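(* Let $n\geq 1$ be an integer and let $(W^{(i)},\ 1\leq i\leq n)$ be independent standard one-dimensional Brownian motions started from $0$. There exist two constants $0<\kappa_1\leq\kappa_2<+\infty$ such that the following estimates hold. (1) (Large deviations) For all sufficiently large $x$, $$\kappa_1\, x^{-\frac{1}{n}}\exp\left(-\frac{n}{2}x^{\frac{2}{n}}\right)\leq \mathbb{P}\left(\sup_{0\leq u\leq 1}\prod_{i=1}^n W_u^{(i)}\geq x\right)\leq \kappa_2\, x^{-\frac{1}{n}}\exp\left(-\frac{n}{2}x^{\frac{2}{n}}\right).$$ (2) (Persistence probability) For all sufficiently small $\varepsilon>0$, $$\kappa_1\,\varepsilon\leq \mathbb{P}\left(\sup_{0\leq u\leq 1}\prod_{i=1}^n W_u^{(i)}\leq \varepsilon\right)\leq \kappa_2\,\varepsilon\,|\ln(\varepsilon)|^{n}.$$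
   Context: The constants $\kappa_1,\kappa_2$ may depend on $n$ but not on $x$ or $\varepsilon$. "Sufficiently large $x$" and "sufficiently small $\varepsilon$" mean that there exist $x_0>0$ and $\varepsilon_0\in(0,1)$ (depending on $n$) such that (1) holds for all $x\geq x_0$ and (2) holds for all $\varepsilon\in(0,\varepsilon_0)$. *)

theory Defs
  imports "HOL-Probability.Probability"
begin

text \<open>
  Only times \<open>t \<ge> 0\<close> matter. Every path (not merely almost every one) is required to be
  continuous: this makes path suprema over compact intervals finite and measurable without
  assuming that \<open>M\<close> is complete.
\<close>

locale standard_brownian_motion = prob_space M for M :: "'a measure" +
  fixes W :: "real \<Rightarrow> 'a \<Rightarrow> real"
  assumes measurable_at: "\<And>t. 0 \<le> t \<Longrightarrow> W t \<in> borel_measurable M"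
    and start_zero: "AE \<omega> in M. W 0 \<omega> = 0"
    and normal_increments: "\<And>s t. 0 \<le> s \<Longrightarrow> s < t \<Longrightarrow>
      distributed M lborel (\<lambda>\<omega>. W t \<omega> - W s \<omega>) (normal_density 0 (sqrt (t - s)))"
    and indep_increments: "\<And>(\<tau> :: nat \<Rightarrow> real) k. 0 \<le> \<tau> 0 \<Longrightarrow> strict_mono_on {..k} \<tau> \<Longrightarrow>
      indep_vars (\<lambda>_. borel) (\<lambda>j \<omega>. W (\<tau> (Suc j)) \<omega> - W (\<tau> j) \<omega>) {..<k}"
    and continuous_paths: "\<And>\<omega>. \<omega> \<in> space M \<Longrightarrow> continuous_on {0..} (\<lambda>t. W t \<omega>)"

text \<open>
  Independence is independence of whole processes, each viewed as a random element of
  the space of functions on \<open>{0..}\<close> with the product \<open>\<sigma>\<close>-algebra.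
\<close>

definition independent_brownian_motions ::
    "'a measure \<Rightarrow> nat \<Rightarrow> (nat \<Rightarrow> real \<Rightarrow> 'a \<Rightarrow> real) \<Rightarrow> bool" where
  "independent_brownian_motions M n W \<longleftrightarrow>
     prob_space M \<and>
     (\<forall>i\<in>{1..n}. standard_brownian_motion M (W i)) \<and>
     prob_space.indep_vars M (\<lambda>_. \<Pi>\<^sub>M t\<in>{0..}. borel) (\<lambda>i \<omega>. \<lambda>t\<in>{0..}. W i t \<omega>) {1..n}"

end

theory Submission
  imports Defs "HOL-Real_Asymp.Real_Asymp"
begin

text \<open>
  Write \<open>M\<^sub>u = \<Prod>\<^sub>i W\<^sup>i\<^sub>u\<close> and \<open>x = y\<^sup>n\<close>.

  Large deviations. If \<open>M\<^sub>u \<ge> y\<^sup>n\<close>, the inequality of arithmetic and geometric means gives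
  \<open>\<Sum>\<^sub>i \<bar>W\<^sup>i\<^sub>u\<bar> \<ge> n y\<close>, so one of the \<open>2\<^sup>n\<close> Brownian motions \<open>(\<Sum>\<^sub>i \<plusminus>W\<^sup>i) / \<surd>n\<close> exceeds \<open>\<surd>n y\<close>
  before time \<open>1\<close>, and Levy's maximal inequality applies. Conversely, \<open>M\<^sub>1 \<ge> y\<^sup>n\<close> contains about
  \<open>y\<^sup>n\<^sup>-\<^sup>1\<close> disjoint cubes of side \<open>1/y\<close>, each of probability of order \<open>y\<^sup>-\<^sup>n exp (- n y\<^sup>2 / 2)\<close>.

  Persistence. Since \<open>M\<close> is a martingale, optional stopping at its exit from \<open>(- \<eta>, \<epsilon>]\<close> shows that
  \<open>M\<close> reaches \<open>- \<eta>\<close> before \<open>\<epsilon>\<close> with probability \<open>O(\<epsilon> / \<eta>)\<close>; and \<open>\<bar>M\<bar>\<close> stays below \<open>\<eta> = N\<^sup>-\<^sup>n\<^sup>/\<^sup>2\<close> with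
  probability at most \<open>q\<^sup>N\<close>, as it has a fixed chance to be larger at each time \<open>k / N\<close>. Take \<open>N\<close>
  proportional to \<open>\<bar>ln \<epsilon>\<bar>\<close>. For the lower bound, with \<open>\<delta>\<close> proportional to \<open>\<epsilon>\<^sup>1\<^sup>/\<^sup>n\<close>, let every
  \<open>W\<^sup>i\<close> be of size \<open>\<delta>\<close> up to time \<open>\<delta>\<^sup>2\<close>, and afterwards \<open>W\<^sup>1 \<le> 0\<close> and \<open>W\<^sup>i \<ge> 0\<close> for \<open>i \<ge> 2\<close>; each
  coordinate does so with probability of order \<open>\<delta>\<close>.
\<close>

subsection \<open>The standard normal distribution\<close>

text \<open>Every estimate is proved for finitely many independent Gaussian increments. A bound
  uniform in the mesh passes to the path along dyadic grids; for the upper bound on persistence a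
  single fine grid is enough, since a small supremum is small on every grid. The obstacle there is
  that a martingale in discrete time jumps over \<epsilon>: a step of mesh h has a fourth moment of
  order h^2, so the total overshoot of 1/h steps is of order h and disappears.

  The factor x^(-1/n) = 1/y is, from above, the 1/a of the Gaussian tail at a = sqrt n * y, and from
  below the number y^(n-1) of cubes times their volume y^(-n). In the upper bound on persistence, N
  of order |ln \<epsilon>| brings the small-ball term below \<epsilon>, and \<epsilon> / \<eta> =
  \<epsilon> N^(n/2) carries the logarithm. In the lower bound the n coordinates cost a factor of
  order \<delta> each, and \<delta>^n is of order \<epsilon>. All constants are explicit in n and
  P(Z \<ge> 1), with Z standard normal, so they serve every probability space at once.\<close>

abbreviation (input) std_gauss :: "real measure" where
  "std_gauss \<equiv> density lborel (\<lambda>x. ennreal (std_normal_density x))"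

interpretation std_gauss: prob_space std_gauss
  using prob_space_normal_density[of 1 0] by simp

lemma (in prob_space) prob_normal_scaled:
  assumes X: "distributed M lborel X (normal_density 0 \<sigma>)" and \<sigma>: "0 < \<sigma>"
    and A: "A \<in> sets borel"
  shows "prob {\<omega> \<in> space M. X \<omega> / \<sigma> \<in> A} = measure std_gauss A"
proof -
  have D: "distributed M lborel (\<lambda>\<omega>. X \<omega> / \<sigma>) (\<lambda>x. ennreal (std_normal_density x))"
    using X normal_standard_normal_convert[OF \<sigma>, of X 0] by simp
  have "measure std_gauss A = measure (distr M lborel (\<lambda>\<omega>. X \<omega> / \<sigma>)) A"
    using distributed_distr_eq_density[OF D] by simp
  also have "\<dots> = prob {\<omega> \<in> space M. X \<omega> / \<sigma> \<in> A}"
    using A distributed_measurable[OF D]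
    by (subst measure_distr) (auto intro!: arg_cong[where f=prob])
  finally show ?thesis by simp
qed

lemma measure_std_gauss_uminus:
  assumes A: "A \<in> sets borel"
  shows "measure std_gauss (uminus -` A) = measure std_gauss A"
proof -
  have "distributed std_gauss lborel (\<lambda>x. x) (\<lambda>x. ennreal (normal_density 0 1 x))"
    by (auto simp: distributed_def distr_id2)
  from std_gauss.normal_density_affine[OF this, of "-1" 0]
  have D: "distributed std_gauss lborel (\<lambda>x. - x) (\<lambda>x. ennreal (normal_density 0 1 x))" by simp
  show ?thesis
    using std_gauss.prob_normal_scaled[OF D _ A] by (simp add: vimage_def)
qed

lemma std_gauss_singleton: "measure std_gauss {a} = 0"
proof -
  have "AE x in lborel. x \<noteq> a" by (rule AE_lborel_singleton)
  then have "(\<integral>\<^sup>+x. ennreal (std_normal_density x) * indicator {a} x \<partial>lborel) = 0"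
    by (subst nn_integral_0_iff_AE) (auto elim!: eventually_mono)
  then show ?thesis by (simp add: measure_def emeasure_density)
qed

lemma std_gauss_half: "measure std_gauss {0..} = 1 / 2" "measure std_gauss {0<..} = 1 / 2"
proof -
  have "uminus -` {0<..} = {..<(0::real)}" by auto
  then have 1: "measure std_gauss {..<0} = measure std_gauss {0<..}"
    using measure_std_gauss_uminus[of "{0<..}"] by simp
  have 2: "measure std_gauss {0..} = measure std_gauss {0<..}"
  proof -
    have "{0..} = {0} \<union> {0<..(0::real)} \<union> {0<..}" by auto
    then have "measure std_gauss ({0..}::real set) = measure std_gauss ({0} \<union> {0<..}::real set)"
      by (intro arg_cong[where f="measure std_gauss"]) auto
    also have "\<dots> = measure std_gauss {0} + measure std_gauss {0<..}"
      by (rule std_gauss.finite_measure_Union) auto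
    finally show ?thesis by (simp add: std_gauss_singleton)
  qed
  have "1 = measure std_gauss ({..<0} \<union> {0..}::real set)"
  proof -
    have "{..<0} \<union> {0..} = (UNIV::real set)" by auto
    then show ?thesis using std_gauss.prob_space by (metis space_density space_borel space_lborel)
  qed
  also have "\<dots> = measure std_gauss {..<0} + measure std_gauss {0..}"
    by (rule std_gauss.finite_measure_Union) auto
  finally show "measure std_gauss {0..} = 1 / 2" "measure std_gauss {0<..} = 1 / 2"
    using 1 2 by auto
qed

text \<open>On \<open>{a..}\<close> the density is at most x / a times exp (- x^2 / 2), which has an
  explicit primitive. The prefactor 1 / a must be kept: it becomes the factor x^(-1/n) of the large
  deviation bound.\<close>

lemma std_gauss_tail_le:
  assumes a: "0 < a"
  shows "measure std_gauss {a..} \<le> exp (- a\<^sup>2 / 2) / a"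
proof -
  have lim: "((\<lambda>x::real. - exp (- x\<^sup>2 / 2)) \<longlongrightarrow> 0) at_top" by real_asymp
  have I: "(\<integral>\<^sup>+x. ennreal (x * exp (- x\<^sup>2 / 2)) * indicator {a..} x \<partial>lborel) = 0 - (- exp (- a\<^sup>2 / 2))"
    using a by (intro nn_integral_FTC_atLeast[OF _ _ _ lim])
      (auto intro!: derivative_eq_intros simp: power2_eq_square)
  have "emeasure std_gauss {a..} = (\<integral>\<^sup>+x. ennreal (std_normal_density x) * indicator {a..} x \<partial>lborel)"
    by (simp add: emeasure_density)
  also have "\<dots> \<le> (\<integral>\<^sup>+x. ennreal (1 / a) * (ennreal (x * exp (- x\<^sup>2 / 2)) * indicator {a..} x) \<partial>lborel)"
  proof (rule nn_integral_mono)
    fix x :: real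
    have "ennreal (std_normal_density x) \<le> ennreal (1 / a) * ennreal (x * exp (- x\<^sup>2 / 2))" if "a \<le> x"
    proof -
      have "1 \<le> sqrt (2 * pi)" using pi_gt3 by simp
      then have "std_normal_density x \<le> 1 * exp (- x\<^sup>2 / 2)"
        unfolding std_normal_density_def by (intro mult_right_mono) auto
      also have "\<dots> \<le> (x / a) * exp (- x\<^sup>2 / 2)" using a that by (intro mult_right_mono) auto
      finally show ?thesis using a that by (subst ennreal_mult[symmetric]) (auto intro!: ennreal_leI)
    qed
    then show "ennreal (std_normal_density x) * indicator {a..} x
      \<le> ennreal (1 / a) * (ennreal (x * exp (- x\<^sup>2 / 2)) * indicator {a..} x)"
      by (auto simp: indicator_def)
  qed
  also have "\<dots> = ennreal (1 / a) * ennreal (exp (- a\<^sup>2 / 2))"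
    using I by (subst nn_integral_cmult) auto
  also have "\<dots> = ennreal (exp (- a\<^sup>2 / 2) / a)" using a by (subst ennreal_mult[symmetric]) auto
  finally show ?thesis using a by (simp add: std_gauss.emeasure_eq_measure divide_nonneg_pos)
qed

text \<open>The density decreases on the positive half-line, so it is at least its value at the
  right end \<open>b\<close>.\<close>

lemma std_gauss_interval_ge:
  assumes a: "0 \<le> a" "a \<le> b"
  shows "(b - a) * (exp (- b\<^sup>2 / 2) / sqrt (2 * pi)) \<le> measure std_gauss {a<..<b}"
proof -
  have "ennreal ((b - a) * (exp (- b\<^sup>2 / 2) / sqrt (2 * pi)))
      = (\<integral>\<^sup>+x. ennreal (exp (- b\<^sup>2 / 2) / sqrt (2 * pi)) * indicator {a<..<b} x \<partial>lborel)"
    using a by (subst nn_integral_cmult_indicator) (auto simp: ennreal_mult[symmetric] mult.commute)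
  also have "\<dots> \<le> (\<integral>\<^sup>+x. ennreal (std_normal_density x) * indicator {a<..<b} x \<partial>lborel)"
  proof (rule nn_integral_mono)
    fix x :: real
    have "exp (- b\<^sup>2 / 2) / sqrt (2 * pi) \<le> std_normal_density x" if "a < x" "x < b"
    proof -
      have "x\<^sup>2 \<le> b\<^sup>2" using a that by (intro power_mono) auto
      then have "exp (- b\<^sup>2 / 2) \<le> exp (- x\<^sup>2 / 2)" by simp
      then show ?thesis unfolding std_normal_density_def
        by (simp add: divide_right_mono)
    qed
    then show "ennreal (exp (- b\<^sup>2 / 2) / sqrt (2 * pi)) * indicator {a<..<b} x
        \<le> ennreal (std_normal_density x) * indicator {a<..<b} x"
      by (auto simp: indicator_def intro!: ennreal_leI)
  qed
  also have "\<dots> = emeasure std_gauss {a<..<b}" by (simp add: emeasure_density)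
  finally show ?thesis by (simp add: std_gauss.emeasure_eq_measure)
qed

lemma std_gauss_tail_pos: "0 < measure std_gauss {a..}"
proof -
  let ?b = "max a 0"
  have "0 < ((?b + 1) - ?b) * (exp (- (?b + 1)\<^sup>2 / 2) / sqrt (2 * pi))" by simp
  also have "\<dots> \<le> measure std_gauss {?b<..<?b + 1}" by (rule std_gauss_interval_ge) auto
  also have "\<dots> \<le> measure std_gauss {a..}" by (intro std_gauss.finite_measure_mono) auto
  finally show ?thesis .
qed

lemma std_gauss_tail_mono: "a \<le> b \<Longrightarrow> measure std_gauss {b..} \<le> measure std_gauss {a..}"
  by (intro std_gauss.finite_measure_mono) auto

text \<open>\<open>1 - 2 P(Z > a) = P(\<bar>Z\<bar> \<le> a)\<close> is what remains after the reflection principle.\<close>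

lemma std_gauss_reflected_ge:
  assumes a: "0 \<le> a" "a \<le> 1"
  shows "a / 4 \<le> 1 - 2 * measure std_gauss {a<..}"
proof -
  have "{0<..} = {0<..a} \<union> {a<..}" and "{0<..a} \<inter> {a<..} = {}" using a by auto
  then have "measure std_gauss {0<..} = measure std_gauss {0<..a} + measure std_gauss {a<..}"
    by (simp add: std_gauss.finite_measure_Union[of "{0<..a}" "{a<..}"])
  moreover have "measure std_gauss {0<..<a} \<le> measure std_gauss {0<..a}"
    by (intro std_gauss.finite_measure_mono) auto
  moreover have "a * (exp (- a\<^sup>2 / 2) / sqrt (2 * pi)) \<le> measure std_gauss {0<..<a}"
    using std_gauss_interval_ge[of 0 a] a by simp
  \<comment> \<open>For \<open>a \<le> 1\<close> the exponential is at least 1/2, and sqrt (2 * pi)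
    is at most 4. By symmetry the claim is about twice P(0 < Z \<le> a), which turns 1/8 into
    1/4.\<close>
  moreover have "a * (1 / 8) \<le> a * (exp (- a\<^sup>2 / 2) / sqrt (2 * pi))"
  proof (intro mult_left_mono)
    have "1 / 2 \<le> 1 + (- a\<^sup>2 / 2)" using a by (simp add: power_le_one)
    also have "\<dots> \<le> exp (- a\<^sup>2 / 2)" by (rule exp_ge_add_one_self)
    finally have 1: "1 / 2 \<le> exp (- a\<^sup>2 / 2)" .
    have "sqrt (2 * pi) \<le> sqrt (4\<^sup>2)" using pi_less_4 by (intro real_sqrt_le_mono) simp
    then have 2: "sqrt (2 * pi) \<le> 4" by simp
    have "1 / 8 = (1/2) / (4::real)" by simp
    also have "\<dots> \<le> exp (- a\<^sup>2 / 2) / sqrt (2 * pi)"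
      using 1 2 by (intro frac_le) auto
    finally show "1 / 8 \<le> exp (- a\<^sup>2 / 2) / sqrt (2 * pi)" .
  qed (use a in auto)
  ultimately show ?thesis using std_gauss_half(2) by argo
qed

lemma (in prob_space) prob_normal_ge:
  assumes X: "distributed M lborel X (normal_density 0 \<sigma>)" and \<sigma>: "0 < \<sigma>"
  shows "prob {\<omega> \<in> space M. \<sigma> * a \<le> X \<omega>} = measure std_gauss {a..}"
    "prob {\<omega> \<in> space M. \<sigma> * a < X \<omega>} = measure std_gauss {a<..}"
    "prob {\<omega> \<in> space M. X \<omega> \<le> \<sigma> * a} = measure std_gauss {..a}"
  using prob_normal_scaled[OF X \<sigma>, of "{a..}"] prob_normal_scaled[OF X \<sigma>, of "{a<..}"]
     prob_normal_scaled[OF X \<sigma>, of "{..a}"] \<sigma>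
  by (simp_all add: field_simps)

text \<open>The vanishing mean makes the product of walks a martingale; the fourth moment controls
  its overshoot.\<close>

lemma (in prob_space) normal_moments:
  assumes X: "distributed M lborel X (normal_density 0 \<sigma>)" and \<sigma>: "0 < \<sigma>"
  shows "integrable M X" "expectation X = 0"
    "integrable M (\<lambda>\<omega>. X \<omega> ^ 4)" "expectation (\<lambda>\<omega>. X \<omega> ^ 4) = 3 * \<sigma> ^ 4"
proof -
  have "integrable lborel (\<lambda>x. normal_density 0 \<sigma> x * x)"
    using integrable_normal_moment_nz_1[OF \<sigma>, of 0] .
  then show "integrable M X"
    using distributed_integrable[OF X, of "\<lambda>x. x"] by simp
  show "expectation X = 0"
    using normal_distributed_expectation[OF \<sigma> X] .
  have 4: "integrable lborel (\<lambda>x. normal_density 0 \<sigma> x * x ^ 4)"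
    using integrable_normal_moment[OF \<sigma>, of 0 4] by simp
  then show "integrable M (\<lambda>\<omega>. X \<omega> ^ 4)"
    using distributed_integrable[OF X, of "\<lambda>x. x ^ 4"] by simp
  have "expectation (\<lambda>\<omega>. X \<omega> ^ 4) = (\<integral>x. normal_density 0 \<sigma> x * x ^ 4 \<partial>lborel)"
    using distributed_integral[OF X, of "\<lambda>x. x ^ 4"] by simp
  also have "\<dots> = 3 * \<sigma> ^ 4"
    using integral_normal_moment_even[OF \<sigma>, of 0 2] \<sigma>
    by (simp add: fact_numeral field_simps power2_eq_square power4_eq_xxxx)
  finally show "expectation (\<lambda>\<omega>. X \<omega> ^ 4) = 3 * \<sigma> ^ 4" .
qed

subsection \<open>Independence\<close>

text \<open>Independence between the rows \<open>Y i\<close> and independence within each row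
  combine: a rectangle over \<open>I \<times> J\<close> is one event per row, and each row event
  factorises again. This merges independence of the processes with independence of the increments of
  each process.\<close>

lemma (in prob_space) indep_vars_nested:
  assumes Y: "indep_vars N Y I" and fin: "finite I" "finite J"
    and f: "\<And>i j. i \<in> I \<Longrightarrow> j \<in> J \<Longrightarrow> f i j \<in> N i \<rightarrow>\<^sub>M K"
    and within: "\<And>i. i \<in> I \<Longrightarrow> indep_vars (\<lambda>_. K) (\<lambda>j \<omega>. f i j (Y i \<omega>)) J"
  shows "indep_vars (\<lambda>_. K) (\<lambda>(i, j) \<omega>. f i j (Y i \<omega>)) (I \<times> J)"
proof (cases "I \<times> J = {}")
  case True
  then show ?thesis by (simp only: indep_vars_def indep_sets_def) auto
next
  case False
  then have ne: "I \<noteq> {}" "J \<noteq> {}" by auto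
  have Y_meas: "Y i \<in> M \<rightarrow>\<^sub>M N i" if "i \<in> I" for i
    using Y that by (auto simp: indep_vars_def)
  show ?thesis
  proof (subst indep_vars_finite[where E="\<lambda>_. sets K"])
    show "sets K = sigma_sets (space K) (sets K)"
      by (simp add: sets.sigma_sets_eq)
    show "(case q of (i, j) \<Rightarrow> \<lambda>\<omega>. f i j (Y i \<omega>)) \<in> M \<rightarrow>\<^sub>M K" if "q \<in> I \<times> J" for q
      using that f Y_meas by (auto split: prod.split intro: measurable_compose)
    show "\<forall>A\<in>I \<times> J \<rightarrow> sets K.
       prob (\<Inter>q\<in>I \<times> J. (case q of (i, j) \<Rightarrow> \<lambda>\<omega>. f i j (Y i \<omega>)) -` A q \<inter> space M)
       = (\<Prod>q\<in>I \<times> J. prob ((case q of (i, j) \<Rightarrow> \<lambda>\<omega>. f i j (Y i \<omega>)) -` A q \<inter> space M))"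
    proof
      fix A assume A: "A \<in> I \<times> J \<rightarrow> sets K"
      \<comment> \<open>All the conditions on row \<open>i\<close>, gathered into one event for
        \<open>Y i\<close>.\<close>
      define B where "B i = (\<Inter>j\<in>J. f i j -` A (i, j) \<inter> space (N i))" for i
      have B: "B i \<in> sets (N i)" if "i \<in> I" for i
        unfolding B_def using fin ne A f that
        by (intro sets.finite_INT) (auto intro!: measurable_sets)
      have Bj: "Y i -` B i \<inter> space M = (\<Inter>j\<in>J. (\<lambda>\<omega>. f i j (Y i \<omega>)) -` A (i, j) \<inter> space M)"
        if "i \<in> I" for i
        using measurable_space[OF Y_meas[OF that]] ne unfolding B_def by auto
      have "(\<Inter>q\<in>I \<times> J. (case q of (i, j) \<Rightarrow> \<lambda>\<omega>. f i j (Y i \<omega>)) -` A q \<inter> space M)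
          = (\<Inter>i\<in>I. \<Inter>j\<in>J. (\<lambda>\<omega>. f i j (Y i \<omega>)) -` A (i, j) \<inter> space M)" by auto
      also have "\<dots> = (\<Inter>i\<in>I. Y i -` B i \<inter> space M)"
        using Bj by auto
      finally have "prob (\<Inter>q\<in>I \<times> J. (case q of (i, j) \<Rightarrow> \<lambda>\<omega>. f i j (Y i \<omega>)) -` A q \<inter> space M)
          = (\<Prod>i\<in>I. prob (Y i -` B i \<inter> space M))"
        using indep_varsD_finite[OF Y ne(1) fin(1) B] by simp
      also have "\<dots> = (\<Prod>i\<in>I. \<Prod>j\<in>J. prob ((\<lambda>\<omega>. f i j (Y i \<omega>)) -` A (i, j) \<inter> space M))"
      proof (intro prod.cong refl)
        fix i assume i: "i \<in> I"
        have "prob (\<Inter>j\<in>J. (\<lambda>\<omega>. f i j (Y i \<omega>)) -` A (i, j) \<inter> space M)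
            = (\<Prod>j\<in>J. prob ((\<lambda>\<omega>. f i j (Y i \<omega>)) -` A (i, j) \<inter> space M))"
          using A i by (intro indep_varsD_finite[OF within[OF i] ne(2) fin(2)]) auto
        then show "prob (Y i -` B i \<inter> space M)
            = (\<Prod>j\<in>J. prob ((\<lambda>\<omega>. f i j (Y i \<omega>)) -` A (i, j) \<inter> space M))"
          unfolding Bj[OF i] .
      qed
      also have "\<dots> = (\<Prod>q\<in>I \<times> J. prob ((case q of (i, j) \<Rightarrow> \<lambda>\<omega>. f i j (Y i \<omega>)) -` A q \<inter> space M))"
        by (simp add: prod.cartesian_product split_def)
      finally show "prob (\<Inter>q\<in>I \<times> J. (case q of (i, j) \<Rightarrow> \<lambda>\<omega>. f i j (Y i \<omega>)) -` A q \<inter> space M)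
       = (\<Prod>q\<in>I \<times> J. prob ((case q of (i, j) \<Rightarrow> \<lambda>\<omega>. f i j (Y i \<omega>)) -` A q \<inter> space M))" .
    qed
  qed (use fin False in \<open>auto simp: sets.Int_stable dest: sets.sets_into_space\<close>)
qed

text \<open>Separates the past from the future of a walk: \<open>P\<close> and \<open>Q\<close> see
  disjoint blocks of the same independent family.\<close>

lemma (in prob_space) indep_restrict_prob:
  assumes ind: "indep_vars N X I" and AB: "A \<inter> B = {}" "A \<subseteq> I" "B \<subseteq> I"
    and P: "Measurable.pred (PiM A N) P" and Q: "Measurable.pred (PiM B N) Q"
  shows "prob {\<omega> \<in> space M. P (\<lambda>i\<in>A. X i \<omega>) \<and> Q (\<lambda>i\<in>B. X i \<omega>)}
    = prob {\<omega> \<in> space M. P (\<lambda>i\<in>A. X i \<omega>)} * prob {\<omega> \<in> space M. Q (\<lambda>i\<in>B. X i \<omega>)}"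
proof -
  let ?P = "{x \<in> space (PiM A N). P x}" and ?Q = "{x \<in> space (PiM B N). Q x}"
  have iv: "indep_var (PiM A N) (\<lambda>\<omega>. \<lambda>i\<in>A. X i \<omega>) (PiM B N) (\<lambda>\<omega>. \<lambda>i\<in>B. X i \<omega>)"
    by (rule indep_var_restrict[OF ind AB])
  have sp: "(\<lambda>i\<in>A. X i \<omega>) \<in> space (PiM A N)" "(\<lambda>i\<in>B. X i \<omega>) \<in> space (PiM B N)"
    if "\<omega> \<in> space M" for \<omega>
    using measurable_space[OF indep_var_rv1[OF iv] that] measurable_space[OF indep_var_rv2[OF iv] that] .
  have "?P \<in> sets (PiM A N)" "?Q \<in> sets (PiM B N)"
    using P Q by (auto simp: pred_def)
  note eq = indep_varD[OF iv this]
  have "(\<lambda>\<omega>. ((\<lambda>i\<in>A. X i \<omega>), (\<lambda>i\<in>B. X i \<omega>))) -` (?P \<times> ?Q) \<inter> space M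
      = {\<omega> \<in> space M. P (\<lambda>i\<in>A. X i \<omega>) \<and> Q (\<lambda>i\<in>B. X i \<omega>)}"
    "(\<lambda>\<omega>. \<lambda>i\<in>A. X i \<omega>) -` ?P \<inter> space M = {\<omega> \<in> space M. P (\<lambda>i\<in>A. X i \<omega>)}"
    "(\<lambda>\<omega>. \<lambda>i\<in>B. X i \<omega>) -` ?Q \<inter> space M = {\<omega> \<in> space M. Q (\<lambda>i\<in>B. X i \<omega>)}"
    using sp by blast+
  with eq show ?thesis by simp
qed

text \<open>The joint law is a product measure, so Fubini allows the first variable to be frozen.
  This takes the place of conditional expectation given the past.\<close>

lemma (in prob_space) indep_var_expectation:
  fixes F :: "'b \<times> 'b \<Rightarrow> real"
  assumes ind: "indep_var S X T Y" and F: "F \<in> borel_measurable (S \<Otimes>\<^sub>M T)"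
    and int: "integrable M (\<lambda>\<omega>. F (X \<omega>, Y \<omega>))"
  shows "expectation (\<lambda>\<omega>. F (X \<omega>, Y \<omega>)) = expectation (\<lambda>\<omega>. expectation (\<lambda>\<omega>'. F (X \<omega>, Y \<omega>')))"
proof -
  have X[measurable]: "X \<in> M \<rightarrow>\<^sub>M S" and Y[measurable]: "Y \<in> M \<rightarrow>\<^sub>M T"
    using ind indep_var_rv1 indep_var_rv2 by auto
  note F[measurable]
  have eq: "distr M S X \<Otimes>\<^sub>M distr M T Y = distr M (S \<Otimes>\<^sub>M T) (\<lambda>x. (X x, Y x))"
    using ind indep_var_distribution_eq by blast
  interpret X: prob_space "distr M S X" by (rule prob_space_distr) simp
  interpret Y: prob_space "distr M T Y" by (rule prob_space_distr) simp
  interpret XY: pair_prob_space "distr M S X" "distr M T Y" ..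
  have "integrable (distr M S X \<Otimes>\<^sub>M distr M T Y) F"
    unfolding eq using int by (subst integrable_distr_eq) auto
  note fub = XY.integral_fst'[OF this]
  have "expectation (\<lambda>\<omega>. F (X \<omega>, Y \<omega>)) = (\<integral>z. F z \<partial>(distr M S X \<Otimes>\<^sub>M distr M T Y))"
    unfolding eq by (subst integral_distr) auto
  also have "\<dots> = (\<integral>x. (\<integral>y. F (x, y) \<partial>distr M T Y) \<partial>distr M S X)" using fub ..
  also have "\<dots> = expectation (\<lambda>\<omega>. (\<integral>y. F (X \<omega>, y) \<partial>distr M T Y))"
    by (subst integral_distr) (auto intro!: Y.borel_measurable_lebesgue_integral)
  also have "\<dots> = expectation (\<lambda>\<omega>. expectation (\<lambda>\<omega>'. F (X \<omega>, Y \<omega>')))"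
    using measurable_space[OF X] by (intro Bochner_Integration.integral_cong refl integral_distr) auto
  finally show ?thesis .
qed

text \<open>With \<open>X\<close> frozen at \<open>x\<close>, the conditional probability of
  \<open>R\<close> is at most \<open>c\<close> whatever \<open>x\<close> is, and the event
  \<open>Q\<close> depends on \<open>x\<close> alone. It is the induction step for staying in a
  small ball.\<close>

lemma (in prob_space) indep_var_prob_le:
  assumes ind: "indep_var S X T Y"
    and R: "Measurable.pred (S \<Otimes>\<^sub>M T) (\<lambda>(x, y). R x y)" and Q: "Measurable.pred S Q"
    and le: "\<And>x. x \<in> space S \<Longrightarrow> prob {\<omega> \<in> space M. R x (Y \<omega>)} \<le> c"
  shows "prob {\<omega> \<in> space M. Q (X \<omega>) \<and> R (X \<omega>) (Y \<omega>)} \<le> c * prob {\<omega> \<in> space M. Q (X \<omega>)}"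
proof -
  have X[measurable]: "X \<in> M \<rightarrow>\<^sub>M S" and Y[measurable]: "Y \<in> M \<rightarrow>\<^sub>M T"
    using ind indep_var_rv1 indep_var_rv2 by auto
  note R[measurable] Q[measurable]
  define F :: "_ \<Rightarrow> real" where "F = indicat_real {z \<in> space (S \<Otimes>\<^sub>M T). Q (fst z) \<and> (\<lambda>(x, y). R x y) z}"
  have F[measurable]: "F \<in> borel_measurable (S \<Otimes>\<^sub>M T)" unfolding F_def by measurable
  have F_eq: "F (X \<omega>, Y \<omega>') = indicat_real {\<omega> \<in> space M. Q (X \<omega>)} \<omega> * indicat_real {\<omega>' \<in> space M. R (X \<omega>) (Y \<omega>')} \<omega>'"
    if "\<omega> \<in> space M" "\<omega>' \<in> space M" for \<omega> \<omega>'
    using measurable_space[OF X that(1)] measurable_space[OF Y that(2)] that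
    by (auto simp: F_def indicator_def space_pair_measure)
  have Rx: "{\<omega>' \<in> space M. R x (Y \<omega>')} \<in> sets M" if "x \<in> space S" for x
    using that by measurable
  have int: "integrable M (\<lambda>\<omega>. F (X \<omega>, Y \<omega>))"
    by (rule integrable_const_bound[where B=1]) (auto simp: F_def indicator_def)
  have "prob {\<omega> \<in> space M. Q (X \<omega>) \<and> R (X \<omega>) (Y \<omega>)}
      = expectation (indicat_real {\<omega> \<in> space M. Q (X \<omega>) \<and> (\<lambda>(x, y). R x y) (X \<omega>, Y \<omega>)})"
    by simp
  also have "\<dots> = expectation (\<lambda>\<omega>. F (X \<omega>, Y \<omega>))"
    by (intro Bochner_Integration.integral_cong refl) (simp add: F_eq, auto simp: indicator_def)
  also have "\<dots> = expectation (\<lambda>\<omega>. expectation (\<lambda>\<omega>'. F (X \<omega>, Y \<omega>')))"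
    by (rule indep_var_expectation[OF ind F int])
  also have "\<dots> = expectation (\<lambda>\<omega>. indicat_real {\<omega> \<in> space M. Q (X \<omega>)} \<omega> * prob {\<omega>' \<in> space M. R (X \<omega>) (Y \<omega>')})"
  proof (intro Bochner_Integration.integral_cong refl)
    fix \<omega> assume w: "\<omega> \<in> space M"
    have "expectation (\<lambda>\<omega>'. F (X \<omega>, Y \<omega>')) = expectation (\<lambda>\<omega>'.
        indicat_real {\<omega> \<in> space M. Q (X \<omega>)} \<omega> * indicat_real {\<omega>' \<in> space M. R (X \<omega>) (Y \<omega>')} \<omega>')"
      using F_eq w by (intro Bochner_Integration.integral_cong refl) auto
    then show "expectation (\<lambda>\<omega>'. F (X \<omega>, Y \<omega>'))
      = indicat_real {\<omega> \<in> space M. Q (X \<omega>)} \<omega> * prob {\<omega>' \<in> space M. R (X \<omega>) (Y \<omega>')}"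
      using Rx[OF measurable_space[OF X w]] by simp
  qed
  also have "\<dots> \<le> expectation (\<lambda>\<omega>. indicat_real {\<omega> \<in> space M. Q (X \<omega>)} \<omega> * c)"
  proof (rule integral_mono')
    show "integrable M (\<lambda>\<omega>. indicat_real {\<omega> \<in> space M. Q (X \<omega>)} \<omega> * c)"
      by (intro integrable_mult_left integrable_real_indicator) (auto simp: less_top[symmetric])
    fix \<omega> assume w: "\<omega> \<in> space M"
    show "indicat_real {\<omega> \<in> space M. Q (X \<omega>)} \<omega> * prob {\<omega>' \<in> space M. R (X \<omega>) (Y \<omega>')}
      \<le> indicat_real {\<omega> \<in> space M. Q (X \<omega>)} \<omega> * c"
      using le[OF measurable_space[OF X w]] by (intro mult_left_mono) auto
    \<comment> \<open>\<open>c\<close> is nonnegative because \<open>le\<close> at the point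
      \<open>X \<omega>\<close> bounds a probability by it.\<close>
    show "0 \<le> indicat_real {\<omega> \<in> space M. Q (X \<omega>)} \<omega> * c"
      using le[OF measurable_space[OF X w]] order.trans[OF measure_nonneg] by (intro mult_nonneg_nonneg) auto
  qed
  also have "\<dots> = c * prob {\<omega> \<in> space M. Q (X \<omega>)}"
    by (subst integral_mult_left_zero) auto
  finally show ?thesis .
qed

subsection \<open>Levy's maximal inequality\<close>

text \<open>Split by the first index \<open>k\<close> at which the partial sum exceeds
  \<open>a\<close> (the event \<open>F k\<close>). The sum of the later terms is independent of
  \<open>F k\<close> and symmetric, hence nonnegative with probability at least 1/2, and then the
  final sum exceeds \<open>a\<close> as well.\<close>

lemma (in prob_space) Levy_maximal_inequality:
  fixes X :: "nat \<Rightarrow> 'a \<Rightarrow> real"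
  assumes ind: "indep_vars (\<lambda>_. borel) X {..<L}"
    and norm: "\<And>j. j < L \<Longrightarrow> distributed M lborel (X j) (normal_density 0 (s j))"
    and s: "\<And>j. j < L \<Longrightarrow> 0 < s j"
  shows "prob {\<omega> \<in> space M. \<exists>k\<le>L. a < (\<Sum>j<k. X j \<omega>)} \<le> 2 * prob {\<omega> \<in> space M. a < (\<Sum>j<L. X j \<omega>)}"
proof -
  have X: "X j \<in> borel_measurable M" if "j < L" for j
    using ind that by (auto simp: indep_vars_def)
  define S where "S k \<omega> = (\<Sum>j<k. X j \<omega>)" for k \<omega>
  have S: "S k \<in> borel_measurable M" if "k \<le> L" for k
    unfolding S_def using that by (auto intro!: borel_measurable_sum X)
  define F where "F k = {\<omega> \<in> space M. a < S k \<omega> \<and> (\<forall>l<k. S l \<omega> \<le> a)}" for k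
  let ?E = "{\<omega> \<in> space M. a < S L \<omega>}"
  have F: "F k \<in> sets M" if "k \<le> L" for k
  proof -
    have "{\<omega> \<in> space M. \<forall>l\<in>{..<k}. S l \<omega> \<le> a} \<in> sets M"
      using that by (intro sets.sets_Collect_finite_All borel_measurable_le S) auto
    moreover have "{\<omega> \<in> space M. a < S k \<omega>} \<in> sets M"
      using that by (intro borel_measurable_less S) auto
    moreover have "F k = {\<omega> \<in> space M. a < S k \<omega>} \<inter> {\<omega> \<in> space M. \<forall>l\<in>{..<k}. S l \<omega> \<le> a}"
      by (auto simp: F_def)
    ultimately show ?thesis by simp
  qed
  have E: "?E \<in> sets M" by (intro borel_measurable_less S) auto
  have half: "prob (F k) \<le> 2 * prob (F k \<inter> ?E)" if k: "k \<le> L" for k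
  proof -
    define R where "R \<omega> = (\<Sum>j\<in>{k..<L}. X j \<omega>)" for \<omega>
    have SL: "S L \<omega> = S k \<omega> + R \<omega>" for \<omega>
      unfolding S_def R_def using k by (metis atLeast0LessThan le0 sum.atLeastLessThan_concat)
    have R_half: "1 / 2 \<le> prob {\<omega> \<in> space M. 0 \<le> R \<omega>}"
    \<comment> \<open>An empty sum has no density, so the last index is treated apart; there
      \<open>R\<close> is \<open>0\<close>.\<close>
    proof (cases "k = L")
      case True
      then show ?thesis by (simp add: R_def prob_space)
    next
      case False
      let ?\<sigma> = "sqrt (\<Sum>j\<in>{k..<L}. (s j)\<^sup>2)"
      have "distributed M lborel R (normal_density (\<Sum>j\<in>{k..<L}. 0) ?\<sigma>)"
        unfolding R_def using False k norm s
        by (intro sum_indep_normal indep_vars_subset[OF ind]) auto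
      then have D: "distributed M lborel R (normal_density 0 ?\<sigma>)" by simp
      have "0 < (\<Sum>j\<in>{k..<L}. (s j)\<^sup>2)" using False k s by (intro sum_pos zero_less_power) auto
      then have "0 < ?\<sigma>" by simp
      from prob_normal_ge(1)[OF D this, of 0] show ?thesis by (simp add: std_gauss_half)
    qed
    \<comment> \<open>First passage and remainder, written as predicates on the terms before
      \<open>k\<close> and from \<open>k\<close> on, so that independence of disjoint blocks
      applies.\<close>
    define P where "P p \<longleftrightarrow> a < (\<Sum>j<k. p j) \<and> (\<forall>l<k. (\<Sum>j<l. p j) \<le> a)" for p :: "nat \<Rightarrow> real"
    define Q where "Q p \<longleftrightarrow> 0 \<le> (\<Sum>j\<in>{k..<L}. p j)" for p :: "nat \<Rightarrow> real"
    have P: "P (\<lambda>i\<in>{..<k}. X i \<omega>) \<longleftrightarrow> a < S k \<omega> \<and> (\<forall>l<k. S l \<omega> \<le> a)" for \<omega>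
      unfolding P_def S_def by auto
    have Q: "Q (\<lambda>i\<in>{k..<L}. X i \<omega>) \<longleftrightarrow> 0 \<le> R \<omega>" for \<omega>
      unfolding Q_def R_def by auto
    have [measurable]: "(\<lambda>p. \<Sum>j<l. p j) \<in> borel_measurable (PiM {..<k} (\<lambda>_. borel :: real measure))" if "l \<le> k" for l
      using that by (intro borel_measurable_sum) auto
    have [measurable]: "(\<lambda>p. \<Sum>j\<in>{k..<L}. p j) \<in> borel_measurable (PiM {k..<L} (\<lambda>_. borel :: real measure))"
      by (intro borel_measurable_sum) auto
    have "prob {\<omega> \<in> space M. P (\<lambda>i\<in>{..<k}. X i \<omega>) \<and> Q (\<lambda>i\<in>{k..<L}. X i \<omega>)}
      = prob {\<omega> \<in> space M. P (\<lambda>i\<in>{..<k}. X i \<omega>)} * prob {\<omega> \<in> space M. Q (\<lambda>i\<in>{k..<L}. X i \<omega>)}"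
      by (rule indep_restrict_prob[OF ind]) (use k in \<open>auto simp: P_def Q_def\<close>)
    then have "prob (F k) * prob {\<omega> \<in> space M. 0 \<le> R \<omega>}
      = prob {\<omega> \<in> space M. (a < S k \<omega> \<and> (\<forall>l<k. S l \<omega> \<le> a)) \<and> 0 \<le> R \<omega>}"
      unfolding P Q by (simp add: F_def)
    also have "\<dots> \<le> prob (F k \<inter> ?E)"
      using F[OF k] E by (intro finite_measure_mono) (auto simp: F_def SL)
    finally have "prob (F k) * prob {\<omega> \<in> space M. 0 \<le> R \<omega>} \<le> prob (F k \<inter> ?E)" .
    moreover have "prob (F k) * (1 / 2) \<le> prob (F k) * prob {\<omega> \<in> space M. 0 \<le> R \<omega>}"
      using R_half by (intro mult_left_mono) auto
    ultimately show ?thesis by linarith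
  qed
  have dis: "disjoint_family_on F {..L}"
    unfolding disjoint_family_on_def F_def
  proof (intro ballI impI)
    fix k l :: nat assume "k \<noteq> l"
    then have "k < l \<or> l < k" by auto
    then show "{\<omega> \<in> space M. a < S k \<omega> \<and> (\<forall>l<k. S l \<omega> \<le> a)} \<inter> {\<omega> \<in> space M. a < S l \<omega> \<and> (\<forall>k<l. S k \<omega> \<le> a)} = {}"
      by fastforce
  qed
  have un: "{\<omega> \<in> space M. \<exists>k\<le>L. a < S k \<omega>} = (\<Union>k\<in>{..L}. F k)"
  proof (intro equalityI subsetI)
    fix \<omega> assume "\<omega> \<in> {\<omega> \<in> space M. \<exists>k\<le>L. a < S k \<omega>}"
    then have w: "\<omega> \<in> space M" and "\<exists>k. k \<le> L \<and> a < S k \<omega>" by auto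
    from exists_least_iff[THEN iffD1, OF this(2)] obtain k where
      "k \<le> L" "a < S k \<omega>" "\<And>l. l < k \<Longrightarrow> \<not> (l \<le> L \<and> a < S l \<omega>)" by blast
    with w show "\<omega> \<in> (\<Union>k\<in>{..L}. F k)"
      by (auto simp: F_def not_less intro!: bexI[of _ k])
  qed (auto simp: F_def)
  have "prob {\<omega> \<in> space M. \<exists>k\<le>L. a < S k \<omega>} = (\<Sum>k\<le>L. prob (F k))"
    unfolding un using F dis by (intro finite_measure_finite_Union) auto
  also have "\<dots> \<le> (\<Sum>k\<le>L. 2 * prob (F k \<inter> ?E))"
    using half by (intro sum_mono) auto
  also have "\<dots> = 2 * prob (\<Union>k\<in>{..L}. F k \<inter> ?E)"
  proof -
    have "prob (\<Union>k\<in>{..L}. F k \<inter> ?E) = (\<Sum>k\<le>L. prob (F k \<inter> ?E))"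
      using F E dis by (intro finite_measure_finite_Union)
        (auto simp: disjoint_family_on_def intro!: sets.Int)
    then show ?thesis by (simp add: sum_distrib_left)
  qed
  also have "\<dots> \<le> 2 * prob ?E"
    using E by (intro mult_left_mono finite_measure_mono) auto
  finally show ?thesis by (simp add: S_def)
qed

subsection \<open>Products of independent Gaussian random walks\<close>

text \<open>Exchange one factor at a time, using (u + v)^4 \<le> 8 (u^4 + v^4) at each exchange. The
  untouched factors are bounded by \<open>a j ^ 4 + b j ^ 4\<close>, so that each summand is a
  product of functions of single coordinates, whose expectation factorises under
  independence.\<close>

lemma power4_prod_diff_le:
  fixes a b :: "'i \<Rightarrow> real"
  assumes "finite I"
  shows "((\<Prod>i\<in>I. b i) - (\<Prod>i\<in>I. a i)) ^ 4
    \<le> 8 ^ card I * (\<Sum>i\<in>I. \<Prod>j\<in>I. if j = i then (b j - a j) ^ 4 else a j ^ 4 + b j ^ 4)"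
  using assms
proof (induction I rule: finite_induct)
  case empty
  then show ?case by simp
next
  case (insert k I)
  let ?c = "\<lambda>i j. if j = i then (b j - a j) ^ 4 else a j ^ 4 + b j ^ 4"
  have c_nn: "0 \<le> ?c i j" for i j by simp
  have two: "(u + v) ^ 4 \<le> 8 * (u ^ 4 + v ^ 4)" for u v :: real
  proof -
    have "(u + v)\<^sup>2 \<le> 2 * (u\<^sup>2 + v\<^sup>2)"
      using zero_le_power2[of "u - v"] by (simp add: power2_eq_square algebra_simps)
    then have "((u + v)\<^sup>2)\<^sup>2 \<le> (2 * (u\<^sup>2 + v\<^sup>2))\<^sup>2" by (intro power_mono) auto
    also have "\<dots> \<le> 8 * (u ^ 4 + v ^ 4)"
      using zero_le_power2[of "u\<^sup>2 - v\<^sup>2"] by (simp add: power2_eq_square power4_eq_xxxx algebra_simps)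
    finally show ?thesis by simp
  qed
  let ?B = "\<Prod>i\<in>I. b i" and ?A = "\<Prod>i\<in>I. a i"
  \<comment> \<open>As \<open>k\<close> is not in \<open>I\<close>, every factor of
    \<open>?c k\<close> over \<open>I\<close> is of the form
    \<open>a j ^ 4 + b j ^ 4\<close>.\<close>
  have B4: "?B ^ 4 \<le> (\<Prod>j\<in>I. ?c k j)"
    unfolding prod_power_distrib using insert.hyps by (intro prod_mono) auto
  have "(\<Prod>i\<in>insert k I. b i) - (\<Prod>i\<in>insert k I. a i) = (b k - a k) * ?B + a k * (?B - ?A)"
    using insert.hyps by (simp add: algebra_simps)
  then have "((\<Prod>i\<in>insert k I. b i) - (\<Prod>i\<in>insert k I. a i)) ^ 4
      \<le> 8 * ((b k - a k) ^ 4 * ?B ^ 4 + a k ^ 4 * (?B - ?A) ^ 4)"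
    using two[of "(b k - a k) * ?B" "a k * (?B - ?A)"] by (simp add: power_mult_distrib)
  also have "\<dots> \<le> 8 * ((b k - a k) ^ 4 * (8 ^ card I * (\<Prod>j\<in>I. ?c k j))
      + (a k ^ 4 + b k ^ 4) * (8 ^ card I * (\<Sum>i\<in>I. \<Prod>j\<in>I. ?c i j)))"
  proof (intro mult_left_mono add_mono mult_mono)
    have "(\<Prod>j\<in>I. ?c k j) \<le> 8 ^ card I * (\<Prod>j\<in>I. ?c k j)"
      using prod_nonneg[of I "?c k"] c_nn by (simp add: mult_le_cancel_right1)
    with B4 show "?B ^ 4 \<le> 8 ^ card I * (\<Prod>j\<in>I. ?c k j)" by linarith
  qed (use insert.IH in auto)
  also have "\<dots> = 8 ^ card (insert k I) * ((\<Prod>j\<in>insert k I. ?c k j) + (\<Sum>i\<in>I. (\<Prod>j\<in>insert k I. ?c i j)))"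
  proof -
    have "(\<Sum>i\<in>I. (\<Prod>j\<in>insert k I. ?c i j)) = (\<Sum>i\<in>I. (a k ^ 4 + b k ^ 4) * (\<Prod>j\<in>I. ?c i j))"
      using insert.hyps by (intro sum.cong refl) (subst prod.insert, auto)
    moreover have "(\<Prod>j\<in>insert k I. ?c k j) = (b k - a k) ^ 4 * (\<Prod>j\<in>I. ?c k j)"
      using insert.hyps by simp
    ultimately show ?thesis using insert.hyps
      by (simp add: sum_distrib_left algebra_simps)
  qed
  also have "\<dots> = 8 ^ card (insert k I) * (\<Sum>i\<in>insert k I. \<Prod>j\<in>insert k I. ?c i j)"
    using insert.hyps by simp
  finally show ?case .
qed

text \<open>Increments of several Brownian motions on a grid of mesh \<open>h\<close>: the first
  index is the coordinate, the second the time step. The upper bound on persistence instantiates it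
  with two different meshes.\<close>

locale gaussian_array = prob_space M for M :: "'a measure" +
  fixes I :: "'i set" and L :: nat and h :: real and X :: "'i \<times> nat \<Rightarrow> 'a \<Rightarrow> real"
  assumes finite_I: "finite I" and I_nonempty: "I \<noteq> {}" and h_pos: "0 < h"
    and indep: "indep_vars (\<lambda>_. borel) X (I \<times> {..<L})"
    and normal: "\<And>i j. i \<in> I \<Longrightarrow> j < L \<Longrightarrow> distributed M lborel (X (i, j)) (normal_density 0 (sqrt h))"
begin

definition walk :: "nat \<Rightarrow> 'i \<Rightarrow> 'a \<Rightarrow> real" where
  "walk k i \<omega> = (\<Sum>j<k. X (i, j) \<omega>)"

definition walk_prod :: "nat \<Rightarrow> 'a \<Rightarrow> real" where
  "walk_prod k \<omega> = (\<Prod>i\<in>I. walk k i \<omega>)"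

abbreviation past_space :: "nat \<Rightarrow> ('i \<times> nat \<Rightarrow> real) measure" where
  "past_space k \<equiv> PiM (I \<times> {..<k}) (\<lambda>_. borel)"

text \<open>Stands for the natural filtration: an event known at time \<open>k\<close> is a
  measurable predicate of \<open>past k\<close>.\<close>

definition past :: "nat \<Rightarrow> 'a \<Rightarrow> 'i \<times> nat \<Rightarrow> real" where
  "past k \<omega> = (\<lambda>q\<in>I \<times> {..<k}. X q \<omega>)"

lemma X_measurable: "i \<in> I \<Longrightarrow> j < L \<Longrightarrow> X (i, j) \<in> borel_measurable M"
  using indep by (auto simp: indep_vars_def)

lemma walk_measurable: "i \<in> I \<Longrightarrow> k \<le> L \<Longrightarrow> walk k i \<in> borel_measurable M"
  unfolding walk_def[abs_def] by (intro borel_measurable_sum X_measurable) auto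

lemma walk_prod_measurable: "k \<le> L \<Longrightarrow> walk_prod k \<in> borel_measurable M"
  unfolding walk_prod_def[abs_def] by (intro borel_measurable_prod walk_measurable) auto

lemma walk_Suc: "walk (Suc k) i \<omega> = walk k i \<omega> + X (i, k) \<omega>"
  by (simp add: walk_def)

lemma walk_past: "i \<in> I \<Longrightarrow> l \<le> k \<Longrightarrow> (\<Sum>j<l. past k \<omega> (i, j)) = walk l i \<omega>"
  unfolding walk_def past_def by (intro sum.cong) auto

lemma walk_prod_past: "l \<le> k \<Longrightarrow> (\<Prod>i\<in>I. \<Sum>j<l. past k \<omega> (i, j)) = walk_prod l \<omega>"
  unfolding walk_prod_def by (intro prod.cong) (auto simp: walk_past)

lemma past_prod_measurable:
  "l \<le> k \<Longrightarrow> (\<lambda>p. \<Prod>i\<in>I. \<Sum>j<l. p (i, j)) \<in> borel_measurable (past_space k)"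
  by (intro borel_measurable_prod borel_measurable_sum measurable_component_singleton) auto

lemma indep_past_next:
  "k < L \<Longrightarrow> indep_var (past_space k) (past k) (PiM (I \<times> {k}) (\<lambda>_. borel)) (\<lambda>\<omega>. \<lambda>q\<in>I \<times> {k}. X q \<omega>)"
  unfolding past_def[abs_def] by (rule indep_var_restrict[OF indep]) auto

text \<open>The blocks \<open>{i} \<times> {..<k}\<close> are disjoint, so functions of the separate
  coordinate histories are independent. Instances are the walks at time \<open>k\<close>, their next
  steps, and the factors of the fourth moment bound.\<close>

lemma indep_columns:
  assumes k: "k \<le> L" and f: "\<And>i. i \<in> I \<Longrightarrow> f i \<in> borel_measurable (PiM ({i} \<times> {..<k}) (\<lambda>_. borel))"
  shows "indep_vars (\<lambda>_. borel) (\<lambda>i \<omega>. f i (\<lambda>q\<in>{i} \<times> {..<k}. X q \<omega>)) I"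
proof (rule indep_vars_compose2[where X="\<lambda>i \<omega>. \<lambda>q\<in>{i} \<times> {..<k}. X q \<omega>" and Y=f])
  show "indep_vars (\<lambda>i. PiM ({i} \<times> {..<k}) (\<lambda>_. borel)) (\<lambda>i \<omega>. \<lambda>q\<in>{i} \<times> {..<k}. X q \<omega>) I"
    using k by (intro indep_vars_restrict[OF indep]) (auto simp: disjoint_family_on_def)
qed (use f in auto)

lemma walk_normal:
  assumes i: "i \<in> I" and k: "0 < k" "k \<le> L"
  shows "distributed M lborel (walk k i) (normal_density 0 (sqrt (real k * h)))"
proof -
  have inj: "inj_on (Pair i) {..<k}" by (simp add: inj_on_def)
  have "distributed M lborel (\<lambda>\<omega>. \<Sum>q\<in>{i} \<times> {..<k}. X q \<omega>)
     (normal_density (\<Sum>q\<in>{i} \<times> {..<k}. 0) (sqrt (\<Sum>q\<in>{i} \<times> {..<k}. (sqrt h)\<^sup>2)))"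
    using i k h_pos by (intro sum_indep_normal indep_vars_subset[OF indep]) (auto intro: normal)
  moreover have "(\<lambda>\<omega>. \<Sum>q\<in>{i} \<times> {..<k}. X q \<omega>) = walk k i"
  proof
    have "{i} \<times> {..<k} = Pair i ` {..<k}" by auto
    then show "(\<Sum>q\<in>{i} \<times> {..<k}. X q \<omega>) = walk k i \<omega>" for \<omega>
      using inj by (simp add: walk_def sum.reindex)
  qed
  ultimately show ?thesis using h_pos by (simp add: mult.commute)
qed

lemma walk_moments:
  assumes i: "i \<in> I" and k: "k \<le> L"
  shows "integrable M (walk k i)" "integrable M (\<lambda>\<omega>. walk k i \<omega> ^ 4)"
    "expectation (\<lambda>\<omega>. walk k i \<omega> ^ 4) = 3 * (real k * h)\<^sup>2"
proof -
  have *: "integrable M (walk k i) \<and> integrable M (\<lambda>\<omega>. walk k i \<omega> ^ 4)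
    \<and> expectation (\<lambda>\<omega>. walk k i \<omega> ^ 4) = 3 * (real k * h)\<^sup>2"
  proof (cases "k = 0")
    case True
    then show ?thesis by (simp add: walk_def[abs_def])
  next
    case False
    then have "0 < sqrt (real k * h)" using h_pos by simp
    note m = normal_moments[OF walk_normal[OF i _ k] this]
    have "sqrt (real k * h) ^ 4 = (real k * h)\<^sup>2"
      using h_pos by (simp add: power4_eq_xxxx power2_eq_square flip: real_sqrt_mult)
    with m False show ?thesis by auto
  qed
  then show "integrable M (walk k i)" "integrable M (\<lambda>\<omega>. walk k i \<omega> ^ 4)"
    "expectation (\<lambda>\<omega>. walk k i \<omega> ^ 4) = 3 * (real k * h)\<^sup>2" by auto
qed

lemma X_moments:
  assumes i: "i \<in> I" and k: "k < L"
  shows "integrable M (X (i, k))" "expectation (X (i, k)) = 0"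
    "integrable M (\<lambda>\<omega>. X (i, k) \<omega> ^ 4)" "expectation (\<lambda>\<omega>. X (i, k) \<omega> ^ 4) = 3 * h\<^sup>2"
proof -
  have "0 < sqrt h" using h_pos by simp
  note m = normal_moments[OF normal[OF i k] this]
  moreover have "sqrt h ^ 4 = h\<^sup>2"
    using h_pos by (simp add: power4_eq_xxxx power2_eq_square flip: real_sqrt_mult)
  ultimately show "integrable M (X (i, k))" "expectation (X (i, k)) = 0"
    "integrable M (\<lambda>\<omega>. X (i, k) \<omega> ^ 4)" "expectation (\<lambda>\<omega>. X (i, k) \<omega> ^ 4) = 3 * h\<^sup>2" by auto
qed

lemma indep_walks:
  assumes k: "k \<le> L" shows "indep_vars (\<lambda>_. borel) (walk k) I"
proof -
  have "indep_vars (\<lambda>_. borel) (\<lambda>i \<omega>. \<Sum>j<k. (\<lambda>q\<in>{i} \<times> {..<k}. X q \<omega>) (i, j)) I"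
    by (rule indep_columns[OF k, of "\<lambda>i p. \<Sum>j<k. p (i, j)"])
      (intro borel_measurable_sum measurable_component_singleton, auto)
  then show ?thesis
    by (rule indep_vars_cong[THEN iffD1, rotated 3]) (auto simp: walk_def fun_eq_iff)
qed

lemma indep_steps:
  assumes k: "k < L" shows "indep_vars (\<lambda>_. borel) (\<lambda>i. X (i, k)) I"
proof -
  have "indep_vars (\<lambda>_. borel) (\<lambda>i \<omega>. (\<lambda>q\<in>{i} \<times> {..<Suc k}. X q \<omega>) (i, k)) I"
    using k by (intro indep_columns[of _ "\<lambda>i p. p (i, k)"] measurable_component_singleton) auto
  then show ?thesis
    by (rule indep_vars_cong[THEN iffD1, rotated 3]) (auto simp: fun_eq_iff)
qed

section \<open>The product of the walks: fourth moments of its steps, martingale property, small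
  balls, exit from an interval\<close>

lemma walk_prod_integrable: "k \<le> L \<Longrightarrow> integrable M (walk_prod k)"
  unfolding walk_prod_def[abs_def]
  using finite_I indep_walks walk_moments by (intro indep_vars_integrable) auto

text \<open>In each summand of \<open>power4_prod_diff_le\<close> the distinguished factor
  contributes the fourth moment 3 h^2 of a step. Any other factor contributes at most 3 + 3 = 6,
  because the walks do not run beyond time \<open>1\<close>. What matters is the order h^2: summed
  over 1 / h steps it still tends to 0, unlike second moments of order h.\<close>

lemma walk_prod_fourth_moment_step:
  assumes k: "k < L" and Lh: "real L * h \<le> 1"
  shows "integrable M (\<lambda>\<omega>. (walk_prod (Suc k) \<omega> - walk_prod k \<omega>) ^ 4)" (is ?int)
    "expectation (\<lambda>\<omega>. (walk_prod (Suc k) \<omega> - walk_prod k \<omega>) ^ 4) \<le> 8 ^ card I * card I * 6 ^ card I * 3 * h\<^sup>2" (is ?le)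
proof -
  define c where "c i j \<omega> = (if j = i then X (j, k) \<omega> ^ 4 else walk k j \<omega> ^ 4 + walk (Suc k) j \<omega> ^ 4)" for i j \<omega>
  have k': "k \<le> L" "Suc k \<le> L" using k by auto
  have c_int: "integrable M (c i j)" if "j \<in> I" for i j
    using X_moments(3)[OF that k] walk_moments(2)[OF that k'(1)] walk_moments(2)[OF that k'(2)]
    unfolding c_def[abs_def] by (cases "j = i") auto
  have kh: "3 * (real l * h)\<^sup>2 \<le> 3" if "l \<le> L" for l
  proof -
    have "real l * h \<le> real L * h" using that h_pos by (intro mult_right_mono) auto
    then have "real l * h \<le> 1" using Lh by linarith
    then have "(real l * h)\<^sup>2 \<le> 1\<^sup>2" using h_pos by (intro power_mono) auto
    then show ?thesis by simp
  qed
  have c_exp: "expectation (c i j) \<le> (if j = i then 3 * h\<^sup>2 else 6)" if "j \<in> I" for i j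
  proof (cases "j = i")
    case True
    then show ?thesis using X_moments(4)[OF that k] by (simp add: c_def[abs_def])
  next
    case False
    then show ?thesis
      using walk_moments(2,3)[OF that k'(1)] walk_moments(2,3)[OF that k'(2)] kh[OF k'(1)] kh[OF k'(2)]
      by (simp add: c_def[abs_def])
  qed
  have c_nn: "0 \<le> c i j \<omega>" for i j \<omega> by (simp add: c_def)
  have c_ind: "indep_vars (\<lambda>_. borel) (c i) I" for i
  proof -
    define f where "f j p = (if j = i then p (j, k) ^ 4 else (\<Sum>l<k. p (j, l)) ^ 4 + (\<Sum>l<Suc k. p (j, l)) ^ 4)"
      for j and p :: "'i \<times> nat \<Rightarrow> real"
    have "indep_vars (\<lambda>_. borel) (\<lambda>j \<omega>. f j (\<lambda>q\<in>{j} \<times> {..<Suc k}. X q \<omega>)) I"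
    proof (rule indep_columns)
      fix j assume "j \<in> I"
      have "(\<lambda>p. p (j, l)) \<in> borel_measurable (PiM ({j} \<times> {..<Suc k}) (\<lambda>_. borel :: real measure))" if "l < Suc k" for l
        using that by (intro measurable_component_singleton) auto
      then show "f j \<in> borel_measurable (PiM ({j} \<times> {..<Suc k}) (\<lambda>_. borel))"
        unfolding f_def[abs_def]
        by (cases "j = i") (auto intro!: borel_measurable_sum borel_measurable_add borel_measurable_power)
    qed (use k in auto)
    then show ?thesis
      by (rule indep_vars_cong[THEN iffD1, rotated 3]) (auto simp: f_def c_def walk_def fun_eq_iff)
  qed
  let ?B = "\<lambda>\<omega>. 8 ^ card I * (\<Sum>i\<in>I. \<Prod>j\<in>I. c i j \<omega>)"
  have B_int: "integrable M ?B"
    using finite_I c_ind c_int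
    by (intro integrable_mult_right Bochner_Integration.integrable_sum indep_vars_integrable) auto
  have le: "(walk_prod (Suc k) \<omega> - walk_prod k \<omega>) ^ 4 \<le> ?B \<omega>" for \<omega>
    using power4_prod_diff_le[OF finite_I, of "\<lambda>i. walk (Suc k) i \<omega>" "\<lambda>i. walk k i \<omega>"]
    unfolding c_def walk_prod_def by (simp add: walk_Suc cong: if_cong)
  show ?int
    using k' le B_int
    by (intro Bochner_Integration.integrable_bound[OF B_int])
      (auto intro!: borel_measurable_power borel_measurable_diff walk_prod_measurable
        simp: abs_of_nonneg sum_nonneg prod_nonneg c_nn)
  have "expectation (\<lambda>\<omega>. (walk_prod (Suc k) \<omega> - walk_prod k \<omega>) ^ 4) \<le> expectation ?B"
    using le \<open>?int\<close> B_int by (intro integral_mono) auto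
  also have "\<dots> = 8 ^ card I * (\<Sum>i\<in>I. \<Prod>j\<in>I. expectation (c i j))"
  proof -
    have "expectation ?B = 8 ^ card I * (\<Sum>i\<in>I. expectation (\<lambda>\<omega>. \<Prod>j\<in>I. c i j \<omega>))"
      using finite_I c_ind c_int
      by (subst integral_mult_right_zero, subst Bochner_Integration.integral_sum)
        (auto intro!: indep_vars_integrable)
    also have "\<dots> = 8 ^ card I * (\<Sum>i\<in>I. \<Prod>j\<in>I. expectation (c i j))"
      using finite_I c_ind c_int
      by (intro arg_cong2[where f="(*)"] sum.cong refl indep_vars_lebesgue_integral) auto
    finally show ?thesis .
  qed
  also have "\<dots> \<le> 8 ^ card I * (\<Sum>i\<in>I. 6 ^ card I * (3 * h\<^sup>2))"
  proof (intro mult_left_mono sum_mono)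
    fix i assume i: "i \<in> I"
    have "(\<Prod>j\<in>I. expectation (c i j)) \<le> (\<Prod>j\<in>I. if j = i then 3 * h\<^sup>2 else 6)"
      using c_exp c_nn by (intro prod_mono) (auto intro!: integral_nonneg_AE)
    also have "\<dots> = 3 * h\<^sup>2 * (\<Prod>j\<in>I - {i}. 6)"
      using i finite_I by (subst prod.remove[of I i]) (auto intro!: prod.cong)
    also have "\<dots> \<le> 3 * h\<^sup>2 * 6 ^ card I"
      using finite_I by (intro mult_left_mono) (auto intro!: power_increasing card_mono)
    finally show "(\<Prod>j\<in>I. expectation (c i j)) \<le> 6 ^ card I * (3 * h\<^sup>2)" by (simp add: mult.commute)
  qed auto
  finally show ?le by (simp add: algebra_simps)
qed

text \<open>With the past frozen at positions \<open>w i\<close>, the next steps are independent and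
  centred, so the expectation of the product of the \<open>w i + X (i, k)\<close> is the product of
  the \<open>w i\<close>.\<close>

lemma walk_prod_martingale:
  assumes k: "k < L" and Q: "Measurable.pred (past_space k) Q"
  shows "expectation (\<lambda>\<omega>. indicat_real {\<omega> \<in> space M. Q (past k \<omega>)} \<omega> * walk_prod (Suc k) \<omega>)
    = expectation (\<lambda>\<omega>. indicat_real {\<omega> \<in> space M. Q (past k \<omega>)} \<omega> * walk_prod k \<omega>)"
proof -
  define F :: "('i \<times> nat \<Rightarrow> real) \<times> ('i \<times> nat \<Rightarrow> real) \<Rightarrow> real" where
    "F z = indicat_real {p \<in> space (past_space k). Q p} (fst z) * (\<Prod>i\<in>I. (\<Sum>j<k. fst z (i, j)) + snd z (i, k))" for z
  note Q[measurable]
  let ?N = "PiM (I \<times> {k}) (\<lambda>_. borel :: real measure)"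
  let ?n = "\<lambda>\<omega>. \<lambda>q\<in>I \<times> {k}. X q \<omega>"
  have past_m[measurable]: "past k \<in> M \<rightarrow>\<^sub>M past_space k"
    using indep_var_rv1[OF indep_past_next[OF k]] .
  have Qset: "{\<omega> \<in> space M. Q (past k \<omega>)} \<in> sets M" by measurable
  have F_meas: "F \<in> borel_measurable (past_space k \<Otimes>\<^sub>M ?N)"
  proof -
    have 1: "(\<lambda>z. fst z (i, j)) \<in> borel_measurable (past_space k \<Otimes>\<^sub>M ?N)" if "i \<in> I" "j < k" for i j
      using that by (intro measurable_compose[OF measurable_fst] measurable_component_singleton) auto
    have 2: "(\<lambda>z. snd z (i, k)) \<in> borel_measurable (past_space k \<Otimes>\<^sub>M ?N)" if "i \<in> I" for i
      using that by (intro measurable_compose[OF measurable_snd] measurable_component_singleton) auto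
    show ?thesis unfolding F_def[abs_def]
      by (intro borel_measurable_times borel_measurable_prod borel_measurable_add borel_measurable_sum 1 2
          measurable_compose[OF measurable_fst] borel_measurable_indicator) auto
  qed
  have F_eq: "F (past k \<omega>, ?n \<omega>') = indicat_real {\<omega> \<in> space M. Q (past k \<omega>)} \<omega> * (\<Prod>i\<in>I. walk k i \<omega> + X (i, k) \<omega>')"
    if "\<omega> \<in> space M" for \<omega> \<omega>'
    using measurable_space[OF past_m that] that
    by (auto simp: F_def walk_past indicator_def intro!: prod.cong)
  have F_diag: "F (past k \<omega>, ?n \<omega>) = indicat_real {\<omega> \<in> space M. Q (past k \<omega>)} \<omega> * walk_prod (Suc k) \<omega>"
    if "\<omega> \<in> space M" for \<omega>
    using F_eq[OF that, of \<omega>] by (simp add: walk_prod_def walk_Suc)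
  have int: "integrable M (\<lambda>\<omega>. indicat_real {\<omega> \<in> space M. Q (past k \<omega>)} \<omega> * walk_prod (Suc k) \<omega>)"
    using k walk_prod_integrable[of "Suc k"] Qset
    by (subst mult.commute, intro integrable_real_mult_indicator) auto
  have step: "expectation (\<lambda>\<omega>'. \<Prod>i\<in>I. w i + X (i, k) \<omega>') = (\<Prod>i\<in>I. w i)" for w :: "'i \<Rightarrow> real"
  proof -
    have "expectation (\<lambda>\<omega>'. \<Prod>i\<in>I. w i + X (i, k) \<omega>') = (\<Prod>i\<in>I. expectation (\<lambda>\<omega>'. w i + X (i, k) \<omega>'))"
      using finite_I X_moments[OF _ k]
      by (intro indep_vars_lebesgue_integral indep_vars_compose2[OF indep_steps[OF k], of "\<lambda>i x. w i + x"]) auto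
    also have "\<dots> = (\<Prod>i\<in>I. w i)"
      using X_moments[OF _ k] by (intro prod.cong refl) (simp add: prob_space)
    finally show ?thesis .
  qed
  have "expectation (\<lambda>\<omega>. indicat_real {\<omega> \<in> space M. Q (past k \<omega>)} \<omega> * walk_prod (Suc k) \<omega>)
      = expectation (\<lambda>\<omega>. F (past k \<omega>, ?n \<omega>))"
    using F_diag by (intro Bochner_Integration.integral_cong refl) auto
  also have "\<dots> = expectation (\<lambda>\<omega>. expectation (\<lambda>\<omega>'. F (past k \<omega>, ?n \<omega>')))"
  proof (rule indep_var_expectation[OF indep_past_next[OF k] F_meas])
    show "integrable M (\<lambda>\<omega>. F (past k \<omega>, ?n \<omega>))"
      using int F_diag by (subst Bochner_Integration.integrable_cong) auto
  qed
  also have "\<dots> = expectation (\<lambda>\<omega>. indicat_real {\<omega> \<in> space M. Q (past k \<omega>)} \<omega> * walk_prod k \<omega>)"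
    using F_eq step by (intro Bochner_Integration.integral_cong refl) (auto simp: walk_prod_def)
  finally show ?thesis .
qed

text \<open>Wherever the walks stand, each coordinate has modulus at least \<open>sqrt h\<close>
  after the next step with probability at least P(Z \<ge> 1). If all of them do, the product has
  modulus at least \<open>sqrt h ^ card I\<close>; so every step is survived with probability at
  most 1 - P(Z \<ge> 1)^n, where n is the number of coordinates.\<close>

lemma walk_prod_small_ball:
  assumes "k \<le> L"
  shows "prob {\<omega> \<in> space M. \<forall>l\<le>k. \<bar>walk_prod l \<omega>\<bar> < sqrt h ^ card I} \<le> (1 - measure std_gauss {1..} ^ card I) ^ k"
  using assms
proof (induction k)
  case 0
  then show ?case by simp
next
  case (Suc k)
  then have k: "k < L" by simp
  let ?p = "measure std_gauss {1..}"
  let ?N = "PiM (I \<times> {k}) (\<lambda>_. borel :: real measure)"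
  define Q where "Q p \<longleftrightarrow> (\<forall>l\<in>{..k}. \<bar>\<Prod>i\<in>I. \<Sum>j<l. p (i, j)\<bar> < sqrt h ^ card I)" for p :: "'i \<times> nat \<Rightarrow> real"
  define R where "R p v \<longleftrightarrow> \<bar>\<Prod>i\<in>I. (\<Sum>j<k. p (i, j)) + v (i, k)\<bar> < sqrt h ^ card I" for p v :: "'i \<times> nat \<Rightarrow> real"
  have Qm: "Measurable.pred (past_space k) Q"
    unfolding Q_def[abs_def]
    by (intro pred_intros_finite borel_measurable_pred_less borel_measurable_abs past_prod_measurable) auto
  have Rm: "Measurable.pred (past_space k \<Otimes>\<^sub>M ?N) (\<lambda>(p, v). R p v)"
  proof -
    have 1: "(\<lambda>z. fst z (i, j)) \<in> borel_measurable (past_space k \<Otimes>\<^sub>M ?N)" if "i \<in> I" "j < k" for i j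
      using that by (intro measurable_compose[OF measurable_fst] measurable_component_singleton) auto
    have 2: "(\<lambda>z. snd z (i, k)) \<in> borel_measurable (past_space k \<Otimes>\<^sub>M ?N)" if "i \<in> I" for i
      using that by (intro measurable_compose[OF measurable_snd] measurable_component_singleton) auto
    show ?thesis unfolding R_def split_def
      by (intro borel_measurable_pred_less borel_measurable_abs borel_measurable_prod borel_measurable_add
          borel_measurable_sum 1 2) auto
  qed
  have one: "prob {\<omega> \<in> space M. R p (\<lambda>q\<in>I \<times> {k}. X q \<omega>)} \<le> 1 - ?p ^ card I" for p
  proof -
    define w where "w i = (\<Sum>j<k. p (i, j))" for i
    define A where "A i = {x. sqrt h \<le> \<bar>w i + x\<bar>}" for i
    have A: "A i \<in> sets borel" for i unfolding A_def by measurable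
    have hs: "0 < sqrt h" using h_pos by simp
    \<comment> \<open>It suffices that the step has size at least \<open>sqrt h\<close> and points
      away from \<open>0\<close>, in the direction of the sign of \<open>w i\<close>.\<close>
    have pA: "?p \<le> prob (X (i, k) -` A i \<inter> space M)" if i: "i \<in> I" for i
    proof (cases "0 \<le> w i")
      case True
      have "?p = prob {\<omega> \<in> space M. sqrt h * 1 \<le> X (i, k) \<omega>}"
        using prob_normal_ge(1)[OF normal[OF i k] hs, of 1] by simp
      also have "\<dots> \<le> prob (X (i, k) -` A i \<inter> space M)"
        using True hs A X_measurable[OF i k]
        by (intro finite_measure_mono measurable_sets) (auto simp: A_def)
      finally show ?thesis .
    next
      case False
      have "uminus -` {1..} = {..-(1::real)}" by auto
      then have "?p = prob {\<omega> \<in> space M. X (i, k) \<omega> \<le> sqrt h * - 1}"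
        using prob_normal_ge(3)[OF normal[OF i k] hs, of "-1"] measure_std_gauss_uminus[of "{1..}"] by simp
      also have "\<dots> \<le> prob (X (i, k) -` A i \<inter> space M)"
        using False hs A X_measurable[OF i k]
        by (intro finite_measure_mono measurable_sets) (auto simp: A_def)
      finally show ?thesis .
    qed
    let ?G = "\<Inter>i\<in>I. X (i, k) -` A i \<inter> space M"
    have G: "?G \<in> sets M"
      using finite_I I_nonempty A X_measurable k by (intro sets.finite_INT) auto
    have "?p ^ card I \<le> (\<Prod>i\<in>I. prob (X (i, k) -` A i \<inter> space M))"
      using pA by (subst prod_constant[symmetric], intro prod_mono) auto
    also have "\<dots> = prob ?G"
      using indep_varsD_finite[OF indep_steps[OF k] I_nonempty finite_I A] by simp
    also have "\<dots> = 1 - prob (space M - ?G)"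
      using prob_compl[OF G] by simp
    also have "\<dots> \<le> 1 - prob {\<omega> \<in> space M. R p (\<lambda>q\<in>I \<times> {k}. X q \<omega>)}"
    proof (intro diff_left_mono finite_measure_mono)
      show "space M - ?G \<in> sets M" using G by auto
      show "{\<omega> \<in> space M. R p (\<lambda>q\<in>I \<times> {k}. X q \<omega>)} \<subseteq> space M - ?G"
      proof safe
        fix \<omega> assume R: "R p (\<lambda>q\<in>I \<times> {k}. X q \<omega>)" and G: "\<omega> \<in> ?G"
        have "(\<Prod>i\<in>I. sqrt h) \<le> (\<Prod>i\<in>I. \<bar>w i + X (i, k) \<omega>\<bar>)"
          using G hs by (intro prod_mono) (auto simp: A_def simp del: INT_simps)
        moreover have "(\<Prod>i\<in>I. \<bar>w i + X (i, k) \<omega>\<bar>) < sqrt h ^ card I"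
          using R unfolding R_def w_def abs_prod[symmetric] by (simp cong: prod.cong)
        ultimately show False by simp
      qed
    qed
    finally show ?thesis by linarith
  qed
  have Qw: "Q (past k \<omega>) \<longleftrightarrow> (\<forall>l\<le>k. \<bar>walk_prod l \<omega>\<bar> < sqrt h ^ card I)" for \<omega>
    unfolding Q_def by (auto simp: walk_prod_past)
  have Rw: "R (past k \<omega>) (\<lambda>q\<in>I \<times> {k}. X q \<omega>) \<longleftrightarrow> \<bar>walk_prod (Suc k) \<omega>\<bar> < sqrt h ^ card I" for \<omega>
    unfolding R_def walk_prod_def by (simp add: walk_past walk_Suc cong: prod.cong)
  have "prob {\<omega> \<in> space M. \<forall>l\<le>Suc k. \<bar>walk_prod l \<omega>\<bar> < sqrt h ^ card I}
      = prob {\<omega> \<in> space M. Q (past k \<omega>) \<and> R (past k \<omega>) (\<lambda>q\<in>I \<times> {k}. X q \<omega>)}"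
    unfolding Qw Rw by (auto simp: le_Suc_eq intro!: arg_cong[where f=prob])
  also have "\<dots> \<le> (1 - ?p ^ card I) * prob {\<omega> \<in> space M. Q (past k \<omega>)}"
    by (rule indep_var_prob_le[OF indep_past_next[OF k] Rm Qm]) (rule one)
  also have "\<dots> \<le> (1 - ?p ^ card I) * (1 - ?p ^ card I) ^ k"
    unfolding Qw using Suc.IH k by (intro mult_left_mono) (auto simp: power_le_one)
  finally show ?case by simp
qed

text \<open>
  Optional stopping at the exit of \<open>walk_prod\<close> from \<open>(- \<eta>, \<epsilon>]\<close>: the overshoot above \<open>\<epsilon>\<close> is
  controlled by \<open>\<bar>\<Delta>\<bar> \<le> \<epsilon> + \<Delta>\<^sup>4 / \<epsilon>\<^sup>3\<close>, whose second term vanishes as the mesh goes to \<open>0\<close>.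
\<close>

lemma walk_prod_persistence:
  assumes Lh: "real L * h \<le> 1" and \<epsilon>: "0 < \<epsilon>" and \<eta>: "0 < \<eta>"
  defines "C \<equiv> 8 ^ card I * card I * 6 ^ card I * 3 * h\<^sup>2 / \<epsilon> ^ 3"
  shows "prob {\<omega> \<in> space M. \<forall>k\<le>L. walk_prod k \<omega> \<le> \<epsilon>}
    \<le> (2 * \<epsilon> + real L * C) / \<eta> + prob {\<omega> \<in> space M. \<forall>k\<le>L. \<bar>walk_prod k \<omega>\<bar> < \<eta>}"
\<comment> \<open>Here the right-hand side is at least \<open>1\<close>. In the other case the two
  exits of the interval exclude each other.\<close>
proof (cases "\<eta> \<le> \<epsilon>")
  case True
  have "0 \<le> real L * C" using \<epsilon> by (simp add: C_def)
  then have "1 \<le> (2 * \<epsilon> + real L * C) / \<eta>" using True \<eta> by simp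
  then show ?thesis using prob_le_1 measure_nonneg by (meson add_increasing2 order.trans)
next
  case False
  then have \<epsilon>\<eta>: "\<epsilon> < \<eta>" by simp
  \<comment> \<open>\<open>G k\<close>: never above \<epsilon> so far. \<open>D k\<close>: not yet
    stopped. \<open>U k\<close> and \<open>V k\<close>: stopped at time \<open>Suc k\<close>,
    through the upper and the lower end respectively.\<close>
  define G where "G k = {\<omega> \<in> space M. \<forall>l\<in>{..k}. walk_prod l \<omega> \<le> \<epsilon>}" for k
  define D where "D k = {\<omega> \<in> space M. \<forall>l\<in>{..k}. walk_prod l \<omega> \<le> \<epsilon> \<and> \<bar>walk_prod l \<omega>\<bar> < \<eta>}" for k
  define U where "U k = D k \<inter> {\<omega> \<in> space M. \<epsilon> < walk_prod (Suc k) \<omega>}" for k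
  define V where "V k = D k \<inter> {\<omega> \<in> space M. walk_prod (Suc k) \<omega> \<le> - \<eta>}" for k
  have G: "G k \<in> sets M" if "k \<le> L" for k
    unfolding G_def using that
    by (intro sets.sets_Collect_finite_All borel_measurable_le walk_prod_measurable) auto
  have D: "D k \<in> sets M" if "k \<le> L" for k
    unfolding D_def using that
    by (intro sets.sets_Collect_finite_All sets.sets_Collect_conj borel_measurable_le borel_measurable_less
        borel_measurable_abs walk_prod_measurable) auto
  have U: "U k \<in> sets M" and V: "V k \<in> sets M" if "k < L" for k
    unfolding U_def V_def using that
    by (intro sets.Int D borel_measurable_le borel_measurable_less walk_prod_measurable; simp)+
  define a where "a k = expectation (\<lambda>\<omega>. indicat_real (D k) \<omega> * walk_prod k \<omega>)" for k
  have int: "integrable M (\<lambda>\<omega>. indicat_real A \<omega> * walk_prod k \<omega>)" if "k \<le> L" "A \<in> sets M" for A k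
    using integrable_real_mult_indicator[OF that(2) walk_prod_integrable[OF that(1)]] by (simp add: mult.commute)
  have step: "\<eta> * prob (V k) \<le> a (Suc k) - a k + (2 * \<epsilon> * prob (U k) + C)" if k: "k < L" for k
  proof -
    have k': "k \<le> L" "Suc k \<le> L" using k by auto
    let ?P = "walk_prod (Suc k)"
    define Q where "Q p \<longleftrightarrow> (\<forall>l\<in>{..k}. (\<Prod>i\<in>I. \<Sum>j<l. p (i, j)) \<le> \<epsilon> \<and> \<bar>\<Prod>i\<in>I. \<Sum>j<l. p (i, j)\<bar> < \<eta>)"
      for p :: "'i \<times> nat \<Rightarrow> real"
    have Qm: "Measurable.pred (past_space k) Q"
      unfolding Q_def[abs_def] pred_def
      by (intro sets.sets_Collect_finite_All sets.sets_Collect_conj borel_measurable_le borel_measurable_less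
          borel_measurable_abs past_prod_measurable) auto
    have "{\<omega> \<in> space M. Q (past k \<omega>)} = D k"
      unfolding Q_def D_def by (auto simp: walk_prod_past)
    with walk_prod_martingale[OF k Qm]
    have mart: "expectation (\<lambda>\<omega>. indicat_real (D k) \<omega> * ?P \<omega>) = a k" by (simp add: a_def)
    \<comment> \<open>A walk not stopped at time \<open>k\<close> stays inside, leaves above or
      leaves below, and \<epsilon> < \<eta> makes the three cases disjoint.\<close>
    have split: "indicat_real (D k) \<omega> * ?P \<omega> = indicat_real (D (Suc k)) \<omega> * ?P \<omega>
        + indicat_real (U k) \<omega> * ?P \<omega> + indicat_real (V k) \<omega> * ?P \<omega>" if "\<omega> \<in> space M" for \<omega>
      using \<epsilon>\<eta> \<eta> \<epsilon> that unfolding U_def V_def D_def atMost_Suc by (auto simp: indicator_def abs_less_iff)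
    have "a k = expectation (\<lambda>\<omega>. indicat_real (D (Suc k)) \<omega> * ?P \<omega>
        + indicat_real (U k) \<omega> * ?P \<omega> + indicat_real (V k) \<omega> * ?P \<omega>)"
      unfolding mart[symmetric] using split by (intro Bochner_Integration.integral_cong refl) auto
    also have "\<dots> = a (Suc k) + expectation (\<lambda>\<omega>. indicat_real (U k) \<omega> * ?P \<omega>)
        + expectation (\<lambda>\<omega>. indicat_real (V k) \<omega> * ?P \<omega>)"
      using int[OF k'(2) D[OF k'(2)]] int[OF k'(2) U[OF k]] int[OF k'(2) V[OF k]]
      by (simp add: a_def)
    finally have eq: "a k = \<dots>" .
    have "expectation (\<lambda>\<omega>. indicat_real (V k) \<omega> * ?P \<omega>) \<le> expectation (\<lambda>\<omega>. indicat_real (V k) \<omega> * - \<eta>)"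
      using int[OF k'(2) V[OF k]] V[OF k]
      by (intro integral_mono integrable_mult_left integrable_real_indicator)
        (auto simp: V_def indicator_def less_top[symmetric])
    also have "\<dots> = - (\<eta> * prob (V k))" using V[OF k] by simp
    finally have Vle: "expectation (\<lambda>\<omega>. indicat_real (V k) \<omega> * ?P \<omega>) \<le> - (\<eta> * prob (V k))" .
    note m4 = walk_prod_fourth_moment_step[OF k Lh]
    have "expectation (\<lambda>\<omega>. indicat_real (U k) \<omega> * ?P \<omega>)
      \<le> expectation (\<lambda>\<omega>. indicat_real (U k) \<omega> * (2 * \<epsilon>) + (?P \<omega> - walk_prod k \<omega>) ^ 4 / \<epsilon> ^ 3)"
    proof (rule integral_mono)
      show "integrable M (\<lambda>\<omega>. indicat_real (U k) \<omega> * (2 * \<epsilon>) + (?P \<omega> - walk_prod k \<omega>) ^ 4 / \<epsilon> ^ 3)"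
        using m4(1) U[OF k] by (intro Bochner_Integration.integrable_add integrable_mult_left integrable_real_indicator integrable_divide)
          (auto simp: less_top[symmetric])
      fix \<omega> assume "\<omega> \<in> space M"
      define \<Delta> where "\<Delta> = ?P \<omega> - walk_prod k \<omega>"
      \<comment> \<open>If \<Delta> > \<epsilon>, then (\<Delta> / \<epsilon>)^3 \<ge> 1. On
        \<open>U k\<close> the previous value is at most \<epsilon>, so the new one is at most 2
        \<epsilon> plus the quartic term.\<close>
      have "\<Delta> \<le> \<epsilon> + \<Delta> ^ 4 / \<epsilon> ^ 3"
      proof (cases "\<Delta> \<le> \<epsilon>")
        case False
        then have "\<epsilon> ^ 3 \<le> \<Delta> ^ 3" using \<epsilon> by (intro power_mono) auto
        then have "\<Delta> * \<epsilon> ^ 3 \<le> \<Delta> * \<Delta> ^ 3" using False \<epsilon> by (intro mult_left_mono) auto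
        then have "\<Delta> \<le> \<Delta> ^ 4 / \<epsilon> ^ 3" using \<epsilon> by (simp add: field_simps power_numeral_reduce)
        then show ?thesis using \<epsilon> by simp
      qed (use \<epsilon> in \<open>auto simp: add_increasing2\<close>)
      then show "indicat_real (U k) \<omega> * ?P \<omega> \<le> indicat_real (U k) \<omega> * (2 * \<epsilon>) + (?P \<omega> - walk_prod k \<omega>) ^ 4 / \<epsilon> ^ 3"
        using \<epsilon> unfolding \<Delta>_def by (auto simp: indicator_def U_def D_def dest!: bspec[of _ _ k])
    qed (use int[OF k'(2) U[OF k]] in auto)
    also have "\<dots> = prob (U k) * (2 * \<epsilon>) + expectation (\<lambda>\<omega>. (?P \<omega> - walk_prod k \<omega>) ^ 4) / \<epsilon> ^ 3"
      using m4(1) U[OF k] by (subst Bochner_Integration.integral_add) (auto simp: less_top[symmetric])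
    also have "\<dots> \<le> prob (U k) * (2 * \<epsilon>) + C"
      using m4(2) \<epsilon> unfolding C_def by (intro add_left_mono divide_right_mono) auto
    finally show ?thesis using eq Vle by (simp add: algebra_simps)
  qed
  \<comment> \<open>The step inequality summed over time. A path in \<open>G k\<close> but not in
    \<open>D k\<close> has left through the lower end, and the upward exits before time
    \<open>k\<close> have total probability at most \<open>1 - prob (D k)\<close>.\<close>
  have main: "\<eta> * (prob (G k) - prob (D k)) \<le> a k + 2 * \<epsilon> * (1 - prob (D k)) + real k * C" if "k \<le> L" for k
    using that
  proof (induction k)
    case 0
    have "walk_prod 0 \<omega> = 0" for \<omega>
      using finite_I I_nonempty by (auto simp: walk_prod_def walk_def prod_zero_iff)
    then have "G 0 = space M" "D 0 = space M" "a 0 = 0"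
      using \<epsilon> \<eta> by (auto simp: G_def D_def a_def)
    then show ?case by (simp add: prob_space)
  next
    case (Suc k)
    then have k: "k < L" "k \<le> L" by auto
    note sets = G[OF k(2)] G[OF Suc.prems] D[OF k(2)] D[OF Suc.prems] V[OF k(1)] U[OF k(1)]
    have DG: "D k \<subseteq> G k" by (auto simp: G_def D_def)
    have D_Suc: "D (Suc k) = D k \<inter> {\<omega> \<in> space M. walk_prod (Suc k) \<omega> \<le> \<epsilon> \<and> \<bar>walk_prod (Suc k) \<omega>\<bar> < \<eta>}"
      by (auto simp: D_def atMost_Suc)
    have G_Suc: "G (Suc k) = G k \<inter> {\<omega> \<in> space M. walk_prod (Suc k) \<omega> \<le> \<epsilon>}"
      by (auto simp: G_def atMost_Suc)
    have "G (Suc k) \<subseteq> D (Suc k) \<union> ((G k - D k) \<union> V k)"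
      unfolding D_Suc G_Suc V_def using \<epsilon>\<eta> by auto
    then have "prob (G (Suc k)) \<le> prob (D (Suc k) \<union> ((G k - D k) \<union> V k))"
      by (intro finite_measure_mono sets.Un sets.Diff sets)
    also have "\<dots> \<le> prob (D (Suc k)) + prob ((G k - D k) \<union> V k)"
      by (intro measure_Un_le sets.Un sets.Diff sets)
    also have "prob ((G k - D k) \<union> V k) \<le> prob (G k - D k) + prob (V k)"
      by (intro measure_Un_le sets.Un sets.Diff sets)
    also have "prob (G k - D k) = prob (G k) - prob (D k)"
      by (intro finite_measure_Diff DG sets)
    finally have 1: "prob (G (Suc k)) - prob (D (Suc k)) \<le> prob (G k) - prob (D k) + prob (V k)" by simp
    have "prob (D (Suc k)) + prob (U k) = prob (D (Suc k) \<union> U k)"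
      by (intro finite_measure_Union[symmetric] sets) (auto simp: D_Suc U_def)
    also have "\<dots> \<le> prob (D k)"
      by (intro finite_measure_mono sets) (auto simp: D_Suc U_def)
    finally have 2: "2 * \<epsilon> * (prob (D (Suc k)) + prob (U k)) \<le> 2 * \<epsilon> * prob (D k)"
      using \<epsilon> by (intro mult_left_mono) auto
    have 3: "\<eta> * (prob (G (Suc k)) - prob (D (Suc k))) \<le> \<eta> * (prob (G k) - prob (D k) + prob (V k))"
      using 1 \<eta> by (intro mult_left_mono) auto
    from 2 3 Suc.IH[OF k(2)] step[OF k(1)] show ?case by (simp add: algebra_simps)
  qed
  \<comment> \<open>On \<open>D L\<close> the product is at most \<epsilon>; the resulting multiple
    of \<open>prob (D L)\<close> is absorbed by the negative one in \<open>main\<close>.\<close>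
  have "a L \<le> expectation (\<lambda>\<omega>. indicat_real (D L) \<omega> * \<epsilon>)"
    unfolding a_def using int[OF order.refl D[OF order.refl]] D[OF order.refl]
    by (intro integral_mono integrable_mult_left integrable_real_indicator)
      (auto simp: D_def indicator_def less_top[symmetric])
  then have "a L \<le> \<epsilon> * prob (D L)" using D[OF order.refl] by (simp add: mult.commute)
  also have "\<dots> \<le> 2 * \<epsilon> * prob (D L)" using \<epsilon> by (intro mult_right_mono) auto
  finally have "\<eta> * (prob (G L) - prob (D L)) \<le> 2 * \<epsilon> + real L * C"
    using main[of L] by (simp add: algebra_simps)
  then have "prob (G L) \<le> (2 * \<epsilon> + real L * C) / \<eta> + prob (D L)"
    using \<eta> by (simp add: field_simps)
  also have "prob (D L) \<le> prob {\<omega> \<in> space M. \<forall>k\<le>L. \<bar>walk_prod k \<omega>\<bar> < \<eta>}"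
  proof (rule finite_measure_mono)
    have "{\<omega> \<in> space M. \<forall>k\<in>{..L}. \<bar>walk_prod k \<omega>\<bar> < \<eta>} \<in> sets M"
      by (intro sets.sets_Collect_finite_All borel_measurable_less borel_measurable_abs walk_prod_measurable) auto
    then show "{\<omega> \<in> space M. \<forall>k\<le>L. \<bar>walk_prod k \<omega>\<bar> < \<eta>} \<in> sets M"
      by (simp only: Ball_def atMost_iff)
    show "D L \<subseteq> {\<omega> \<in> space M. \<forall>k\<le>L. \<bar>walk_prod k \<omega>\<bar> < \<eta>}"
      unfolding D_def by blast
  qed
  finally show ?thesis unfolding G_def by (simp only: Ball_def atMost_iff)
qed

end

lemma (in gaussian_array) all_walk_prod_measurable:
  assumes "N \<le> L" "B \<in> sets borel"
  shows "{\<omega> \<in> space M. \<forall>k\<le>N. walk_prod k \<omega> \<in> B} \<in> sets M"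
proof -
  have "{\<omega> \<in> space M. \<forall>k\<in>{..N}. walk_prod k \<omega> \<in> B} \<in> sets M"
  proof (intro sets.sets_Collect_finite_All)
    fix k assume "k \<in> {..N}"
    then have "walk_prod k -` B \<inter> space M \<in> sets M"
      using assms by (intro measurable_sets[OF walk_prod_measurable]) auto
    also have "walk_prod k -` B \<inter> space M = {\<omega> \<in> space M. walk_prod k \<omega> \<in> B}" by auto
    finally show "{\<omega> \<in> space M. walk_prod k \<omega> \<in> B} \<in> sets M" .
  qed auto
  then show ?thesis by (simp only: Ball_def atMost_iff)
qed

subsection \<open>Path suprema\<close>

text \<open>Rounding down to the dyadic grid gives points that converge to \<open>u\<close>, and
  continuity does the rest. The interval is arbitrary because the persistence event uses the grids
  of \<open>[0, \<delta>\<^sup>2]\<close> and of \<open>[\<delta>\<^sup>2, 1]\<close>.\<close>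

lemma all_le_iff_all_dyadic_le:
  fixes f :: "real \<Rightarrow> real"
  assumes cd: "c \<le> d" and f: "continuous_on {c..d} f"
  shows "(\<forall>u\<in>{c..d}. f u \<le> a) \<longleftrightarrow> (\<forall>m::nat. \<forall>k\<le>2 ^ m. f (c + (d - c) * (real k / 2 ^ m)) \<le> a)"
proof
  assume L: "\<forall>u\<in>{c..d}. f u \<le> a"
  show "\<forall>m::nat. \<forall>k\<le>2 ^ m. f (c + (d - c) * (real k / 2 ^ m)) \<le> a"
  proof (intro allI impI)
    fix m k :: nat assume "k \<le> 2 ^ m"
    then have "real k \<le> 2 ^ m" by (metis of_nat_le_iff of_nat_numeral of_nat_power)
    then have "real k / 2 ^ m \<le> 1" by simp
    then have "(d - c) * (real k / 2 ^ m) \<le> (d - c) * 1" using cd by (intro mult_left_mono) auto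
    then show "f (c + (d - c) * (real k / 2 ^ m)) \<le> a" using L cd by auto
  qed
next
  assume R: "\<forall>m::nat. \<forall>k\<le>2 ^ m. f (c + (d - c) * (real k / 2 ^ m)) \<le> a"
  show "\<forall>u\<in>{c..d}. f u \<le> a"
  proof
    fix u assume u: "u \<in> {c..d}"
    show "f u \<le> a"
    proof (cases "c = d")
      case True
      then show ?thesis using u R[rule_format, of 0 0] by auto
    next
      case False
      with cd have cd': "c < d" by simp
      define v where "v = (u - c) / (d - c)"
      have v: "0 \<le> v" "v \<le> 1" using u cd' by (auto simp: v_def)
      define k where "k m = nat \<lfloor>v * 2 ^ m\<rfloor>" for m :: nat
      define x where "x m = c + (d - c) * (real (k m) / 2 ^ m)" for m
      have rk: "real (k m) = of_int \<lfloor>v * 2 ^ m\<rfloor>" for m using v by (simp add: k_def)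
      have k_le: "real (k m) \<le> v * 2 ^ m" "v * 2 ^ m - 1 \<le> real (k m)" for m
        unfolding rk by linarith+
      have kv: "real (k m) / 2 ^ m \<le> v" "v - (1 / 2) ^ m \<le> real (k m) / 2 ^ m" for m
      proof -
        show "real (k m) / 2 ^ m \<le> v" using k_le(1)[of m] by (simp add: pos_divide_le_eq)
        have "v - (1 / 2) ^ m = (v * 2 ^ m - 1) / 2 ^ m" by (simp add: diff_divide_distrib power_one_over)
        also have "\<dots> \<le> real (k m) / 2 ^ m" using k_le(2)[of m] by (intro divide_right_mono) auto
        finally show "v - (1 / 2) ^ m \<le> real (k m) / 2 ^ m" .
      qed
      have "v * 2 ^ m \<le> 1 * 2 ^ m" for m using v by (intro mult_right_mono) auto
      then have "real (k m) \<le> 2 ^ m" for m using k_le(1)[of m] by (metis mult_1 order.trans)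
      then have k2: "k m \<le> 2 ^ m" for m by (metis of_nat_le_iff of_nat_numeral of_nat_power)
      have lim: "(\<lambda>m. real (k m) / 2 ^ m) \<longlonglongrightarrow> v"
      proof (rule tendsto_sandwich)
        have "(\<lambda>m. v - (1 / 2) ^ m) \<longlonglongrightarrow> v - 0" by (intro tendsto_intros LIMSEQ_realpow_zero) auto
        then show "(\<lambda>m. v - (1 / 2) ^ m) \<longlonglongrightarrow> v" by simp
      qed (use kv in auto)
      have "x \<longlonglongrightarrow> c + (d - c) * v"
        unfolding x_def[abs_def] using lim by (intro tendsto_intros)
      then have "x \<longlonglongrightarrow> u" using cd' by (simp add: v_def)
      moreover have "x m \<in> {c..d}" for m
      proof -
        have "(d - c) * (real (k m) / 2 ^ m) \<le> (d - c) * v" using kv(1)[of m] cd by (intro mult_left_mono) auto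
        then show ?thesis using cd cd' u by (auto simp: x_def v_def)
      qed
      ultimately have "(\<lambda>m. f (x m)) \<longlonglongrightarrow> f u"
        using f u by (intro continuous_on_tendsto_compose[OF f]) auto
      moreover have "f (x m) \<le> a" for m using R k2 by (simp add: x_def)
      ultimately show ?thesis by (intro tendsto_upperbound[of "\<lambda>m. f (x m)"]) auto
    qed
  qed
qed

lemma continuous_SUP_le_iff:
  fixes f :: "real \<Rightarrow> real"
  assumes "continuous_on {0..1} f"
  shows "(SUP u\<in>{0..1}. f u) \<le> a \<longleftrightarrow> (\<forall>u\<in>{0..1}. f u \<le> a)"
proof -
  have "compact (f ` {0..1})" using assms by (intro compact_continuous_image) auto
  then have "bdd_above (f ` {0..1})" by (intro bounded_imp_bdd_above compact_imp_bounded)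
  then show ?thesis by (intro cSUP_le_iff) auto
qed

lemma continuous_SUP_ge_iff:
  fixes f :: "real \<Rightarrow> real"
  assumes "continuous_on {0..1} f"
  shows "a \<le> (SUP u\<in>{0..1}. f u) \<longleftrightarrow> (\<exists>u\<in>{0..1}. a \<le> f u)"
proof -
  obtain v where v: "v \<in> {0..1}" "\<forall>u\<in>{0..1}. f u \<le> f v"
    using continuous_attains_sup[OF _ _ assms] by auto
  have "(SUP u\<in>{0..1}. f u) = f v"
    using v by (intro cSup_eq_maximum) auto
  then show ?thesis using v by force
qed

lemma continuous_SUP_measurable:
  fixes f :: "real \<Rightarrow> 'a \<Rightarrow> real"
  assumes f: "\<And>t. t \<in> {0..1} \<Longrightarrow> f t \<in> borel_measurable M"
    and cont: "\<And>\<omega>. \<omega> \<in> space M \<Longrightarrow> continuous_on {0..1} (\<lambda>t. f t \<omega>)"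
  shows "(\<lambda>\<omega>. SUP u\<in>{0..1}. f u \<omega>) \<in> borel_measurable M"
proof (subst borel_measurable_iff_le, rule allI)
  fix a
  have "{\<omega> \<in> space M. (SUP u\<in>{0..1}. f u \<omega>) \<le> a}
      = {\<omega> \<in> space M. \<forall>m::nat. \<forall>k\<in>{..2 ^ m}. f (0 + (1 - 0) * (real k / 2 ^ m)) \<omega> \<le> a}"
    using cont all_le_iff_all_dyadic_le[of 0 1] by (auto simp: continuous_SUP_le_iff)
  also have "\<dots> \<in> sets M"
  proof (intro sets.sets_Collect_countable_All sets.sets_Collect_finite_All borel_measurable_le f)
    fix m k :: nat assume "k \<in> {..2 ^ m}"
    then have "real k \<le> 2 ^ m" by (metis atMost_iff of_nat_le_iff of_nat_numeral of_nat_power)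
    then show "0 + (1 - 0) * (real k / 2 ^ m) \<in> {0..1}" by simp
  qed auto
  finally show "{\<omega> \<in> space M. (SUP u\<in>{0..1}. f u \<omega>) \<le> a} \<in> sets M" .
qed

subsection \<open>Brownian motions\<close>

lemma independent_brownian_motionsD:
  assumes "independent_brownian_motions M n W"
  shows "prob_space M" "\<And>i. i \<in> {1..n} \<Longrightarrow> standard_brownian_motion M (W i)"
    "prob_space.indep_vars M (\<lambda>_. \<Pi>\<^sub>M t\<in>{0..}. borel) (\<lambda>i \<omega>. \<lambda>t\<in>{0..}. W i t \<omega>) {1..n}"
  using assms unfolding independent_brownian_motions_def by auto

text \<open>Rows are the whole paths, entries are read off each path at grid times. These times are
  nonnegative, so restricting the paths to \<open>{0..}\<close> loses nothing.\<close>

lemma indep_increments_jointly: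
  assumes W: "independent_brownian_motions M n W"
    and \<tau>: "0 \<le> \<tau> 0" "strict_mono_on {..L} \<tau>"
  shows "prob_space.indep_vars M (\<lambda>_. borel)
    (\<lambda>(i, j) \<omega>. W i (\<tau> (Suc j)) \<omega> - W i (\<tau> j) \<omega>) ({1..n} \<times> {..<L})"
proof -
  interpret prob_space M using independent_brownian_motionsD(1)[OF W] .
  have \<tau>_nn: "0 \<le> \<tau> j" if "j \<le> L" for j
    using \<tau> that strict_mono_on_leD[OF \<tau>(2), of 0 j] by auto
  let ?N = "PiM {0..} (\<lambda>_. borel) :: (real \<Rightarrow> real) measure"
  let ?Y = "\<lambda>i \<omega>. \<lambda>t\<in>{0..}. W i t \<omega>"
  let ?f = "\<lambda>(i::nat) j y. y (\<tau> (Suc j)) - y (\<tau> j) :: real"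
  have f: "?f i j \<in> ?N \<rightarrow>\<^sub>M borel" if "j \<in> {..<L}" for i j
    using that \<tau>_nn by (intro borel_measurable_diff measurable_component_singleton) auto
  have eq: "?f i j (?Y i \<omega>) = W i (\<tau> (Suc j)) \<omega> - W i (\<tau> j) \<omega>" if "j \<in> {..<L}" for i j \<omega>
    using that \<tau>_nn by auto
  have "indep_vars (\<lambda>_. borel) (\<lambda>(i, j) \<omega>. ?f i j (?Y i \<omega>)) ({1..n} \<times> {..<L})"
  proof (rule indep_vars_nested[OF independent_brownian_motionsD(3)[OF W]])
    fix i assume i: "i \<in> {1..n}"
    interpret standard_brownian_motion M "W i" using independent_brownian_motionsD(2)[OF W i] .
    show "indep_vars (\<lambda>_. borel) (\<lambda>j \<omega>. ?f i j (?Y i \<omega>)) {..<L}"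
      by (rule indep_vars_cong[THEN iffD1, OF _ _ _ indep_increments[OF \<tau>]])
        (auto simp only: eq[symmetric])
  qed (use f in auto)
  then show ?thesis
  proof (rule indep_vars_cong[THEN iffD1, rotated 3])
    fix q assume "q \<in> {1..n} \<times> {..<L}"
    then show "(case q of (i, j) \<Rightarrow> \<lambda>\<omega>. ?f i j (?Y i \<omega>))
        = (case q of (i, j) \<Rightarrow> \<lambda>\<omega>. W i (\<tau> (Suc j)) \<omega> - W i (\<tau> j) \<omega>)"
      by (elim SigmaE) (simp only: prod.case eq)
  qed auto
qed

lemma gaussian_array_increments:
  assumes W: "independent_brownian_motions M n W" and n: "1 \<le> n" and h: "0 < h"
  shows "gaussian_array M {1..n} L h (\<lambda>(i, j) \<omega>. W i (real (Suc j) * h) \<omega> - W i (real j * h) \<omega>)"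
proof -
  interpret prob_space M using independent_brownian_motionsD(1)[OF W] .
  have mono: "strict_mono_on {..L} (\<lambda>j. real j * h)"
    using h by (auto simp: strict_mono_on_def)
  show ?thesis
  proof
    show "indep_vars (\<lambda>_. borel) (\<lambda>(i, j) \<omega>. W i (real (Suc j) * h) \<omega> - W i (real j * h) \<omega>) ({1..n} \<times> {..<L})"
      using indep_increments_jointly[OF W _ mono] by simp
    fix i j assume i: "i \<in> {1..n}"
    interpret standard_brownian_motion M "W i" using independent_brownian_motionsD(2)[OF W i] .
    have "sqrt (real (Suc j) * h - real j * h) = sqrt h" by (simp add: algebra_simps)
    then show "distributed M lborel ((\<lambda>(i, j) \<omega>. W i (real (Suc j) * h) \<omega> - W i (real j * h) \<omega>) (i, j))
       (normal_density 0 (sqrt h))"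
      using normal_increments[of "real j * h" "real (Suc j) * h"] h by auto
  qed (use n h in auto)
qed

lemma AE_all_start_zero:
  assumes W: "independent_brownian_motions M n W"
  shows "AE \<omega> in M. \<forall>i\<in>{1..n}. W i 0 \<omega> = 0"
  using standard_brownian_motion.start_zero[OF independent_brownian_motionsD(2)[OF W]]
  by (intro AE_finite_allI) auto

lemma brownian_prod_measurable:
  assumes W: "independent_brownian_motions M n W" and t: "0 \<le> t"
  shows "(\<lambda>\<omega>. \<Prod>i=1..n. W i t \<omega>) \<in> borel_measurable M"
  using standard_brownian_motion.measurable_at[OF independent_brownian_motionsD(2)[OF W] t]
  by (intro borel_measurable_prod) auto

lemma brownian_prod_continuous:
  assumes W: "independent_brownian_motions M n W" and \<omega>: "\<omega> \<in> space M"
  shows "continuous_on {0..1} (\<lambda>t. \<Prod>i=1..n. W i t \<omega>)"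
proof (intro continuous_on_prod)
  fix i assume "i \<in> {1..n}"
  from standard_brownian_motion.continuous_paths[OF independent_brownian_motionsD(2)[OF W this] \<omega>]
  show "continuous_on {0..1} (\<lambda>t. W i t \<omega>)" by (rule continuous_on_subset) auto
qed

lemma sup_brownian_prod_measurable:
  assumes W: "independent_brownian_motions M n W"
  shows "(\<lambda>\<omega>. SUP u\<in>{0..1}. \<Prod>i=1..n. W i u \<omega>) \<in> borel_measurable M"
  using brownian_prod_measurable[OF W] brownian_prod_continuous[OF W]
  by (intro continuous_SUP_measurable) auto

text \<open>The array knows increments only, and the processes start at \<open>0\<close> almost
  surely; one null set serves all \<open>k\<close>.\<close>

lemma AE_walk_prod_eq:
  assumes W: "independent_brownian_motions M n W" and n: "1 \<le> n" and h: "0 < h"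
  shows "AE \<omega> in M. \<forall>k. gaussian_array.walk_prod {1..n}
    (\<lambda>(i, j) \<omega>. W i (real (Suc j) * h) \<omega> - W i (real j * h) \<omega>) k \<omega> = (\<Prod>i=1..n. W i (real k * h) \<omega>)"
  using AE_all_start_zero[OF W]
proof (rule eventually_mono)
  \<comment> \<open>The value of \<open>walk_prod\<close> does not involve the number of steps, so
    an array of length \<open>0\<close> gives access to its definition.\<close>
  interpret gaussian_array M "{1..n}" 0 h "\<lambda>(i, j) \<omega>. W i (real (Suc j) * h) \<omega> - W i (real j * h) \<omega>"
    by (rule gaussian_array_increments[OF W n h])
  fix \<omega> assume zero: "\<forall>i\<in>{1..n}. W i 0 \<omega> = 0"
  show "\<forall>k. walk_prod k \<omega> = (\<Prod>i=1..n. W i (real k * h) \<omega>)"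
    unfolding walk_prod_def walk_def
  proof (intro allI prod.cong refl)
    fix k i assume "i \<in> {1..n}"
    then show "(\<Sum>j<k. (\<lambda>(i, j) \<omega>. W i (real (Suc j) * h) \<omega> - W i (real j * h) \<omega>) (i, j) \<omega>) = W i (real k * h) \<omega>"
      using sum_lessThan_telescope[of "\<lambda>j. W i (real j * h) \<omega>" k] zero by simp
  qed
qed

section \<open>Reflected and projected Brownian motions, and Levy's inequality along a grid\<close>

lemma standard_brownian_motion_uminus:
  assumes "standard_brownian_motion M W"
  shows "standard_brownian_motion M (\<lambda>t \<omega>. - W t \<omega>)"
proof -
  interpret standard_brownian_motion M W by fact
  show ?thesis
  proof
    fix s t :: real assume st: "0 \<le> s" "s < t"
    from normal_density_affine[OF normal_increments[OF st], of "-1" 0] st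
    show "distributed M lborel (\<lambda>\<omega>. - W t \<omega> - - W s \<omega>) (normal_density 0 (sqrt (t - s)))" by simp
  next
    fix \<tau> :: "nat \<Rightarrow> real" and k assume \<tau>: "0 \<le> \<tau> 0" "strict_mono_on {..k} \<tau>"
    have "indep_vars (\<lambda>_. borel) (\<lambda>j \<omega>. - (W (\<tau> (Suc j)) \<omega> - W (\<tau> j) \<omega>)) {..<k}"
      by (rule indep_vars_compose2[OF indep_increments[OF \<tau>]]) auto
    then show "indep_vars (\<lambda>_. borel) (\<lambda>j \<omega>. - W (\<tau> (Suc j)) \<omega> - - W (\<tau> j) \<omega>) {..<k}"
      by simp
  qed (use measurable_at start_zero continuous_paths in \<open>auto intro: continuous_on_minus\<close>)
qed

text \<open>The signs divided by \<open>sqrt n\<close> form a unit vector: n independent increments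
  of variance (t - s) / n add up to variance t - s. Increments over different time steps use
  disjoint columns of the joint array and are therefore independent.\<close>

lemma standard_brownian_motion_signed_sum:
  assumes W: "independent_brownian_motions M n W" and n: "1 \<le> n"
    and \<sigma>: "\<And>i. i \<in> {1..n} \<Longrightarrow> \<bar>\<sigma> i\<bar> = 1"
  shows "standard_brownian_motion M (\<lambda>t \<omega>. (\<Sum>i=1..n. \<sigma> i * W i t \<omega>) / sqrt n)"
proof -
  interpret prob_space M using independent_brownian_motionsD(1)[OF W] .
  note bm = independent_brownian_motionsD(2)[OF W]
  define B where "B t \<omega> = (\<Sum>i=1..n. \<sigma> i * W i t \<omega>) / sqrt n" for t \<omega>
  have B_diff: "B t \<omega> - B s \<omega> = (\<Sum>i=1..n. (\<sigma> i / sqrt n) * (W i t \<omega> - W i s \<omega>))" for t s \<omega>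
    unfolding B_def by (simp add: sum_divide_distrib sum_subtractf algebra_simps diff_divide_distrib)
  have "standard_brownian_motion M B"
  proof
    fix t :: real assume "0 \<le> t"
    with standard_brownian_motion.measurable_at[OF bm] show "B t \<in> borel_measurable M"
      unfolding B_def[abs_def] by (intro borel_measurable_divide borel_measurable_sum borel_measurable_times) auto
  next
    show "AE \<omega> in M. B 0 \<omega> = 0"
      using AE_all_start_zero[OF W] by eventually_elim (simp add: B_def)
  next
    fix \<omega> assume "\<omega> \<in> space M"
    with standard_brownian_motion.continuous_paths[OF bm] show "continuous_on {0..} (\<lambda>t. B t \<omega>)"
      unfolding B_def using n by (intro continuous_on_divide continuous_on_sum continuous_on_mult continuous_on_const) auto
  next
    fix s t :: real assume st: "0 \<le> s" "s < t"
    have D: "distributed M lborel (\<lambda>\<omega>. (\<sigma> i / sqrt n) * (W i t \<omega> - W i s \<omega>)) (normal_density 0 (sqrt ((t - s) / n)))"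
      if i: "i \<in> {1..n}" for i
    proof -
      have "\<sigma> i \<noteq> 0" using \<sigma>[OF i] by auto
      moreover have "\<bar>\<sigma> i / sqrt n\<bar> * sqrt (t - s) = sqrt ((t - s) / n)"
        using \<sigma>[OF i] by (simp add: real_sqrt_divide)
      ultimately show ?thesis
        using normal_density_affine[OF standard_brownian_motion.normal_increments[OF bm[OF i] st], of "\<sigma> i / sqrt n" 0] st n
        by simp
    qed
    have "indep_vars (\<lambda>_. borel) (\<lambda>i \<omega>. (\<lambda>y. (\<sigma> i / sqrt n) * (y t - y s)) (\<lambda>t\<in>{0..}. W i t \<omega>)) {1..n}"
      using st by (intro indep_vars_compose2[OF independent_brownian_motionsD(3)[OF W]]
          borel_measurable_times borel_measurable_diff measurable_component_singleton) auto
    then have ind: "indep_vars (\<lambda>_. borel) (\<lambda>i \<omega>. (\<sigma> i / sqrt n) * (W i t \<omega> - W i s \<omega>)) {1..n}"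
      using st by simp
    have "distributed M lborel (\<lambda>\<omega>. \<Sum>i\<in>{1..n}. (\<sigma> i / sqrt n) * (W i t \<omega> - W i s \<omega>))
        (normal_density (\<Sum>i\<in>{1..n}. 0) (sqrt (\<Sum>i\<in>{1..n}. (sqrt ((t - s) / n))\<^sup>2)))"
      using n st by (intro sum_indep_normal ind D) auto
    then show "distributed M lborel (\<lambda>\<omega>. B t \<omega> - B s \<omega>) (normal_density 0 (sqrt (t - s)))"
      using n st by (simp add: B_diff)
  next
    fix \<tau> :: "nat \<Rightarrow> real" and k assume \<tau>: "0 \<le> \<tau> 0" "strict_mono_on {..k} \<tau>"
    let ?X = "\<lambda>(i, j) \<omega>. W i (\<tau> (Suc j)) \<omega> - W i (\<tau> j) \<omega>"
    let ?f = "\<lambda>j p. \<Sum>i=1..n. (\<sigma> i / sqrt n) * p (i, j)"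
    have r: "indep_vars (\<lambda>j. PiM ({1..n} \<times> {j}) (\<lambda>_. borel)) (\<lambda>j \<omega>. restrict (\<lambda>q. ?X q \<omega>) ({1..n} \<times> {j})) {..<k}"
      by (intro indep_vars_restrict[OF indep_increments_jointly[OF W \<tau>]]) (auto simp: disjoint_family_on_def)
    have "indep_vars (\<lambda>_. borel) (\<lambda>j \<omega>. ?f j (restrict (\<lambda>q. ?X q \<omega>) ({1..n} \<times> {j}))) {..<k}"
      by (rule indep_vars_compose2[OF r])
        (intro borel_measurable_sum borel_measurable_times measurable_component_singleton, auto)
    then show "indep_vars (\<lambda>_. borel) (\<lambda>j \<omega>. B (\<tau> (Suc j)) \<omega> - B (\<tau> j) \<omega>) {..<k}"
      by (rule indep_vars_cong[THEN iffD1, rotated 3]) (auto simp: B_diff fun_eq_iff)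
  qed
  then show ?thesis by (simp add: B_def[abs_def])
qed

text \<open>The starting time is free because persistence needs the bound after time
  \<open>\<delta>\<^sup>2\<close> as well as from time \<open>0\<close>.\<close>

lemma (in standard_brownian_motion) Levy_grid:
  fixes \<tau> :: "nat \<Rightarrow> real"
  assumes \<tau>: "0 \<le> \<tau> 0" "strict_mono_on {..L} \<tau>" and L: "0 < L"
  shows "prob {\<omega> \<in> space M. \<exists>k\<le>L. a < W (\<tau> k) \<omega> - W (\<tau> 0) \<omega>}
    \<le> 2 * measure std_gauss {a / sqrt (\<tau> L - \<tau> 0)<..}"
proof -
  have lt: "\<tau> j < \<tau> k" if "j < k" "k \<le> L" for j k
    using monotone_onD[OF \<tau>(2), of j k] that order.trans[of j k L] by simp
  have nn: "0 \<le> \<tau> j" if "j \<le> L" for j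
    using \<tau> lt[of 0 j] that by (cases "j = 0") auto
  let ?\<sigma> = "sqrt (\<tau> L - \<tau> 0)"
  have \<sigma>: "0 < ?\<sigma>" using lt[of 0 L] L by simp
  have tel: "(\<Sum>j<k. W (\<tau> (Suc j)) \<omega> - W (\<tau> j) \<omega>) = W (\<tau> k) \<omega> - W (\<tau> 0) \<omega>" for k \<omega>
    using sum_lessThan_telescope[of "\<lambda>j. W (\<tau> j) \<omega>" k] by simp
  have "prob {\<omega> \<in> space M. \<exists>k\<le>L. a < (\<Sum>j<k. W (\<tau> (Suc j)) \<omega> - W (\<tau> j) \<omega>)}
      \<le> 2 * prob {\<omega> \<in> space M. a < (\<Sum>j<L. W (\<tau> (Suc j)) \<omega> - W (\<tau> j) \<omega>)}"
  proof (rule Levy_maximal_inequality[OF indep_increments[OF \<tau>]])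
    fix j assume j: "j < L"
    show "distributed M lborel (\<lambda>\<omega>. W (\<tau> (Suc j)) \<omega> - W (\<tau> j) \<omega>)
        (normal_density 0 (sqrt (\<tau> (Suc j) - \<tau> j)))"
      using j nn lt[of j "Suc j"] by (intro normal_increments) auto
    show "0 < sqrt (\<tau> (Suc j) - \<tau> j)" using j lt[of j "Suc j"] by simp
  qed
  also have "prob {\<omega> \<in> space M. a < (\<Sum>j<L. W (\<tau> (Suc j)) \<omega> - W (\<tau> j) \<omega>)}
      = measure std_gauss {a / ?\<sigma><..}"
    unfolding tel using prob_normal_ge(2)[OF normal_increments[OF nn lt] \<sigma>, of "a / ?\<sigma>"] \<sigma> L by simp
  finally show ?thesis unfolding tel .
qed

subsection \<open>The upper bounds\<close>

text \<open>The exit estimate is used on a fine grid, the small-ball estimate on a coarse one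
  contained in it. The restriction \<epsilon> < exp (-1) makes l = |ln \<epsilon>| larger than 1, so
  that N \<le> l / r + 1 \<le> c l and the stray term \<epsilon> is at most \<epsilon> l^n.\<close>

lemma persistence_upper_bound:
  fixes n :: nat
  assumes W: "independent_brownian_motions M n W" and n: "1 \<le> n"
    and \<epsilon>: "0 < \<epsilon>" "\<epsilon> < exp (- 1)"
  defines "p \<equiv> measure std_gauss {1..} ^ n"
  defines "c \<equiv> 1 / - ln (1 - p) + 1"
  shows "measure M {\<omega> \<in> space M. (SUP u\<in>{0..1}. \<Prod>i=1..n. W i u \<omega>) \<le> \<epsilon>} \<le> (3 * c ^ n + 1) * \<epsilon> * \<bar>ln \<epsilon>\<bar> ^ n"
proof -
  interpret prob_space M using independent_brownian_motionsD(1)[OF W] .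
  have p: "0 < p" "p < 1"
  proof -
    have "measure std_gauss {1..} \<le> 1 / 2"
      using std_gauss_tail_mono[of 0 1] by (simp add: std_gauss_half)
    then show "0 < p" "p < 1" using std_gauss_tail_pos n unfolding p_def by (auto intro!: power_less_one_iff[THEN iffD2])
  qed
  define r where "r = - ln (1 - p)"
  have r: "0 < r" using p by (simp add: r_def)
  define l where "l = - ln \<epsilon>"
  have "ln \<epsilon> < ln (exp (- 1))" using \<epsilon> by (intro ln_less_cancel_iff[THEN iffD2]) auto
  then have l: "1 < l" by (simp add: l_def)
  have l_abs: "\<bar>ln \<epsilon>\<bar> = l" using l by (simp add: l_def)
  \<comment> \<open>The least number of coarse steps for which (1 - p)^N \<le> \<epsilon>.\<close>
  define N where "N = nat \<lceil>l / r\<rceil>"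
  have lr: "0 < l / r" using l r by simp
  have N1: "l / r \<le> real N" "real N \<le> l / r + 1" unfolding N_def using lr by linarith+
  then have N: "0 < N" using lr by (cases N) auto
  have "real N \<le> l / r + l" using N1 l by linarith
  also have "\<dots> = c * l" by (simp add: c_def r_def algebra_simps)
  finally have Ncl: "real N \<le> c * l" .
  have qN: "(1 - p) ^ N \<le> \<epsilon>"
  proof -
    have "(1 - p) ^ N = exp (real N * ln (1 - p))" using p by (simp add: exp_of_nat_mult)
    also have "\<dots> \<le> exp (- l)"
    proof -
      have "l \<le> real N * r" using N1(1) r by (simp add: pos_divide_le_eq)
      then show ?thesis by (simp add: r_def)
    qed
    also have "\<dots> = \<epsilon>" using \<epsilon> by (simp add: l_def)
    finally show ?thesis .
  qed
  define K :: real where "K = 8 ^ n * n * 6 ^ n * 3"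
  \<comment> \<open>With h = 1 / L the overshoot term is K / (L \<epsilon>^3), which is at most
    \<epsilon> once L \<ge> K / \<epsilon>^4. Taking \<open>L\<close> as a multiple of
    \<open>N\<close> puts the coarse times on the fine grid.\<close>
  define m where "m = Suc (nat \<lceil>K / \<epsilon> ^ 4\<rceil>)"
  define L where "L = N * m"
  define h where "h = 1 / real L"
  define h\<^sub>0 where "h\<^sub>0 = 1 / real N"
  have m: "0 < m" by (simp add: m_def)
  have L: "0 < L" using N m by (simp add: L_def)
  have h: "0 < h" "0 < h\<^sub>0" using L N by (auto simp: h_def h\<^sub>0_def)
  interpret F: gaussian_array M "{1..n}" L h "\<lambda>(i, j) \<omega>. W i (real (Suc j) * h) \<omega> - W i (real j * h) \<omega>"
    by (rule gaussian_array_increments[OF W n h(1)])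
  interpret C: gaussian_array M "{1..n}" N h\<^sub>0 "\<lambda>(i, j) \<omega>. W i (real (Suc j) * h\<^sub>0) \<omega> - W i (real j * h\<^sub>0) \<omega>"
    by (rule gaussian_array_increments[OF W n h(2)])
  note eqF = AE_walk_prod_eq[OF W n h(1)] and eqC = AE_walk_prod_eq[OF W n h(2)]
  define \<eta> where "\<eta> = sqrt h\<^sub>0 ^ n"
  have \<eta>: "0 < \<eta>" using h by (simp add: \<eta>_def)
  \<comment> \<open>Exactly, 1 / \<eta> is N^(n/2); the estimate sqrt N \<le> N \<le> c l leads to
    the power \<open>n\<close> of the logarithm.\<close>
  have \<eta>_inv: "1 / \<eta> \<le> (c * l) ^ n"
  proof -
    have "1 / \<eta> = sqrt (real N) ^ n" unfolding \<eta>_def h\<^sub>0_def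
      by (simp add: real_sqrt_divide power_one_over)
    also have "\<dots> \<le> (c * l) ^ n"
    proof (rule power_mono)
      have "sqrt (real N) \<le> sqrt (real N * real N)" using N by (intro real_sqrt_le_mono) auto
      then show "sqrt (real N) \<le> c * l" using Ncl by simp
    qed simp
    finally show ?thesis .
  qed
  have "prob {\<omega> \<in> space M. (SUP u\<in>{0..1}. \<Prod>i=1..n. W i u \<omega>) \<le> \<epsilon>}
      \<le> prob {\<omega> \<in> space M. \<forall>k\<le>L. F.walk_prod k \<omega> \<in> {..\<epsilon>}}"
  proof (rule finite_measure_mono_AE)
    show "AE \<omega> in M. \<omega> \<in> {\<omega> \<in> space M. (SUP u\<in>{0..1}. \<Prod>i=1..n. W i u \<omega>) \<le> \<epsilon>}
        \<longrightarrow> \<omega> \<in> {\<omega> \<in> space M. \<forall>k\<le>L. F.walk_prod k \<omega> \<in> {..\<epsilon>}}"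
      using eqF
    proof eventually_elim
      case (elim \<omega>)
      have "real k * h \<in> {0..1}" if "k \<le> L" for k using that L by (simp add: h_def)
      then show ?case
        using brownian_prod_continuous[OF W, of \<omega>] elim by (auto simp: continuous_SUP_le_iff)
    qed
  qed (intro F.all_walk_prod_measurable, auto)
  also have "\<dots> = prob {\<omega> \<in> space M. \<forall>k\<le>L. F.walk_prod k \<omega> \<le> \<epsilon>}" by simp
  also have "\<dots> \<le> (2 * \<epsilon> + real L * (8 ^ n * n * 6 ^ n * 3 * h\<^sup>2 / \<epsilon> ^ 3)) / \<eta>
      + prob {\<omega> \<in> space M. \<forall>k\<le>L. \<bar>F.walk_prod k \<omega>\<bar> < \<eta>}"
    using F.walk_prod_persistence[OF _ \<epsilon>(1) \<eta>] L by (simp add: h_def)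
  finally have A: "prob {\<omega> \<in> space M. (SUP u\<in>{0..1}. \<Prod>i=1..n. W i u \<omega>) \<le> \<epsilon>}
      \<le> (2 * \<epsilon> + real L * (8 ^ n * n * 6 ^ n * 3 * h\<^sup>2 / \<epsilon> ^ 3)) / \<eta>
      + prob {\<omega> \<in> space M. \<forall>k\<le>L. \<bar>F.walk_prod k \<omega>\<bar> < \<eta>}" .
  have B: "real L * (8 ^ n * n * 6 ^ n * 3 * h\<^sup>2 / \<epsilon> ^ 3) \<le> \<epsilon>"
  proof -
    have "K / \<epsilon> ^ 4 \<le> real m" unfolding m_def by linarith
    also have "\<dots> \<le> real L" using N unfolding L_def of_nat_le_iff by (cases N) auto
    finally have "K \<le> real L * \<epsilon> ^ 4" using \<epsilon> by (simp add: pos_divide_le_eq)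
    then have "K / real L \<le> \<epsilon> * \<epsilon> ^ 3" using L by (simp add: field_simps power_numeral_reduce)
    then have "K / real L / \<epsilon> ^ 3 \<le> \<epsilon>" using \<epsilon> by (subst pos_divide_le_eq) auto
    also have "K / real L / \<epsilon> ^ 3 = real L * (8 ^ n * n * 6 ^ n * 3 * h\<^sup>2 / \<epsilon> ^ 3)"
      using L by (simp add: K_def h_def power2_eq_square)
    finally show ?thesis .
  qed
  \<comment> \<open>The coarse walk at \<open>k\<close> is the fine walk at \<open>k * m\<close>,
    and \<eta> is the ball radius that belongs to the coarse mesh.\<close>
  have "prob {\<omega> \<in> space M. \<forall>k\<le>L. \<bar>F.walk_prod k \<omega>\<bar> < \<eta>} \<le> prob {\<omega> \<in> space M. \<forall>k\<le>N. C.walk_prod k \<omega> \<in> {- \<eta><..<\<eta>}}"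
  proof (rule finite_measure_mono_AE)
    show "AE \<omega> in M. \<omega> \<in> {\<omega> \<in> space M. \<forall>k\<le>L. \<bar>F.walk_prod k \<omega>\<bar> < \<eta>}
        \<longrightarrow> \<omega> \<in> {\<omega> \<in> space M. \<forall>k\<le>N. C.walk_prod k \<omega> \<in> {- \<eta><..<\<eta>}}"
      using eqF eqC
    proof eventually_elim
      case (elim \<omega>)
      have grid: "C.walk_prod k \<omega> = F.walk_prod (k * m) \<omega>" for k
      proof -
        have eq: "real (k * m) * h = real k * h\<^sub>0" using N m by (simp add: h_def h\<^sub>0_def L_def)
        show ?thesis
          unfolding elim(1)[THEN spec, of "k * m"] elim(2)[THEN spec, of k] eq ..
      qed
      have "k * m \<le> L" if "k \<le> N" for k using that by (simp add: L_def)
      moreover have "C.walk_prod k \<omega> \<in> {- \<eta><..<\<eta>}" if "\<bar>F.walk_prod (k * m) \<omega>\<bar> < \<eta>" for k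
        using that unfolding grid abs_less_iff by auto
      ultimately show ?case by blast
    qed
  qed (intro C.all_walk_prod_measurable, auto)
  also have "\<dots> = prob {\<omega> \<in> space M. \<forall>k\<le>N. \<bar>C.walk_prod k \<omega>\<bar> < sqrt h\<^sub>0 ^ card {1..n}}"
  proof -
    have "C.walk_prod k \<omega> \<in> {- \<eta><..<\<eta>} \<longleftrightarrow> \<bar>C.walk_prod k \<omega>\<bar> < sqrt h\<^sub>0 ^ card {1..n}" for k \<omega>
      by (auto simp: \<eta>_def abs_less_iff)
    then show ?thesis by (simp only:)
  qed
  also have "\<dots> \<le> (1 - p) ^ N"
    using C.walk_prod_small_ball[of N] by (simp add: p_def)
  finally have D: "prob {\<omega> \<in> space M. \<forall>k\<le>L. \<bar>F.walk_prod k \<omega>\<bar> < \<eta>} \<le> \<epsilon>" using qN by linarith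
  have "(2 * \<epsilon> + real L * (8 ^ n * n * 6 ^ n * 3 * h\<^sup>2 / \<epsilon> ^ 3)) / \<eta> \<le> (2 * \<epsilon> + \<epsilon>) / \<eta>"
    using B \<eta> by (intro divide_right_mono add_left_mono) auto
  with A D have "prob {\<omega> \<in> space M. (SUP u\<in>{0..1}. \<Prod>i=1..n. W i u \<omega>) \<le> \<epsilon>} \<le> (2 * \<epsilon> + \<epsilon>) / \<eta> + \<epsilon>"
    by linarith
  also have "(2 * \<epsilon> + \<epsilon>) / \<eta> + \<epsilon> \<le> 3 * \<epsilon> * (c * l) ^ n + \<epsilon> * l ^ n"
  proof (rule add_mono)
    have "3 * \<epsilon> * (1 / \<eta>) \<le> 3 * \<epsilon> * (c * l) ^ n" using \<eta>_inv \<epsilon> by (intro mult_left_mono) auto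
    then show "(2 * \<epsilon> + \<epsilon>) / \<eta> \<le> 3 * \<epsilon> * (c * l) ^ n" by simp
    have "1 \<le> l ^ n" using l by (intro one_le_power) auto
    then show "\<epsilon> \<le> \<epsilon> * l ^ n" using \<epsilon> by simp
  qed
  also have "\<dots> = (3 * c ^ n + 1) * \<epsilon> * l ^ n" by (simp add: power_mult_distrib algebra_simps)
  finally show ?thesis unfolding l_abs .
qed

section \<open>The upper tail of the supremum, for one Brownian motion and then for the
  product\<close>

lemma (in standard_brownian_motion) prob_sup_ge_le:
  assumes a: "0 < a"
  shows "prob {\<omega> \<in> space M. a \<le> (SUP u\<in>{0..1}. W u \<omega>)} \<le> 2 * (exp (- a\<^sup>2 / 2) / a)"
proof -
  have cont: "continuous_on {0..1} (\<lambda>u. W u \<omega>)" if "\<omega> \<in> space M" for \<omega>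
    using continuous_paths[OF that] by (rule continuous_on_subset) auto
  \<comment> \<open>A supremum equal to \<open>a\<close> need not be seen on any dyadic grid. For
    \<open>b < a\<close>, however, some grid value exceeds \<open>b\<close>, and the grid events
    \<open>E m\<close> increase.\<close>
  have le: "prob {\<omega> \<in> space M. a \<le> (SUP u\<in>{0..1}. W u \<omega>)} \<le> 2 * (exp (- b\<^sup>2 / 2) / b)"
    if b: "0 < b" "b < a" for b
  proof -
    define E where "E m = {\<omega> \<in> space M. \<exists>k\<in>{..2 ^ m}. b < W (real k / 2 ^ m) \<omega>}" for m :: nat
    have E: "E m \<in> sets M" for m
      unfolding E_def by (intro sets.sets_Collect_finite_Ex borel_measurable_less measurable_at) auto
    have inc: "incseq E"
    proof (rule incseq_SucI, rule subsetI)
      fix m \<omega> assume "\<omega> \<in> E m"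
      then obtain k where k: "\<omega> \<in> space M" "k \<le> 2 ^ m" "b < W (real k / 2 ^ m) \<omega>" by (auto simp: E_def)
      then have "b < W (real (2 * k) / 2 ^ Suc m) \<omega>" by simp
      with k show "\<omega> \<in> E (Suc m)"
        unfolding E_def by (auto intro!: bexI[of _ "2 * k"])
    qed
    have "prob (E m) \<le> 2 * (exp (- b\<^sup>2 / 2) / b)" for m
    proof -
      have "prob (E m) \<le> prob {\<omega> \<in> space M. \<exists>k\<le>2 ^ m. b < W (real k / 2 ^ m) \<omega> - W (real 0 / 2 ^ m) \<omega>}"
      proof (rule finite_measure_mono_AE)
        show "AE \<omega> in M. \<omega> \<in> E m \<longrightarrow> \<omega> \<in> {\<omega> \<in> space M. \<exists>k\<le>2 ^ m. b < W (real k / 2 ^ m) \<omega> - W (real 0 / 2 ^ m) \<omega>}"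
          using start_zero by eventually_elim (auto simp: E_def)
        have "{\<omega> \<in> space M. \<exists>k\<in>{..2 ^ m}. b < W (real k / 2 ^ m) \<omega> - W (real 0 / 2 ^ m) \<omega>} \<in> sets M"
          by (intro sets.sets_Collect_finite_Ex borel_measurable_less borel_measurable_diff measurable_at) auto
        then show "{\<omega> \<in> space M. \<exists>k\<le>2 ^ m. b < W (real k / 2 ^ m) \<omega> - W (real 0 / 2 ^ m) \<omega>} \<in> sets M"
          by (simp only: Bex_def atMost_iff)
      qed
      also have "\<dots> \<le> 2 * measure std_gauss {b / sqrt (real (2 ^ m) / 2 ^ m - real 0 / 2 ^ m)<..}"
        by (rule Levy_grid) (auto simp: strict_mono_on_def divide_strict_right_mono)
      also have "\<dots> = 2 * measure std_gauss {b<..}" by simp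
      also have "\<dots> \<le> 2 * measure std_gauss {b..}"
        by (intro mult_left_mono std_gauss.finite_measure_mono) auto
      also have "\<dots> \<le> 2 * (exp (- b\<^sup>2 / 2) / b)"
        using std_gauss_tail_le[OF b(1)] by simp
      finally show ?thesis .
    qed
    moreover have "(\<lambda>m. prob (E m)) \<longlonglongrightarrow> prob (\<Union>m. E m)"
      using E inc by (intro finite_Lim_measure_incseq) auto
    ultimately have "prob (\<Union>m. E m) \<le> 2 * (exp (- b\<^sup>2 / 2) / b)"
      by (intro tendsto_upperbound[of "\<lambda>m. prob (E m)"]) auto
    moreover have "{\<omega> \<in> space M. a \<le> (SUP u\<in>{0..1}. W u \<omega>)} \<subseteq> (\<Union>m. E m)"
    proof
      fix \<omega> assume "\<omega> \<in> {\<omega> \<in> space M. a \<le> (SUP u\<in>{0..1}. W u \<omega>)}"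
      then have \<omega>: "\<omega> \<in> space M" and "\<not> (\<forall>u\<in>{0..1}. W u \<omega> \<le> b)"
        using b continuous_SUP_ge_iff[OF cont] by force+
      then show "\<omega> \<in> (\<Union>m. E m)"
        using all_le_iff_all_dyadic_le[of 0 1 "\<lambda>u. W u \<omega>" b] cont[OF \<omega>]
        by (auto simp: E_def not_le intro!: bexI)
    qed
    then have "prob {\<omega> \<in> space M. a \<le> (SUP u\<in>{0..1}. W u \<omega>)} \<le> prob (\<Union>m. E m)"
      using E by (intro finite_measure_mono) auto
    ultimately show ?thesis by linarith
  qed
  \<comment> \<open>The bound is continuous in \<open>b\<close>, so letting \<open>b\<close>
    increase to \<open>a\<close> costs nothing.\<close>
  have "((\<lambda>b. 2 * (exp (- b\<^sup>2 / 2) / b)) \<longlongrightarrow> 2 * (exp (- a\<^sup>2 / 2) / a)) (at_left a)"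
    using a by (intro tendsto_intros) auto
  moreover have "\<forall>\<^sub>F b in at_left a. prob {\<omega> \<in> space M. a \<le> (SUP u\<in>{0..1}. W u \<omega>)} \<le> 2 * (exp (- b\<^sup>2 / 2) / b)"
    using eventually_at_left_real[OF a] by eventually_elim (rule le, auto)
  ultimately show ?thesis
    by (intro tendsto_lowerbound[of "\<lambda>b. 2 * (exp (- b\<^sup>2 / 2) / b)"]) auto
qed

text \<open>The exponent is sharp because the arithmetic-geometric inequality is an equality on the
  diagonal: a = sqrt n * y gives a^2 / 2 = n y^2 / 2. The factor 2^(n+1) is the 2 of Levy's
  inequality times the number of sign patterns.\<close>

lemma deviation_upper_bound:
  fixes n :: nat
  assumes W: "independent_brownian_motions M n W" and n: "1 \<le> n" and y: "0 < y"
  shows "measure M {\<omega> \<in> space M. y ^ n \<le> (SUP u\<in>{0..1}. \<Prod>i=1..n. W i u \<omega>)}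
    \<le> 2 ^ (n + 1) / y * exp (- (real n / 2) * y\<^sup>2)"
proof -
  interpret prob_space M using independent_brownian_motionsD(1)[OF W] .
  define \<Sigma> where "\<Sigma> = ({1..n} \<rightarrow>\<^sub>E {-1, 1 :: real})"
  define B where "B \<sigma> t \<omega> = (\<Sum>i=1..n. \<sigma> i * W i t \<omega>) / sqrt n" for \<sigma> t \<omega>
  have bm: "standard_brownian_motion M (B \<sigma>)" if "\<sigma> \<in> \<Sigma>" for \<sigma>
    unfolding B_def[abs_def] using that
    by (intro standard_brownian_motion_signed_sum[OF W n]) (force simp: \<Sigma>_def PiE_iff)
  have cont: "continuous_on {0..1} (\<lambda>t. B \<sigma> t \<omega>)" if "\<sigma> \<in> \<Sigma>" "\<omega> \<in> space M" for \<sigma> \<omega>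
    using standard_brownian_motion.continuous_paths[OF bm[OF that(1)] that(2)]
    by (rule continuous_on_subset) auto
  define a where "a = sqrt n * y"
  have a: "0 < a" using n y by (simp add: a_def)
  define E where "E \<sigma> = {\<omega> \<in> space M. a \<le> (SUP u\<in>{0..1}. B \<sigma> u \<omega>)}" for \<sigma>
  have E: "E \<sigma> \<in> sets M" if "\<sigma> \<in> \<Sigma>" for \<sigma>
    unfolding E_def using that cont standard_brownian_motion.measurable_at[OF bm[OF that]]
    by (intro borel_measurable_le continuous_SUP_measurable) auto
  have fin: "finite \<Sigma>" and card: "card \<Sigma> = 2 ^ n"
    by (auto simp: \<Sigma>_def card_PiE numeral_2_eq_2 intro!: finite_PiE)
  have "{\<omega> \<in> space M. y ^ n \<le> (SUP u\<in>{0..1}. \<Prod>i=1..n. W i u \<omega>)} \<subseteq> (\<Union>\<sigma>\<in>\<Sigma>. E \<sigma>)"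
  proof
    fix \<omega> assume "\<omega> \<in> {\<omega> \<in> space M. y ^ n \<le> (SUP u\<in>{0..1}. \<Prod>i=1..n. W i u \<omega>)}"
    then obtain u where \<omega>: "\<omega> \<in> space M" and u: "u \<in> {0..1}" and prod: "y ^ n \<le> (\<Prod>i=1..n. W i u \<omega>)"
      using continuous_SUP_ge_iff[OF brownian_prod_continuous[OF W]] by auto
    \<comment> \<open>The pattern depends on the path and on the time \<open>u\<close>, which is why
      the union runs over all of \<open>\<Sigma>\<close>.\<close>
    define \<sigma> where "\<sigma> = (\<lambda>i\<in>{1..n}. if 0 \<le> W i u \<omega> then 1 else -1 :: real)"
    have \<sigma>: "\<sigma> \<in> \<Sigma>" by (auto simp: \<sigma>_def \<Sigma>_def)
    have abs: "\<sigma> i * W i u \<omega> = \<bar>W i u \<omega>\<bar>" if "i \<in> {1..n}" for i using that by (auto simp: \<sigma>_def)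
    have prod_abs: "y ^ n \<le> (\<Prod>i=1..n. \<bar>W i u \<omega>\<bar>)"
      using prod abs_ge_self[of "\<Prod>i=1..n. W i u \<omega>"] by (simp add: abs_prod)
    moreover have "0 < y ^ n" using y by simp
    ultimately have pos: "0 < (\<Prod>i=1..n. \<bar>W i u \<omega>\<bar>)" by linarith
    note prod_abs
    also have "\<dots> \<le> ((\<Sum>i=1..n. \<bar>W i u \<omega>\<bar>) / n) ^ n"
    proof -
      have "root n (\<Prod>i=1..n. \<bar>W i u \<omega>\<bar>) \<le> (\<Sum>i=1..n. \<bar>W i u \<omega>\<bar>) / n"
        using arith_geom_mean[of "{1..n}" "\<lambda>i. \<bar>W i u \<omega>\<bar>"] n pos
        by (simp add: root_powr_inverse sum_divide_distrib)
      then have "root n (\<Prod>i=1..n. \<bar>W i u \<omega>\<bar>) ^ n \<le> ((\<Sum>i=1..n. \<bar>W i u \<omega>\<bar>) / n) ^ n"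
        using n by (intro power_mono real_root_ge_zero prod_nonneg) auto
      then show ?thesis using n by (simp add: prod_nonneg)
    qed
    finally have "y \<le> (\<Sum>i=1..n. \<bar>W i u \<omega>\<bar>) / n"
      using n y by (subst (asm) power_mono_iff) (auto intro!: divide_nonneg_nonneg sum_nonneg)
    then have "n * y / sqrt n \<le> B \<sigma> u \<omega>"
      unfolding B_def using n abs by (intro divide_right_mono) (simp_all add: field_simps)
    moreover have "n * y / sqrt n = a"
      using n by (simp add: a_def field_simps)
    ultimately have "\<exists>u\<in>{0..1}. a \<le> B \<sigma> u \<omega>" using u by auto
    then have "\<omega> \<in> E \<sigma>"
      using \<omega> continuous_SUP_ge_iff[OF cont[OF \<sigma> \<omega>]] by (auto simp: E_def)
    with \<sigma> show "\<omega> \<in> (\<Union>\<sigma>\<in>\<Sigma>. E \<sigma>)" by auto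
  qed
  then have "prob {\<omega> \<in> space M. y ^ n \<le> (SUP u\<in>{0..1}. \<Prod>i=1..n. W i u \<omega>)} \<le> prob (\<Union>\<sigma>\<in>\<Sigma>. E \<sigma>)"
    using E fin by (intro finite_measure_mono) auto
  also have "\<dots> \<le> (\<Sum>\<sigma>\<in>\<Sigma>. prob (E \<sigma>))"
    using E fin by (intro measure_UNION_le) auto
  also have "\<dots> \<le> (\<Sum>\<sigma>\<in>\<Sigma>. 2 * (exp (- a\<^sup>2 / 2) / a))"
    unfolding E_def using standard_brownian_motion.prob_sup_ge_le[OF bm a] by (intro sum_mono)
  also have "\<dots> = 2 ^ (n + 1) * (exp (- a\<^sup>2 / 2) / a)" by (simp add: card)
  \<comment> \<open>Replacing 1 / a by 1 / y loses only the constant factor sqrt n.\<close>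
  also have "\<dots> \<le> 2 ^ (n + 1) * (exp (- a\<^sup>2 / 2) / y)"
  proof (intro mult_left_mono divide_left_mono)
    show "y \<le> a" using n y by (simp add: a_def)
  qed (use a y in auto)
  also have "exp (- a\<^sup>2 / 2) = exp (- (real n / 2) * y\<^sup>2)" by (simp add: a_def power_mult_distrib)
  finally show ?thesis by simp
qed

subsection \<open>The lower bound for large deviations\<close>

text \<open>
  The tangent space at \<open>(y, \<dots>, y)\<close> of the surface \<open>\<Prod>x\<^sub>i = y\<^sup>n\<close>: moving \<open>n - 1\<close> coordinates by
  \<open>t\<^sub>i \<in> [0, 1]\<close> and adjusting the last one changes \<open>\<Sum>x\<^sub>i\<^sup>2\<close> by a bounded amount only.
\<close>

lemma sum_squares_near_diagonal:
  fixes t :: "'i \<Rightarrow> real"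
  assumes J: "finite J" and y: "1 \<le> y" and t: "\<And>i. i \<in> J \<Longrightarrow> 0 \<le> t i \<and> t i \<le> 1"
  defines "z \<equiv> y / (\<Prod>i\<in>J. 1 + t i / y)"
  shows "0 < z" and "(\<Sum>i\<in>J. (y + t i + 1 / y)\<^sup>2) + (z + 1 / y)\<^sup>2
    \<le> (real (card J) + 1) * y\<^sup>2 + (8 * real (card J) + 4 * (real (card J))\<^sup>2 + 3)"
proof -
  define s where "s i = t i / y" for i
  have s: "0 \<le> s i" "s i \<le> 1" "y * s i = t i" if "i \<in> J" for i
    using t[OF that] y by (auto simp: s_def field_simps)
  define T where "T = (\<Sum>i\<in>J. t i)"
  \<comment> \<open>Since ln (1 + s) \<ge> s - s^2 on [0, 1], the ratio z / y is at most exp (v /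
    2). Here v is of order 1 / y, so y * v stays bounded.\<close>
  define v where "v = 2 * (\<Sum>i\<in>J. - s i + (s i)\<^sup>2)"
  have T: "0 \<le> T" "T \<le> real (card J)"
    unfolding T_def using t sum_mono[of J t "\<lambda>_. 1"] by (auto intro!: sum_nonneg)
  have prod_ge1: "1 \<le> (\<Prod>i\<in>J. 1 + s i)" using s by (intro prod_ge_1) auto
  have z_eq: "z = y / (\<Prod>i\<in>J. 1 + s i)" by (simp add: z_def s_def)
  show z: "0 < z" unfolding z_eq using prod_ge1 y by (intro divide_pos_pos) auto
  have z_le: "z \<le> y" unfolding z_eq using prod_ge1 y by (simp add: divide_le_eq)
  have exp_le: "1 / (\<Prod>i\<in>J. 1 + s i) \<le> exp (v / 2)"
  proof -
    have "1 / (\<Prod>i\<in>J. 1 + s i) = (\<Prod>i\<in>J. 1 / (1 + s i))" by (simp add: prod_dividef)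
    also have "\<dots> \<le> (\<Prod>i\<in>J. exp (- s i + (s i)\<^sup>2))"
    proof (intro prod_mono conjI)
      fix i assume i: "i \<in> J"
      have "1 / (1 + s i) = exp (- ln (1 + s i))" using s[OF i] by (simp add: exp_minus field_simps)
      also have "\<dots> \<le> exp (- s i + (s i)\<^sup>2)"
        using ln_one_plus_pos_lower_bound[of "s i"] s[OF i] by simp
      finally show "1 / (1 + s i) \<le> exp (- s i + (s i)\<^sup>2)" .
    qed (use s in auto)
    also have "\<dots> = exp (v / 2)" using J by (simp add: v_def exp_sum)
    finally show ?thesis .
  qed
  have ssq: "0 \<le> (s i)\<^sup>2" "(s i)\<^sup>2 \<le> s i" if "i \<in> J" for i
    using s[OF that] by (auto simp: power2_eq_square mult_left_le)
  have yv: "y * v \<le> 0" "- (2 * T) \<le> y * v"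
  proof -
    have "v \<le> 0" unfolding v_def using ssq by (simp add: sum_nonpos)
    then show "y * v \<le> 0" using y by (simp add: mult_nonneg_nonpos)
    have "y * (\<Sum>i\<in>J. - s i) \<le> y * (\<Sum>i\<in>J. - s i + (s i)\<^sup>2)"
      using y ssq by (intro mult_left_mono sum_mono) auto
    moreover have "y * (\<Sum>i\<in>J. - s i) = - T"
      unfolding T_def by (simp add: sum_distrib_left sum_negf s cong: sum.cong)
    ultimately show "- (2 * T) \<le> y * v" unfolding v_def by linarith
  qed
  \<comment> \<open>The term of order y, namely - 2 y T, is going to cancel the + 2 y T produced by
    the coordinates in \<open>J\<close>.\<close>
  have y2v: "y\<^sup>2 * v \<le> - (2 * y * T) + 2 * real (card J)"
  proof -
    have "y\<^sup>2 * v = 2 * (\<Sum>i\<in>J. - (y * t i) + (t i)\<^sup>2)"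
    proof -
      have "y\<^sup>2 * (- s i + (s i)\<^sup>2) = - (y * t i) + (t i)\<^sup>2" if "i \<in> J" for i
        using s(3)[OF that, symmetric] by (simp add: power2_eq_square algebra_simps)
      then have "(\<Sum>i\<in>J. y\<^sup>2 * (- s i + (s i)\<^sup>2)) = (\<Sum>i\<in>J. - (y * t i) + (t i)\<^sup>2)"
        by (intro sum.cong refl)
      then show ?thesis unfolding v_def sum_distrib_left[symmetric] by (simp only: mult.left_commute[of _ 2])
    qed
    also have "\<dots> \<le> 2 * (\<Sum>i\<in>J. - (y * t i) + 1)"
      using t by (intro mult_left_mono sum_mono add_left_mono) (auto simp: power_le_one)
    also have "\<dots> = - (2 * y * T) + 2 * real (card J)"
    proof -
      have "(\<Sum>i\<in>J. - (y * t i) + 1) = - (y * T) + real (card J)"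
        unfolding T_def by (simp only: sum.distrib sum_negf sum_distrib_left sum_constant mult_1_right)
      then show ?thesis by simp
    qed
    finally show ?thesis .
  qed
  \<comment> \<open>For v \<le> 0 multiply by the positive number 1 - v \<le> exp (- v): the left
    side becomes at most 1, the right side is 1 - v^3 \<ge> 1.\<close>
  have "exp v \<le> 1 + v + v\<^sup>2"
  proof -
    have v: "v \<le> 0" using yv(1) y by (simp add: mult_le_0_iff)
    have "exp v * (1 - v) \<le> exp v * exp (- v)"
      using exp_ge_add_one_self[of "- v"] by (intro mult_left_mono) auto
    also have "\<dots> \<le> (1 + v + v\<^sup>2) * (1 - v)"
    proof -
      have "v ^ 3 \<le> 0" using v by (simp add: power3_eq_cube mult_nonneg_nonpos mult_nonpos_nonpos)
      moreover have "(1 + v + v\<^sup>2) * (1 - v) = 1 - v ^ 3"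
        by (simp add: power2_eq_square power3_eq_cube algebra_simps)
      ultimately show ?thesis by (simp add: exp_add[symmetric])
    qed
    finally show ?thesis using v by (simp add: mult_le_cancel_right)
  qed
  then have "y\<^sup>2 * exp v \<le> y\<^sup>2 * (1 + v + v\<^sup>2)" by (intro mult_left_mono) auto
  moreover have "z\<^sup>2 \<le> y\<^sup>2 * exp v"
  proof -
    have "z \<le> y * exp (v / 2)"
      using mult_left_mono[OF exp_le, of y] y by (simp add: z_eq)
    then have "z\<^sup>2 \<le> (y * exp (v / 2))\<^sup>2" using z by (intro power_mono) auto
    also have "\<dots> = y\<^sup>2 * exp v" using exp_double[of "v / 2"] by (simp add: power_mult_distrib)
    finally show ?thesis .
  qed
  moreover have "(y * v)\<^sup>2 \<le> 4 * (real (card J))\<^sup>2"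
  proof -
    have "\<bar>y * v\<bar> \<le> 2 * real (card J)" using yv T by linarith
    then have "\<bar>y * v\<bar>\<^sup>2 \<le> (2 * real (card J))\<^sup>2" by (intro power_mono) auto
    then show ?thesis by (simp add: power_mult_distrib)
  qed
  moreover have "y\<^sup>2 * (1 + v + v\<^sup>2) = y\<^sup>2 + y\<^sup>2 * v + (y * v)\<^sup>2"
    by (simp add: power_mult_distrib algebra_simps)
  ultimately have z2: "z\<^sup>2 \<le> y\<^sup>2 - 2 * y * T + 2 * real (card J) + 4 * (real (card J))\<^sup>2"
    using y2v by linarith
  have inv_y: "0 < 1 / y" "1 / y \<le> 1" using y by auto
  have "(z + 1 / y)\<^sup>2 = z\<^sup>2 + 2 * (z * (1 / y)) + (1 / y)\<^sup>2" by (simp add: power2_eq_square algebra_simps)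
  also have "\<dots> \<le> z\<^sup>2 + 2 * 1 + 1"
  proof (intro add_mono order.refl mult_left_mono)
    show "z * (1 / y) \<le> 1" using z_le y by simp
    show "(1 / y)\<^sup>2 \<le> 1" using inv_y by (intro power_le_one) auto
  qed auto
  finally have z': "(z + 1 / y)\<^sup>2 \<le> z\<^sup>2 + 3" by simp
  have "(\<Sum>i\<in>J. (y + t i + 1 / y)\<^sup>2) \<le> (\<Sum>i\<in>J. y\<^sup>2 + 2 * (y * t i) + 6)"
  proof (intro sum_mono)
    fix i assume i: "i \<in> J"
    have "t i + 1 / y \<le> 2" "0 \<le> t i + 1 / y" using t[OF i] inv_y by linarith+
    then have "(t i + 1 / y)\<^sup>2 \<le> 2\<^sup>2" by (intro power_mono) auto
    moreover have "(y + t i + 1 / y)\<^sup>2 = y\<^sup>2 + 2 * (y * t i) + 2 + (t i + 1 / y)\<^sup>2"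
      using y by (simp add: power2_eq_square algebra_simps)
    ultimately show "(y + t i + 1 / y)\<^sup>2 \<le> y\<^sup>2 + 2 * (y * t i) + 6" by simp
  qed
  also have "\<dots> = real (card J) * y\<^sup>2 + 2 * (y * T) + real (card J) * 6"
    unfolding T_def by (simp only: sum.distrib sum_distrib_left sum_constant)
  \<comment> \<open>With d = card J, the constant collects 2 d + 4 d^2 from z^2, 3 from enlarging
    \<open>z\<close> by 1 / y, and 6 d from the other squares.\<close>
  finally show "(\<Sum>i\<in>J. (y + t i + 1 / y)\<^sup>2) + (z + 1 / y)\<^sup>2
    \<le> (real (card J) + 1) * y\<^sup>2 + (8 * real (card J) + 4 * (real (card J))\<^sup>2 + 3)"
    using z' z2 by (simp add: algebra_simps)
qed

text \<open>A multi-index \<open>k\<close> fixes the lower corner of a cube: y + k i / y in the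
  coordinates of \<open>J\<close>, and in the last one the value \<open>z k\<close> that puts the
  corner on the surface where the product is y^n. All coordinates are positive, so the product is at
  least y^n throughout the cube; by \<open>sum_squares_near_diagonal\<close> the density there is of
  order exp (- n y^2 / 2).\<close>

lemma deviation_lower_bound:
  fixes n :: nat
  assumes W: "independent_brownian_motions M n W" and n: "1 \<le> n" and y: "1 \<le> y"
  defines "d \<equiv> real (n - 1)"
  shows "(1 / 2) ^ (n - 1) * (1 / sqrt (2 * pi)) ^ n * exp (- (8 * d + 4 * d\<^sup>2 + 3) / 2) / y * exp (- (real n / 2) * y\<^sup>2)
    \<le> measure M {\<omega> \<in> space M. y ^ n \<le> (SUP u\<in>{0..1}. \<Prod>i=1..n. W i u \<omega>)}"
proof -
  interpret prob_space M using independent_brownian_motionsD(1)[OF W] .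
  \<comment> \<open>One step of length \<open>1\<close>: only the values at time \<open>1\<close>
    enter.\<close>
  interpret gaussian_array M "{1..n}" 1 1 "\<lambda>(i, j) \<omega>. W i (real (Suc j) * 1) \<omega> - W i (real j * 1) \<omega>"
    by (rule gaussian_array_increments[OF W n]) simp
  define Z where "Z i \<omega> = W i 1 \<omega> - W i 0 \<omega>" for i \<omega>
  have Z_ind: "indep_vars (\<lambda>_. borel) Z {1..n}"
    using indep_steps[of 0] by (simp add: Z_def[abs_def])
  have Z_m: "Z i \<in> borel_measurable M" if "i \<in> {1..n}" for i
    using Z_ind that by (auto simp: indep_vars_def)
  have Z_norm: "distributed M lborel (Z i) (normal_density 0 1)" if "i \<in> {1..n}" for i
    using normal[OF that, of 0] by (simp add: Z_def[abs_def])
  define J where "J = {1..<n}"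
  have J: "finite J" "card J = n - 1" "{1..n} = insert n J" "n \<notin> J" using n by (auto simp: J_def)
  define m where "m = nat \<lfloor>y\<rfloor>"
  have "1 \<le> \<lfloor>y\<rfloor>" using y by simp
  \<comment> \<open>For y \<ge> 1 rounding down at most halves \<open>y\<close>, hence the constant
    (1 / 2)^(n - 1).\<close>
  then have m: "real m \<le> y" "y / 2 \<le> real m" unfolding m_def by linarith+
  define t where "t k i = real (k i) / y" for k :: "nat \<Rightarrow> nat" and i
  define \<K> where "\<K> = (J \<rightarrow>\<^sub>E {..<m})"
  have t: "0 \<le> t k i \<and> t k i \<le> 1" if "k \<in> \<K>" "i \<in> J" for k i
  proof -
    have "k i < m" using that by (auto simp: \<K>_def)
    then have "real (k i) \<le> y" using m(1) by linarith
    then show ?thesis using y by (simp add: t_def)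
  qed
  define z where "z k = y / (\<Prod>i\<in>J. 1 + t k i / y)" for k
  define lo where "lo k i = (if i \<in> J then y + t k i else z k)" for k i
  define Box where "Box k = (\<Inter>i\<in>{1..n}. Z i -` {lo k i<..<lo k i + 1 / y} \<inter> space M)" for k
  let ?c = "(1 / sqrt (2 * pi)) ^ n * exp (- (8 * d + 4 * d\<^sup>2 + 3) / 2) * exp (- (real n / 2) * y\<^sup>2)"
  have Box_m: "Box k \<in> sets M" for k
    unfolding Box_def using n Z_m by (intro sets.finite_INT measurable_sets) auto
  have zpos: "0 < z k" if "k \<in> \<K>" for k
    unfolding z_def using sum_squares_near_diagonal(1)[OF J(1) y, of "t k"] t[OF that] by blast
  have lo_pos: "0 < lo k i" if "k \<in> \<K>" for k i
    using t[OF that, of i] zpos[OF that] y by (auto simp: lo_def)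
  have prob_Box: "(1 / y) ^ n * ?c \<le> prob (Box k)" if k: "k \<in> \<K>" for k
  proof -
    have "(\<Sum>i\<in>{1..n}. (lo k i + 1 / y)\<^sup>2) = (\<Sum>i\<in>J. (y + t k i + 1 / y)\<^sup>2) + (z k + 1 / y)\<^sup>2"
      using J by (simp add: lo_def)
    also have "\<dots> \<le> (d + 1) * y\<^sup>2 + (8 * d + 4 * d\<^sup>2 + 3)"
      using sum_squares_near_diagonal(2)[OF J(1) y, of "t k"] t[OF k] by (simp add: z_def d_def J(2))
    also have "(d + 1) * y\<^sup>2 = real n * y\<^sup>2" using n by (simp add: d_def of_nat_diff)
    finally have sq: "(\<Sum>i\<in>{1..n}. (lo k i + 1 / y)\<^sup>2) \<le> real n * y\<^sup>2 + (8 * d + 4 * d\<^sup>2 + 3)" .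
    have "(1 / y) ^ n * ?c = (1 / y) ^ n * (1 / sqrt (2 * pi)) ^ n * exp (- (real n * y\<^sup>2 + (8 * d + 4 * d\<^sup>2 + 3)) / 2)"
      by (simp add: exp_add[symmetric] algebra_simps add_divide_distrib diff_divide_distrib)
    also have "\<dots> \<le> (1 / y) ^ n * (1 / sqrt (2 * pi)) ^ n * exp (- (\<Sum>i\<in>{1..n}. (lo k i + 1 / y)\<^sup>2) / 2)"
      using sq y by (intro mult_left_mono) (auto intro!: mult_nonneg_nonneg)
    also have "\<dots> = (\<Prod>i\<in>{1..n}. (1 / y) * (exp (- (lo k i + 1 / y)\<^sup>2 / 2) / sqrt (2 * pi)))"
    proof -
      have "(\<Prod>i\<in>{1..n}. (1 / y) * (exp (- (lo k i + 1 / y)\<^sup>2 / 2) / sqrt (2 * pi)))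
          = (\<Prod>i\<in>{1..n}. ((1 / y) * (1 / sqrt (2 * pi))) * exp (- (lo k i + 1 / y)\<^sup>2 / 2))" by simp
      also have "\<dots> = ((1 / y) * (1 / sqrt (2 * pi))) ^ n * exp (\<Sum>i\<in>{1..n}. - (lo k i + 1 / y)\<^sup>2 / 2)"
        by (simp only: prod.distrib prod_constant exp_sum[OF finite_atLeastAtMost] card_atLeastAtMost diff_Suc_1 power_mult_distrib)
      also have "(\<Sum>i\<in>{1..n}. - (lo k i + 1 / y)\<^sup>2 / 2) = - (\<Sum>i\<in>{1..n}. (lo k i + 1 / y)\<^sup>2) / 2"
        by (simp only: sum_divide_distrib[symmetric] sum_negf)
      finally show ?thesis by (simp only: power_mult_distrib)
    qed
    also have "\<dots> \<le> (\<Prod>i\<in>{1..n}. measure std_gauss {lo k i<..<lo k i + 1 / y})"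
    proof (intro prod_mono conjI)
      fix i assume "i \<in> {1..n}"
      show "(1 / y) * (exp (- (lo k i + 1 / y)\<^sup>2 / 2) / sqrt (2 * pi)) \<le> measure std_gauss {lo k i<..<lo k i + 1 / y}"
        using std_gauss_interval_ge[of "lo k i" "lo k i + 1 / y"] lo_pos[OF k, of i] y by simp
    qed (use y in auto)
    also have "\<dots> = (\<Prod>i\<in>{1..n}. prob (Z i -` {lo k i<..<lo k i + 1 / y} \<inter> space M))"
    proof (intro prod.cong refl)
      fix i assume i: "i \<in> {1..n}"
      show "measure std_gauss {lo k i<..<lo k i + 1 / y} = prob (Z i -` {lo k i<..<lo k i + 1 / y} \<inter> space M)"
        using prob_normal_scaled[OF Z_norm[OF i], of "{lo k i<..<lo k i + 1 / y}"]
        by (simp add: vimage_def Int_def conj_commute)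
    qed
    also have "\<dots> = prob (Box k)"
      unfolding Box_def using n by (intro indep_varsD_finite[OF Z_ind, symmetric]) auto
    finally show ?thesis .
  qed
  have disj: "disjoint_family_on Box \<K>"
    unfolding disjoint_family_on_def
  proof (intro ballI impI, rule ccontr)
    fix k k' assume kk: "k \<in> \<K>" "k' \<in> \<K>" "k \<noteq> k'" and "Box k \<inter> Box k' \<noteq> {}"
    then obtain \<omega> where \<omega>: "\<omega> \<in> Box k" "\<omega> \<in> Box k'" by auto
    \<comment> \<open>The cubes are separated by a coordinate in \<open>J\<close>, where the
      intervals are translates by multiples of their length 1 / y; the last coordinate depends on
      all of \<open>k\<close> and need not separate them.\<close>
    obtain i where i: "i \<in> J" "k i \<noteq> k' i" using kk unfolding \<K>_def by (meson PiE_ext)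
    have in_n: "i \<in> {1..n}" using i J by auto
    have "y + real (k i) / y < Z i \<omega>" "Z i \<omega> < y + real (k i) / y + 1 / y"
      "y + real (k' i) / y < Z i \<omega>" "Z i \<omega> < y + real (k' i) / y + 1 / y"
    proof -
      have "lo k i < Z i \<omega>" "Z i \<omega> < lo k i + 1 / y" "lo k' i < Z i \<omega>" "Z i \<omega> < lo k' i + 1 / y"
        using \<omega> in_n unfolding Box_def by auto
      then show "y + real (k i) / y < Z i \<omega>" "Z i \<omega> < y + real (k i) / y + 1 / y"
        "y + real (k' i) / y < Z i \<omega>" "Z i \<omega> < y + real (k' i) / y + 1 / y"
        using i by (auto simp: lo_def t_def)
    qed
    then have "real (k i) / y < (real (k' i) + 1) / y" "real (k' i) / y < (real (k i) + 1) / y"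
      unfolding add_divide_distrib by linarith+
    then have "real (k i) < real (k' i) + 1" "real (k' i) < real (k i) + 1"
      using y by (auto simp: divide_less_cancel)
    then show False using i(2) by linarith
  qed
  have finK: "finite \<K>" and cardK: "card \<K> = m ^ (n - 1)"
    using J by (auto simp: \<K>_def card_PiE intro!: finite_PiE)
  have prod_ge: "y ^ n \<le> (\<Prod>i=1..n. Z i \<omega>)" if "k \<in> \<K>" "\<omega> \<in> Box k" for k \<omega>
  proof -
    have "(\<Prod>i=1..n. lo k i) = (\<Prod>i\<in>J. y + t k i) * z k"
      using J by (simp add: lo_def mult.commute)
    also have "(\<Prod>i\<in>J. y + t k i) = (\<Prod>i\<in>J. y * (1 + t k i / y))"
      using y by (intro prod.cong) (auto simp: field_simps)
    also have "\<dots> = y ^ (n - 1) * (\<Prod>i\<in>J. 1 + t k i / y)" using J by (simp add: prod.distrib)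
    also have "\<dots> * z k = y ^ (n - 1) * y"
      using zpos[OF that(1)] by (auto simp: z_def zero_less_divide_iff)
    also have "\<dots> = y ^ n" using n by (simp add: power_eq_if)
    finally have "y ^ n = (\<Prod>i=1..n. lo k i)" by simp
    also have "\<dots> \<le> (\<Prod>i=1..n. Z i \<omega>)"
      using that lo_pos by (intro prod_mono) (force simp: Box_def less_imp_le)
    finally show ?thesis .
  qed
  have "(1 / 2) ^ (n - 1) / y * ?c \<le> real (card \<K>) * ((1 / y) ^ n * ?c)"
  proof -
    \<comment> \<open>Number of cubes times volume: m^(n - 1) / y^n, with m \<ge> y / 2.\<close>
    have "(1 / 2) ^ (n - 1) / y = (y / 2) ^ (n - 1) * (1 / y) ^ n"
      using y n by (cases n) (auto simp: field_simps)
    also have "\<dots> \<le> real (card \<K>) * (1 / y) ^ n"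
      unfolding cardK of_nat_power using m y by (intro mult_right_mono power_mono) auto
    finally have "(1 / 2) ^ (n - 1) / y * ?c \<le> real (card \<K>) * (1 / y) ^ n * ?c"
      by (intro mult_right_mono) auto
    then show ?thesis by (simp add: mult.assoc)
  qed
  also have "\<dots> = (\<Sum>k\<in>\<K>. (1 / y) ^ n * ?c)" by simp
  also have "\<dots> \<le> (\<Sum>k\<in>\<K>. prob (Box k))" using prob_Box by (intro sum_mono)
  also have "\<dots> = prob (\<Union>k\<in>\<K>. Box k)"
    using finK Box_m disj by (intro finite_measure_finite_Union[symmetric]) auto
  also have "\<dots> \<le> prob {\<omega> \<in> space M. y ^ n \<le> (SUP u\<in>{0..1}. \<Prod>i=1..n. W i u \<omega>)}"
  proof (rule finite_measure_mono_AE)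
    show "AE \<omega> in M. \<omega> \<in> (\<Union>k\<in>\<K>. Box k) \<longrightarrow> \<omega> \<in> {\<omega> \<in> space M. y ^ n \<le> (SUP u\<in>{0..1}. \<Prod>i=1..n. W i u \<omega>)}"
      using AE_all_start_zero[OF W]
    proof eventually_elim
      case (elim \<omega>)
      show ?case
      proof
        assume "\<omega> \<in> (\<Union>k\<in>\<K>. Box k)"
        then obtain k where k: "k \<in> \<K>" "\<omega> \<in> Box k" by auto
        then have \<omega>: "\<omega> \<in> space M" using n by (auto simp: Box_def)
        have "(\<Prod>i=1..n. Z i \<omega>) = (\<Prod>i=1..n. W i 1 \<omega>)"
          using elim by (intro prod.cong) (auto simp: Z_def)
        with prod_ge[OF k] have "\<exists>u\<in>{0..1}. y ^ n \<le> (\<Prod>i=1..n. W i u \<omega>)"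
          by (intro bexI[of _ 1]) auto
        then show "\<omega> \<in> {\<omega> \<in> space M. y ^ n \<le> (SUP u\<in>{0..1}. \<Prod>i=1..n. W i u \<omega>)}"
          using \<omega> continuous_SUP_ge_iff[OF brownian_prod_continuous[OF W \<omega>]] by simp
      qed
    qed
    show "{\<omega> \<in> space M. y ^ n \<le> (SUP u\<in>{0..1}. \<Prod>i=1..n. W i u \<omega>)} \<in> sets M"
      by (intro borel_measurable_le sup_brownian_prod_measurable[OF W]) auto
  qed
  finally show ?thesis by (simp add: algebra_simps)
qed

subsection \<open>The lower bound for persistence\<close>

text \<open>
  Restricting to a dyadic grid makes this an event in finitely many increments; the unsimplified
  grid times match \<open>all_le_iff_all_dyadic_le\<close>.
\<close>

definition rises_and_stays :: "real \<Rightarrow> real \<Rightarrow> nat \<Rightarrow> (real \<Rightarrow> real) \<Rightarrow> bool" where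
  "rises_and_stays K \<delta> m y \<longleftrightarrow>
    (\<forall>k\<le>2 ^ m. \<bar>y (0 + (\<delta>\<^sup>2 - 0) * (real k / 2 ^ m)) - y 0\<bar> \<le> K * \<delta>) \<and> \<delta> \<le> y (\<delta>\<^sup>2) - y 0 \<and>
    (\<forall>k\<le>2 ^ m. - \<delta> \<le> y (\<delta>\<^sup>2 + (1 - \<delta>\<^sup>2) * (real k / 2 ^ m)) - y (\<delta>\<^sup>2))"

text \<open>Dyadic grids are nested, k / 2^m = 2 k / 2^(m + 1), so these events decrease in
  \<open>m\<close> and have a limit.\<close>

lemma rises_and_stays_Suc:
  assumes "rises_and_stays K \<delta> (Suc m) y"
  shows "rises_and_stays K \<delta> m y"
  unfolding rises_and_stays_def
proof (intro conjI allI impI)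
  have eq: "real (2 * k) / 2 ^ Suc m = real k / 2 ^ m" for k by simp
  fix k :: nat assume "k \<le> 2 ^ m"
  then have k: "2 * k \<le> 2 ^ Suc m" by simp
  show "\<bar>y (0 + (\<delta>\<^sup>2 - 0) * (real k / 2 ^ m)) - y 0\<bar> \<le> K * \<delta>"
    using assms k eq[of k] unfolding rises_and_stays_def by metis
  show "- \<delta> \<le> y (\<delta>\<^sup>2 + (1 - \<delta>\<^sup>2) * (real k / 2 ^ m)) - y (\<delta>\<^sup>2)"
    using assms k eq[of k] unfolding rises_and_stays_def by metis
qed (use assms in \<open>simp add: rises_and_stays_def\<close>)

text \<open>The behaviour before and after time \<open>\<delta>\<^sup>2\<close> is independent. The
  early part has probability at least p / 2 by Brownian scaling, the late part at least \<delta> / 4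
  by reflection; neither bound involves \<open>m\<close>.\<close>

lemma (in standard_brownian_motion) prob_rises_and_stays:
  assumes \<delta>: "0 < \<delta>" "\<delta> < 1"
  defines "p \<equiv> measure std_gauss {1..}"
  shows "p / 8 * \<delta> \<le> prob {\<omega> \<in> space M. rises_and_stays (8 / p) \<delta> m (\<lambda>t. W t \<omega>)}"
proof -
  have p: "0 < p" "p \<le> 1" unfolding p_def by (auto simp: std_gauss_tail_pos)
  \<comment> \<open>Chosen so that the Gaussian tail beyond \<open>K\<close>, which is at most 1 /
    K, is at most p / 8.\<close>
  define K where "K = 8 / p"
  have K: "0 < K" using p by (simp add: K_def)
  have tail_K: "measure std_gauss {K<..} \<le> p / 8"
  proof -
    have "measure std_gauss {K<..} \<le> measure std_gauss {K..}"
      by (intro std_gauss.finite_measure_mono) auto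
    also have "\<dots> \<le> exp (- K\<^sup>2 / 2) / K" by (rule std_gauss_tail_le[OF K])
    also have "\<dots> \<le> 1 / K" using K by (intro divide_right_mono) auto
    finally show ?thesis by (simp add: K_def)
  qed
  define N :: nat where "N = 2 ^ m"
  have N: "0 < N" by (simp add: N_def)
  have \<delta>2: "0 < \<delta>\<^sup>2" "\<delta>\<^sup>2 < 1" using \<delta> by (auto simp: power_less_one_iff)
  \<comment> \<open>Two dyadic grids glued at index \<open>N\<close>: \<open>N\<close> steps up to
    time \<open>\<delta>\<^sup>2\<close>, then \<open>N\<close> more up to time
    \<open>1\<close>.\<close>
  define \<tau> where "\<tau> j = (if j \<le> N then \<delta>\<^sup>2 * (real j / N) else \<delta>\<^sup>2 + (1 - \<delta>\<^sup>2) * (real (j - N) / N))" for j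
  have \<tau>0: "\<tau> 0 = 0" and \<tau>N: "\<tau> N = \<delta>\<^sup>2" and \<tau>1: "\<tau> (N + N) = 1"
    using N by (auto simp: \<tau>_def)
  have \<tau>_late: "\<tau> (N + k) = \<delta>\<^sup>2 + (1 - \<delta>\<^sup>2) * (real k / N)" for k
    using N by (auto simp: \<tau>_def)
  have \<tau>_step: "\<tau> j < \<tau> (Suc j)" for j
  proof -
    consider "Suc j \<le> N" | "N \<le> j" by linarith
    then show ?thesis
    proof cases
      case 1
      then show ?thesis using \<delta>2 N by (auto simp: \<tau>_def divide_strict_right_mono)
    next
      case 2
      then obtain k where "j = N + k" using le_Suc_ex by blast
      then show ?thesis using \<delta>2 N \<tau>_late[of k] \<tau>_late[of "Suc k"]
        by (auto simp: divide_strict_right_mono)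
    qed
  qed
  have mono: "strict_mono_on A \<tau>" for A
    using strict_mono_Suc_iff[of \<tau>] \<tau>_step by (auto simp: strict_mono_on_def strict_mono_def)
  interpret neg: standard_brownian_motion M "\<lambda>t \<omega>. - W t \<omega>"
    by (rule standard_brownian_motion_uminus) unfold_locales
  define X where "X j \<omega> = W (\<tau> (Suc j)) \<omega> - W (\<tau> j) \<omega>" for j \<omega>
  have X_ind: "indep_vars (\<lambda>_. borel) X {..<N + N}"
    using indep_increments[OF _ mono, of "N + N"] \<tau>0 by (simp add: X_def[abs_def])
  have tel: "(\<Sum>j<k. X j \<omega>) = W (\<tau> k) \<omega> - W 0 \<omega>" for k \<omega>
    using sum_lessThan_telescope[of "\<lambda>j. W (\<tau> j) \<omega>" k] by (simp add: X_def \<tau>0)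
  have tel_late: "(\<Sum>j\<in>{N..<N + k}. X j \<omega>) = W (\<tau> (N + k)) \<omega> - W (\<tau> N) \<omega>" for k \<omega>
    unfolding X_def by (rule sum_Suc_diff') simp
  have \<tau>_nn: "0 \<le> \<tau> k" for k
    using monotone_onD[OF mono[of UNIV], of 0 k] \<tau>0 by (cases "k = 0") auto
  have W_m: "W (\<tau> k) \<in> borel_measurable M" for k using measurable_at \<tau>_nn by auto
  have W0_m: "W 0 \<in> borel_measurable M" using measurable_at by auto
  \<comment> \<open>Early and late behaviour in terms of increments with index below
    \<open>N\<close> and from \<open>N\<close> on, which are independent blocks.\<close>
  define P where "P q \<longleftrightarrow> (\<forall>k\<in>{..N}. \<bar>\<Sum>j<k. q j\<bar> \<le> K * \<delta>) \<and> \<delta> \<le> (\<Sum>j<N. q j)" for q :: "nat \<Rightarrow> real"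
  define Q where "Q q \<longleftrightarrow> (\<forall>k\<in>{..N}. - \<delta> \<le> (\<Sum>j\<in>{N..<N + k}. q j))" for q :: "nat \<Rightarrow> real"
  have P_eq: "P (\<lambda>j\<in>{..<N}. X j \<omega>) \<longleftrightarrow> (\<forall>k\<in>{..N}. \<bar>W (\<tau> k) \<omega> - W 0 \<omega>\<bar> \<le> K * \<delta>) \<and> \<delta> \<le> W (\<tau> N) \<omega> - W 0 \<omega>" for \<omega>
  proof -
    have "(\<Sum>j<k. (\<lambda>j\<in>{..<N}. X j \<omega>) j) = W (\<tau> k) \<omega> - W 0 \<omega>" if "k \<le> N" for k
      unfolding tel[symmetric] using that by (intro sum.cong) auto
    then show ?thesis unfolding P_def by simp
  qed
  have Q_eq: "Q (\<lambda>j\<in>{N..<N + N}. X j \<omega>) \<longleftrightarrow> (\<forall>k\<in>{..N}. - \<delta> \<le> W (\<tau> (N + k)) \<omega> - W (\<tau> N) \<omega>)" for \<omega>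
  proof -
    have "(\<Sum>j\<in>{N..<N + k}. (\<lambda>j\<in>{N..<N + N}. X j \<omega>) j) = W (\<tau> (N + k)) \<omega> - W (\<tau> N) \<omega>" if "k \<le> N" for k
      unfolding tel_late[symmetric] using that by (intro sum.cong) auto
    then show ?thesis unfolding Q_def by simp
  qed
  have P_m: "Measurable.pred (PiM {..<N} (\<lambda>_. borel)) P"
    unfolding P_def pred_def
    by (intro sets.sets_Collect_conj sets.sets_Collect_finite_All borel_measurable_le borel_measurable_abs
        borel_measurable_sum measurable_component_singleton) auto
  have Q_m: "Measurable.pred (PiM {N..<N + N} (\<lambda>_. borel)) Q"
    unfolding Q_def pred_def
    by (intro sets.sets_Collect_finite_All borel_measurable_le
        borel_measurable_sum measurable_component_singleton) auto
  let ?A = "{\<omega> \<in> space M. (\<forall>k\<in>{..N}. \<bar>W (\<tau> k) \<omega> - W 0 \<omega>\<bar> \<le> K * \<delta>) \<and> \<delta> \<le> W (\<tau> N) \<omega> - W 0 \<omega>}"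
  let ?B = "{\<omega> \<in> space M. \<forall>k\<in>{..N}. - \<delta> \<le> W (\<tau> (N + k)) \<omega> - W (\<tau> N) \<omega>}"
  have A_m: "?A \<in> sets M"
    by (intro sets.sets_Collect_conj sets.sets_Collect_finite_All borel_measurable_le borel_measurable_abs
        borel_measurable_diff W_m W0_m) auto
  have prod: "prob {\<omega> \<in> space M. P (\<lambda>j\<in>{..<N}. X j \<omega>) \<and> Q (\<lambda>j\<in>{N..<N + N}. X j \<omega>)} = prob ?A * prob ?B"
    unfolding P_eq[symmetric] Q_eq[symmetric]
    by (rule indep_restrict_prob[OF X_ind _ _ _ P_m Q_m]) auto
  have A: "p / 2 \<le> prob ?A"
  proof -
    \<comment> \<open>Paths that leave the band of half-width \<open>K * \<delta>\<close> upwards;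
      \<open>V\<close> collects the downward ones. Each has probability at most 2 * (p / 8), so p /
      2 remains of the probability \<open>p\<close> of rising by \<delta>.\<close>
    define U where "U = {\<omega> \<in> space M. \<exists>k\<le>N. K * \<delta> < W (\<tau> k) \<omega> - W (\<tau> 0) \<omega>}"
    define V where "V = {\<omega> \<in> space M. \<exists>k\<le>N. K * \<delta> < - W (\<tau> k) \<omega> - - W (\<tau> 0) \<omega>}"
    have U_m: "U \<in> sets M"
    proof -
      have "{\<omega> \<in> space M. \<exists>k\<in>{..N}. K * \<delta> < W (\<tau> k) \<omega> - W (\<tau> 0) \<omega>} \<in> sets M"
        by (intro sets.sets_Collect_finite_Ex borel_measurable_less borel_measurable_diff W_m) auto
      then show ?thesis unfolding U_def by (simp only: Bex_def atMost_iff)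
    qed
    have V_m: "V \<in> sets M"
    proof -
      have "{\<omega> \<in> space M. \<exists>k\<in>{..N}. K * \<delta> < - W (\<tau> k) \<omega> - - W (\<tau> 0) \<omega>} \<in> sets M"
        by (intro sets.sets_Collect_finite_Ex borel_measurable_less borel_measurable_diff borel_measurable_uminus W_m) auto
      then show ?thesis unfolding V_def by (simp only: Bex_def atMost_iff)
    qed
    have scale: "K * \<delta> / sqrt (\<tau> N - \<tau> 0) = K" using \<delta> by (simp add: \<tau>0 \<tau>N)
    have U_le: "prob U \<le> p / 4"
      using Levy_grid[OF _ mono N, of "K * \<delta>"] tail_K unfolding U_def scale by (simp add: \<tau>0)
    have V_le: "prob V \<le> p / 4"
      using neg.Levy_grid[OF _ mono N, of "K * \<delta>"] tail_K unfolding V_def scale by (simp add: \<tau>0)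
    have "p = prob {\<omega> \<in> space M. \<delta> \<le> W (\<tau> N) \<omega> - W 0 \<omega>}"
      using prob_normal_ge(1)[OF normal_increments[of 0 "\<delta>\<^sup>2"], of 1] \<delta> by (simp add: \<tau>N p_def)
    also have "\<dots> \<le> prob (?A \<union> (U \<union> V))"
    proof (rule finite_measure_mono)
      show "{\<omega> \<in> space M. \<delta> \<le> W (\<tau> N) \<omega> - W 0 \<omega>} \<subseteq> ?A \<union> (U \<union> V)"
      proof
        fix \<omega> assume \<omega>: "\<omega> \<in> {\<omega> \<in> space M. \<delta> \<le> W (\<tau> N) \<omega> - W 0 \<omega>}"
        show "\<omega> \<in> ?A \<union> (U \<union> V)"
        proof (rule ccontr)
          assume no: "\<omega> \<notin> ?A \<union> (U \<union> V)"
          then have "\<bar>W (\<tau> k) \<omega> - W 0 \<omega>\<bar> \<le> K * \<delta>" if "k \<le> N" for k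
            using \<omega> that unfolding U_def V_def \<tau>0 by (force simp: abs_le_iff not_less)
          with no \<omega> show False by auto
        qed
      qed
    qed (intro sets.Un A_m U_m V_m)
    also have "\<dots> \<le> prob ?A + prob (U \<union> V)" by (intro measure_Un_le sets.Un A_m U_m V_m)
    also have "prob (U \<union> V) \<le> prob U + prob V" by (intro measure_Un_le U_m V_m)
    finally show ?thesis using U_le V_le by linarith
  qed
  have B: "\<delta> / 4 \<le> prob ?B"
  proof -
    define V where "V = {\<omega> \<in> space M. \<exists>k\<le>N. \<delta> < - W (\<tau> (N + k)) \<omega> - - W (\<tau> (N + 0)) \<omega>}"
    have V_m: "V \<in> sets M"
    proof -
      have "{\<omega> \<in> space M. \<exists>k\<in>{..N}. \<delta> < - W (\<tau> (N + k)) \<omega> - - W (\<tau> (N + 0)) \<omega>} \<in> sets M"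
        by (intro sets.sets_Collect_finite_Ex borel_measurable_less borel_measurable_diff borel_measurable_uminus W_m) auto
      then show ?thesis unfolding V_def by (simp only: Bex_def atMost_iff)
    qed
    have mono': "strict_mono_on {..N} (\<lambda>k. \<tau> (N + k))"
      using monotone_onD[OF mono[of UNIV]] by (auto simp: strict_mono_on_def)
    have "prob V \<le> 2 * measure std_gauss {\<delta> / sqrt (\<tau> (N + N) - \<tau> (N + 0))<..}"
      unfolding V_def using \<tau>_nn by (intro neg.Levy_grid[OF _ mono' N]) auto
    also have "\<dots> \<le> 2 * measure std_gauss {\<delta><..}"
    proof -
      \<comment> \<open>The late window is shorter than \<open>1\<close>, so the threshold \<delta>
        amounts to at least \<delta> standard deviations.\<close>
      have "\<delta> \<le> \<delta> / sqrt (1 - \<delta>\<^sup>2)"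
        using \<delta> \<delta>2 by (simp add: le_divide_eq)
      then show ?thesis by (intro mult_left_mono std_gauss.finite_measure_mono) (auto simp: \<tau>1 \<tau>N)
    qed
    finally have "\<delta> / 4 \<le> 1 - prob V" using std_gauss_reflected_ge[of \<delta>] \<delta> by simp
    also have "1 - prob V = prob (space M - V)" using prob_compl[OF V_m] by simp
    also have "space M - V = ?B"
    proof -
      have "\<not> \<delta> < - a - - b \<longleftrightarrow> - \<delta> \<le> a - b" for a b :: real by linarith
      then show ?thesis unfolding V_def by auto
    qed
    finally show ?thesis .
  qed
  have "p / 8 * \<delta> = p / 2 * (\<delta> / 4)" by simp
  also have "\<dots> \<le> prob ?A * prob ?B" using A B p \<delta> by (intro mult_mono) auto
  also have "\<dots> = prob {\<omega> \<in> space M. P (\<lambda>j\<in>{..<N}. X j \<omega>) \<and> Q (\<lambda>j\<in>{N..<N + N}. X j \<omega>)}"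
    by (rule prod[symmetric])
  also have "{\<omega> \<in> space M. P (\<lambda>j\<in>{..<N}. X j \<omega>) \<and> Q (\<lambda>j\<in>{N..<N + N}. X j \<omega>)}
      = {\<omega> \<in> space M. rises_and_stays (8 / p) \<delta> m (\<lambda>t. W t \<omega>)}"
  proof -
    have early: "\<tau> k = 0 + (\<delta>\<^sup>2 - 0) * (real k / 2 ^ m)" if "k \<le> N" for k
      using that by (simp add: \<tau>_def N_def)
    have late: "\<tau> (N + k) = \<delta>\<^sup>2 + (1 - \<delta>\<^sup>2) * (real k / 2 ^ m)" for k
      using \<tau>_late[of k] by (simp add: N_def)
    show ?thesis unfolding P_eq Q_eq rises_and_stays_def \<tau>N
      by (auto simp add: early late N_def[symmetric] K_def)
  qed
  finally show ?thesis .
qed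

text \<open>The processes \<open>s i * W i\<close> all rise by \<delta> and then lose at most
  \<delta>, so they are nonnegative from time \<open>\<delta>\<^sup>2\<close> on. Before that time
  the product is bounded by \<epsilon>; afterwards it is at most \<open>0\<close>.\<close>

lemma persistence_lower_bound:
  fixes n :: nat
  assumes W: "independent_brownian_motions M n W" and n: "1 \<le> n" and \<epsilon>: "0 < \<epsilon>" "\<epsilon> < 1"
  shows "((measure std_gauss {1..})\<^sup>2 / 64) ^ n * \<epsilon>
    \<le> measure M {\<omega> \<in> space M. (SUP u\<in>{0..1}. \<Prod>i=1..n. W i u \<omega>) \<le> \<epsilon>}"
proof -
  interpret prob_space M using independent_brownian_motionsD(1)[OF W] .
  note bm = independent_brownian_motionsD(2)[OF W]
  define p where "p = measure std_gauss {1..}"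
  have p: "0 < p" "p \<le> 1" unfolding p_def by (auto simp: std_gauss_tail_pos)
  define K where "K = 8 / p"
  have K: "8 \<le> K" using p by (simp add: K_def le_divide_eq)
  \<comment> \<open>Makes the early bound exact, (K * \<delta>)^n = \<epsilon>. The division by K =
    8 / p turns p / 8 into p^2 / 64 in the constant.\<close>
  define \<delta> where "\<delta> = root n \<epsilon> / K"
  have root: "0 < root n \<epsilon>" "root n \<epsilon> < 1" "root n \<epsilon> ^ n = \<epsilon>" using n \<epsilon> by auto
  have \<delta>: "0 < \<delta>" "\<delta> < 1" using root K by (auto simp: \<delta>_def)
  have K\<delta>: "K * \<delta> = root n \<epsilon>" using K by (simp add: \<delta>_def)
  have \<delta>2: "0 < \<delta>\<^sup>2" "\<delta>\<^sup>2 < 1" using \<delta> by (auto simp: power_less_one_iff)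
  \<comment> \<open>Exactly one sign is flipped, so the late product is at most \<open>0\<close>
    whatever the parity of \<open>n\<close>.\<close>
  define s :: "nat \<Rightarrow> real" where "s i = (if i = 1 then -1 else 1)" for i
  have s: "s i * s i = 1" "\<bar>s i\<bar> = 1" for i by (auto simp: s_def)
  let ?N = "PiM {0..} (\<lambda>_. borel) :: (real \<Rightarrow> real) measure"
  define A where "A m i = {y \<in> space ?N. rises_and_stays K \<delta> m (\<lambda>t. s i * y t)}" for m i
  define G where "G m = (\<Inter>i\<in>{1..n}. (\<lambda>\<omega>. \<lambda>t\<in>{0..}. W i t \<omega>) -` A m i \<inter> space M)" for m
  have early_nn: "0 \<le> 0 + (\<delta>\<^sup>2 - 0) * (real k / 2 ^ m)" for k m by simp
  have late_nn: "0 \<le> \<delta>\<^sup>2 + (1 - \<delta>\<^sup>2) * (real k / 2 ^ m)" for k m using \<delta>2 by simp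
  have A_m: "A m i \<in> sets ?N" for m i
  proof -
    have comp: "(\<lambda>y. s i * y t) \<in> borel_measurable ?N" if "0 \<le> t" for t
      using that by (intro borel_measurable_times measurable_component_singleton) auto
    have "{y \<in> space ?N. (\<forall>k\<in>{..2 ^ m}. \<bar>s i * y (0 + (\<delta>\<^sup>2 - 0) * (real k / 2 ^ m)) - s i * y 0\<bar> \<le> K * \<delta>) \<and> \<delta> \<le> s i * y (\<delta>\<^sup>2) - s i * y 0 \<and>
      (\<forall>k\<in>{..2 ^ m}. - \<delta> \<le> s i * y (\<delta>\<^sup>2 + (1 - \<delta>\<^sup>2) * (real k / 2 ^ m)) - s i * y (\<delta>\<^sup>2))} \<in> sets ?N"
      by (intro sets.sets_Collect_conj sets.sets_Collect_finite_All borel_measurable_le borel_measurable_abs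
          borel_measurable_diff comp early_nn late_nn borel_measurable_const finite_atMost zero_le_power2 order.refl)
    then show ?thesis unfolding A_def rises_and_stays_def by (simp only: Ball_def atMost_iff)
  qed
  have Y_m: "(\<lambda>\<omega>. \<lambda>t\<in>{0..}. W i t \<omega>) \<in> M \<rightarrow>\<^sub>M ?N" if "i \<in> {1..n}" for i
    using independent_brownian_motionsD(3)[OF W] that by (auto simp: indep_vars_def)
  have A_iff: "(\<lambda>t\<in>{0..}. W i t \<omega>) \<in> A m i \<longleftrightarrow> rises_and_stays K \<delta> m (\<lambda>t. s i * W i t \<omega>)"
    if "\<omega> \<in> space M" "i \<in> {1..n}" for i m \<omega>
  proof -
    have "rises_and_stays K \<delta> m (\<lambda>t. s i * (\<lambda>t\<in>{0..}. W i t \<omega>) t) \<longleftrightarrow> rises_and_stays K \<delta> m (\<lambda>t. s i * W i t \<omega>)"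
    proof -
      have r: "(\<lambda>t\<in>{0..}. W i t \<omega>) t = W i t \<omega>" if "0 \<le> t" for t using that by simp
      show ?thesis unfolding rises_and_stays_def r[OF early_nn] r[OF late_nn] r[OF order.refl] r[OF zero_le_power2] ..
    qed
    then show ?thesis using measurable_space[OF Y_m[OF that(2)] that(1)] by (simp add: A_def)
  qed
  have G_m: "G m \<in> sets M" for m
    unfolding G_def using n A_m Y_m by (intro sets.finite_INT measurable_sets) auto
  have "(p / 8 * \<delta>) ^ n \<le> prob (G m)" for m
  proof -
    have "(p / 8 * \<delta>) ^ n = (\<Prod>i\<in>{1..n}. p / 8 * \<delta>)" by simp
    also have "\<dots> \<le> (\<Prod>i\<in>{1..n}. prob ((\<lambda>\<omega>. \<lambda>t\<in>{0..}. W i t \<omega>) -` A m i \<inter> space M))"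
    proof (intro prod_mono conjI)
      fix i assume i: "i \<in> {1..n}"
      have "standard_brownian_motion M (\<lambda>t \<omega>. s i * W i t \<omega>)"
        using bm[OF i] standard_brownian_motion_uminus[OF bm[OF i]] by (cases "i = 1") (auto simp: s_def)
      from standard_brownian_motion.prob_rises_and_stays[OF this \<delta>, of m]
      have "p / 8 * \<delta> \<le> prob {\<omega> \<in> space M. rises_and_stays K \<delta> m (\<lambda>t. s i * W i t \<omega>)}"
        by (simp add: p_def K_def)
      also have "{\<omega> \<in> space M. rises_and_stays K \<delta> m (\<lambda>t. s i * W i t \<omega>)}
          = (\<lambda>\<omega>. \<lambda>t\<in>{0..}. W i t \<omega>) -` A m i \<inter> space M"
        using A_iff[OF _ i] by blast
      finally show "p / 8 * \<delta> \<le> prob ((\<lambda>\<omega>. \<lambda>t\<in>{0..}. W i t \<omega>) -` A m i \<inter> space M)" .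
    qed (use p \<delta> in auto)
    also have "\<dots> = prob (G m)"
      unfolding G_def using n A_m
      by (intro indep_varsD_finite[OF independent_brownian_motionsD(3)[OF W], symmetric]) auto
    finally show ?thesis .
  qed
  \<comment> \<open>The lower bound does not depend on \<open>m\<close>, so it survives the passage
    to the intersection of all dyadic events.\<close>
  moreover have "(\<lambda>m. prob (G m)) \<longlonglongrightarrow> prob (\<Inter>m. G m)"
  proof (rule finite_Lim_measure_decseq)
    show "decseq G"
    proof (rule decseq_SucI)
      fix m
      have "A (Suc m) i \<subseteq> A m i" for i unfolding A_def using rises_and_stays_Suc by blast
      then show "G (Suc m) \<subseteq> G m" unfolding G_def by (intro INF_mono) blast
    qed
  qed (use G_m in auto)
  ultimately have "(p / 8 * \<delta>) ^ n \<le> prob (\<Inter>m. G m)"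
    by (intro tendsto_lowerbound[of "\<lambda>m. prob (G m)"]) auto
  also have "\<dots> \<le> prob {\<omega> \<in> space M. (SUP u\<in>{0..1}. \<Prod>i=1..n. W i u \<omega>) \<le> \<epsilon>}"
  proof (rule finite_measure_mono_AE)
    show "{\<omega> \<in> space M. (SUP u\<in>{0..1}. \<Prod>i=1..n. W i u \<omega>) \<le> \<epsilon>} \<in> sets M"
      by (intro borel_measurable_le sup_brownian_prod_measurable[OF W]) auto
    show "AE \<omega> in M. \<omega> \<in> (\<Inter>m. G m) \<longrightarrow> \<omega> \<in> {\<omega> \<in> space M. (SUP u\<in>{0..1}. \<Prod>i=1..n. W i u \<omega>) \<le> \<epsilon>}"
      using AE_all_start_zero[OF W]
    proof (eventually_elim, intro impI)
      fix \<omega> assume zero: "\<forall>i\<in>{1..n}. W i 0 \<omega> = 0" and \<omega>G: "\<omega> \<in> (\<Inter>m. G m)"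
      have "\<omega> \<in> G 0" using \<omega>G by blast
      then have \<omega>: "\<omega> \<in> space M" using n by (auto simp: G_def)
      define V where "V i t = s i * W i t \<omega>" for i t
      have V_rises: "rises_and_stays K \<delta> m (V i)" if "i \<in> {1..n}" for i m
      proof -
        have "\<omega> \<in> G m" using \<omega>G by blast
        then show ?thesis using that A_iff[OF \<omega> that, of m] unfolding G_def V_def[abs_def] by blast
      qed
      have V0: "V i 0 = 0" if "i \<in> {1..n}" for i using zero that by (simp add: V_def)
      have V_cont: "continuous_on {a..b} (V i)" if "i \<in> {1..n}" "0 \<le> a" for i a b
      proof -
        have "continuous_on {0..} (V i)"
          unfolding V_def[abs_def]
          by (intro continuous_intros standard_brownian_motion.continuous_paths[OF bm[OF that(1)] \<omega>])
        then show ?thesis by (rule continuous_on_subset) (use that in auto)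
      qed
      have early: "\<bar>V i u\<bar> \<le> K * \<delta>" if i: "i \<in> {1..n}" and u: "u \<in> {0..\<delta>\<^sup>2}" for i u
      proof -
        have "\<forall>u\<in>{0..\<delta>\<^sup>2}. \<bar>V i u - V i 0\<bar> \<le> K * \<delta>"
          using V_rises[OF i] V_cont[OF i]
          by (subst all_le_iff_all_dyadic_le) (auto simp: rises_and_stays_def intro!: continuous_on_rabs continuous_on_diff continuous_on_const)
        then show ?thesis using u V0[OF i] by auto
      qed
      have late: "0 \<le> V i u" if i: "i \<in> {1..n}" and u: "u \<in> {\<delta>\<^sup>2..1}" for i u
      proof -
        \<comment> \<open>Written as an upper bound on the drop since time
          \<open>\<delta>\<^sup>2\<close>, the form to which the dyadic criterion applies.\<close>
        have "\<forall>u\<in>{\<delta>\<^sup>2..1}. V i (\<delta>\<^sup>2) - V i u \<le> \<delta>"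
          using V_rises[OF i] V_cont[OF i] \<delta>2
          by (subst all_le_iff_all_dyadic_le) (auto simp: rises_and_stays_def algebra_simps intro!: continuous_on_diff continuous_on_const)
        moreover have "\<delta> \<le> V i (\<delta>\<^sup>2)" using V_rises[OF i, of 0] V0[OF i] by (simp add: rises_and_stays_def)
        ultimately show ?thesis using u by (smt (verit, best))
      qed
      have "(\<Prod>i=1..n. W i u \<omega>) \<le> \<epsilon>" if u: "u \<in> {0..1}" for u
      proof (cases "u \<le> \<delta>\<^sup>2")
        case True
        have "(\<Prod>i=1..n. W i u \<omega>) \<le> (\<Prod>i=1..n. \<bar>W i u \<omega>\<bar>)"
          by (metis abs_ge_self abs_prod)
        also have "\<dots> = (\<Prod>i=1..n. \<bar>V i u\<bar>)" by (simp add: V_def abs_mult s)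
        also have "\<dots> \<le> (\<Prod>i=1..n. K * \<delta>)" using early u True by (intro prod_mono) auto
        also have "\<dots> = \<epsilon>" using root by (simp add: K\<delta>)
        finally show ?thesis .
      next
        case False
        have W_V: "W i u \<omega> = s i * V i u" for i
          unfolding V_def mult.assoc[symmetric] s(1) by simp
        have "(\<Prod>i=1..n. s i) = -1"
          unfolding s_def using n by (subst prod.delta) auto
        then have "(\<Prod>i=1..n. W i u \<omega>) = - (\<Prod>i=1..n. V i u)"
          unfolding W_V prod.distrib by simp
        moreover have "0 \<le> (\<Prod>i=1..n. V i u)" using late u False by (intro prod_nonneg) auto
        ultimately show ?thesis using \<epsilon> by simp
      qed
      then show "\<omega> \<in> {\<omega> \<in> space M. (SUP u\<in>{0..1}. \<Prod>i=1..n. W i u \<omega>) \<le> \<epsilon>}"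
        using \<omega> continuous_SUP_le_iff[OF brownian_prod_continuous[OF W \<omega>]] by blast
    qed
  qed
  also have "(p / 8 * \<delta>) ^ n = (p\<^sup>2 / 64) ^ n * \<epsilon>"
  proof -
    have "p / 8 * \<delta> = p\<^sup>2 / 64 * root n \<epsilon>" using p by (simp add: \<delta>_def K_def power2_eq_square)
    then show ?thesis using root(3) by (simp only: power_mult_distrib)
  qed
  finally show ?thesis by (simp add: p_def)
qed

text \<open>The four bounds depend on the processes through \<open>n\<close> only, so the constants
  are fixed before \<open>M\<close> and \<open>W\<close>. The thresholds are x = 1, where y \<ge> 1
  as the cubes require, and \<epsilon> = exp (-1), below which |ln \<epsilon>| > 1.\<close>

theorem theorem1:
  fixes n :: nat
  assumes "1 \<le> n"
  shows "\<exists>\<kappa>\<^sub>1 \<kappa>\<^sub>2 x\<^sub>0 \<epsilon>\<^sub>0 :: real.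
    0 < \<kappa>\<^sub>1 \<and> \<kappa>\<^sub>1 \<le> \<kappa>\<^sub>2 \<and> 0 < x\<^sub>0 \<and> 0 < \<epsilon>\<^sub>0 \<and> \<epsilon>\<^sub>0 < 1 \<and>
    (\<forall>(M :: 'a measure) (W :: nat \<Rightarrow> real \<Rightarrow> 'a \<Rightarrow> real). independent_brownian_motions M n W \<longrightarrow>
      (\<forall>x\<ge>x\<^sub>0.
        \<kappa>\<^sub>1 * x powr (- 1 / real n) * exp (- (real n / 2) * x powr (2 / real n))
          \<le> \<P>(\<omega> in M. (SUP u\<in>{0..1}. \<Prod>i=1..n. W i u \<omega>) \<ge> x) \<and>
        \<P>(\<omega> in M. (SUP u\<in>{0..1}. \<Prod>i=1..n. W i u \<omega>) \<ge> x)
          \<le> \<kappa>\<^sub>2 * x powr (- 1 / real n) * exp (- (real n / 2) * x powr (2 / real n))) \<and>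
      (\<forall>\<epsilon>. 0 < \<epsilon> \<and> \<epsilon> < \<epsilon>\<^sub>0 \<longrightarrow>
        \<kappa>\<^sub>1 * \<epsilon> \<le> \<P>(\<omega> in M. (SUP u\<in>{0..1}. \<Prod>i=1..n. W i u \<omega>) \<le> \<epsilon>) \<and>
        \<P>(\<omega> in M. (SUP u\<in>{0..1}. \<Prod>i=1..n. W i u \<omega>) \<le> \<epsilon>) \<le> \<kappa>\<^sub>2 * \<epsilon> * \<bar>ln \<epsilon>\<bar> ^ n))"
proof -
  let ?d = "real (n - 1)"
  define c\<^sub>1 where "c\<^sub>1 = (1 / 2) ^ (n - 1) * (1 / sqrt (2 * pi)) ^ n * exp (- (8 * ?d + 4 * ?d\<^sup>2 + 3) / 2)"
  define c\<^sub>2 where "c\<^sub>2 = ((measure std_gauss {1..})\<^sup>2 / 64) ^ n"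
  define C\<^sub>1 :: real where "C\<^sub>1 = 2 ^ (n + 1)"
  define C\<^sub>2 where "C\<^sub>2 = 3 * (1 / - ln (1 - measure std_gauss {1..} ^ n) + 1) ^ n + 1"
  define \<kappa>\<^sub>1 where "\<kappa>\<^sub>1 = min c\<^sub>1 c\<^sub>2"
  \<comment> \<open>Including the lower constant in the maximum secures their order without
    comparing the four constants.\<close>
  define \<kappa>\<^sub>2 where "\<kappa>\<^sub>2 = max \<kappa>\<^sub>1 (max C\<^sub>1 C\<^sub>2)"
  have "0 < c\<^sub>1" by (simp add: c\<^sub>1_def)
  moreover have "0 < c\<^sub>2" using std_gauss_tail_pos[of 1] by (simp add: c\<^sub>2_def)
  ultimately have \<kappa>: "0 < \<kappa>\<^sub>1" "\<kappa>\<^sub>1 \<le> \<kappa>\<^sub>2" "\<kappa>\<^sub>1 \<le> c\<^sub>1" "\<kappa>\<^sub>1 \<le> c\<^sub>2" "C\<^sub>1 \<le> \<kappa>\<^sub>2" "C\<^sub>2 \<le> \<kappa>\<^sub>2"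
    by (auto simp: \<kappa>\<^sub>1_def \<kappa>\<^sub>2_def)
  have dev: "\<kappa>\<^sub>1 * x powr (- 1 / real n) * exp (- (real n / 2) * x powr (2 / real n))
          \<le> \<P>(\<omega> in M. (SUP u\<in>{0..1}. \<Prod>i=1..n. W i u \<omega>) \<ge> x) \<and>
        \<P>(\<omega> in M. (SUP u\<in>{0..1}. \<Prod>i=1..n. W i u \<omega>) \<ge> x)
          \<le> \<kappa>\<^sub>2 * x powr (- 1 / real n) * exp (- (real n / 2) * x powr (2 / real n))"
    if W: "independent_brownian_motions M n W" and x: "1 \<le> x" for M :: "'a measure" and W x
  proof -
    \<comment> \<open>The scale of a single coordinate when all n coordinates share the product
      \<open>x\<close> equally.\<close>
    define y where "y = x powr (1 / real n)"
    have y: "1 \<le> y" using x assms by (simp add: y_def ge_one_powr_ge_zero)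
    have yn: "y ^ n = x" using x assms by (simp add: y_def powr_power)
    have y2: "x powr (2 / real n) = y\<^sup>2" using x by (simp add: y_def powr_power)
    have y1: "x powr (- 1 / real n) = 1 / y" using x by (simp add: y_def powr_minus_divide)
    let ?e = "exp (- (real n / 2) * y\<^sup>2)"
    have "\<kappa>\<^sub>1 * (1 / y) * ?e \<le> c\<^sub>1 * (1 / y) * ?e" using \<kappa> y by (intro mult_right_mono) auto
    also have "\<dots> \<le> \<P>(\<omega> in M. (SUP u\<in>{0..1}. \<Prod>i=1..n. W i u \<omega>) \<ge> y ^ n)"
      using deviation_lower_bound[OF W assms y] by (simp add: c\<^sub>1_def)
    finally have 1: "\<kappa>\<^sub>1 * (1 / y) * ?e \<le> \<P>(\<omega> in M. (SUP u\<in>{0..1}. \<Prod>i=1..n. W i u \<omega>) \<ge> y ^ n)" .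
    have "\<P>(\<omega> in M. (SUP u\<in>{0..1}. \<Prod>i=1..n. W i u \<omega>) \<ge> y ^ n) \<le> C\<^sub>1 * (1 / y) * ?e"
      using deviation_upper_bound[OF W assms, of y] y by (simp add: C\<^sub>1_def)
    also have "\<dots> \<le> \<kappa>\<^sub>2 * (1 / y) * ?e" using \<kappa> y by (intro mult_right_mono) auto
    finally show ?thesis using 1 unfolding y1 y2 yn by blast
  qed
  have per: "\<kappa>\<^sub>1 * \<epsilon> \<le> \<P>(\<omega> in M. (SUP u\<in>{0..1}. \<Prod>i=1..n. W i u \<omega>) \<le> \<epsilon>) \<and>
        \<P>(\<omega> in M. (SUP u\<in>{0..1}. \<Prod>i=1..n. W i u \<omega>) \<le> \<epsilon>) \<le> \<kappa>\<^sub>2 * \<epsilon> * \<bar>ln \<epsilon>\<bar> ^ n"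
    if W: "independent_brownian_motions M n W" and \<epsilon>: "0 < \<epsilon>" "\<epsilon> < exp (- 1)" for M :: "'a measure" and W \<epsilon>
  proof
    have "\<epsilon> < 1" using \<epsilon>(2) by (rule less_trans) simp
    have "\<kappa>\<^sub>1 * \<epsilon> \<le> c\<^sub>2 * \<epsilon>" using \<kappa> \<epsilon> by (intro mult_right_mono) auto
    also have "\<dots> \<le> \<P>(\<omega> in M. (SUP u\<in>{0..1}. \<Prod>i=1..n. W i u \<omega>) \<le> \<epsilon>)"
      using persistence_lower_bound[OF W assms \<epsilon>(1) \<open>\<epsilon> < 1\<close>] by (simp add: c\<^sub>2_def)
    finally show "\<kappa>\<^sub>1 * \<epsilon> \<le> \<dots>" .
    have "\<P>(\<omega> in M. (SUP u\<in>{0..1}. \<Prod>i=1..n. W i u \<omega>) \<le> \<epsilon>) \<le> C\<^sub>2 * \<epsilon> * \<bar>ln \<epsilon>\<bar> ^ n"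
      using persistence_upper_bound[OF W assms \<epsilon>] by (simp add: C\<^sub>2_def)
    also have "\<dots> \<le> \<kappa>\<^sub>2 * \<epsilon> * \<bar>ln \<epsilon>\<bar> ^ n" using \<kappa> \<epsilon> by (intro mult_right_mono) auto
    finally show "\<P>(\<omega> in M. (SUP u\<in>{0..1}. \<Prod>i=1..n. W i u \<omega>) \<le> \<epsilon>) \<le> \<kappa>\<^sub>2 * \<epsilon> * \<bar>ln \<epsilon>\<bar> ^ n" .
  qed
  show ?thesis
  proof (rule exI[of _ \<kappa>\<^sub>1], rule exI[of _ \<kappa>\<^sub>2], rule exI[of _ 1], rule exI[of _ "exp (- 1)"],
      intro conjI allI impI)
    fix M :: "'a measure" and W and \<epsilon> :: real
    assume W: "independent_brownian_motions M n W" and "0 < \<epsilon> \<and> \<epsilon> < exp (- 1)"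
    then have \<epsilon>: "0 < \<epsilon>" "\<epsilon> < exp (- 1)" by auto
    show "\<kappa>\<^sub>1 * \<epsilon> \<le> \<P>(\<omega> in M. (SUP u\<in>{0..1}. \<Prod>i=1..n. W i u \<omega>) \<le> \<epsilon>)"
      "\<P>(\<omega> in M. (SUP u\<in>{0..1}. \<Prod>i=1..n. W i u \<omega>) \<le> \<epsilon>) \<le> \<kappa>\<^sub>2 * \<epsilon> * \<bar>ln \<epsilon>\<bar> ^ n"
      using per[OF W \<epsilon>] by blast+
  next
    fix M :: "'a measure" and W and x :: real
    assume W: "independent_brownian_motions M n W" and x: "1 \<le> x"
    show "\<kappa>\<^sub>1 * x powr (- 1 / real n) * exp (- (real n / 2) * x powr (2 / real n))
        \<le> \<P>(\<omega> in M. (SUP u\<in>{0..1}. \<Prod>i=1..n. W i u \<omega>) \<ge> x)"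
      "\<P>(\<omega> in M. (SUP u\<in>{0..1}. \<Prod>i=1..n. W i u \<omega>) \<ge> x)
        \<le> \<kappa>\<^sub>2 * x powr (- 1 / real n) * exp (- (real n / 2) * x powr (2 / real n))"
      using dev[OF W x] by blast+
  qed (use \<kappa>(1,2) in simp_all)
qed

end
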